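(* For each real $\ell>3$, there exists $a_\ell\in(0,1)$ such that $F_{a_\ell}:=f_{a_\ell,-a_\ell}$ is a positive symmetric bimodal map with Fibonacci combinatorics. Its critical points are $d=-1/3$ and $c=1/3$, both of critical order $\ell$. Here $f_{u,v}=f^{(\ell)}_{u,v}$ is the two-parameter family defined in the context.
   Context: **Bimodal maps.** A $C^1$ map $f:[-1,1]\to[-1,1]$ is *bimodal* if $f(\{-1,1\})=\{-1,1\}$, $f$ has exactly two critical points $-1<d<c<1$, both are turning points, and $f$ is strictly monotone on each of the three intervals determined by $d$ and $c$. It is *positive* if $-1,1$ are fixed, and *symmetric* if it is odd. A critical point $\widetilde c$ has *critical order* $\ell>1$ if there exist $C^3$ diffeomorphisms $\phi,\psi$ near $0$ with $\phi(0)=\widetilde c$, $\psi(0)=f(\widetilde c)$ and $|\psi^{-1}\circ f\circ\phi(x)|=|x|^\ell$ for all small $|x|$. **Fibonacci combinatorics (positive maps).** Let $f$ be a positive bimodal map with recurrent non-periodic critical points $d<c$. Then $f$ has a unique fixed point $p\in(d,c)$; it has three distinct preimages $p_1<d<p_2=p<c<p_3$. Put $U^0=(p_1,p_2)$, $V^0=(p_2,p_3)$. For $k\ge1$ let $\phi_k$ be the first return map (under $f$) of $U^{k-1}\cup V^{k-1}$, and let $U^k\ni d$, $V^k\ni c$ be the components of its domain containing $d$, $c$. Let $r_k,t_k$ be the return times with $\phi_k(d)=f^{r_k}(d)$, $\phi_k(c)=f^{t_k}(c)$. Then $f$ has *Fibonacci combinatorics* if $r_k,t_k$ are defined and $r_k=t_k=S_k$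 for all $k\ge1$, where $S_1=2$, $S_2=3$, $S_{k+1}=S_k+S_{k-1}$. **The family.** Fix $\ell>1$, $d=-1/3$, $c=1/3$ and $\Delta_*=\{(u,v):-1\le v<u\le1\}$. Let $\rho_\ell(t)=t|t|^{\ell-2}$ for $t\ne0$, $\rho_\ell(0)=0$, and $q_\ell(x)=\rho_\ell(x-d)\rho_\ell(x-c)$. Fix non-negative $C^\infty$ functions $\eta_L,\eta_M,\eta_R$ with supports compactly contained in $(-1,d)$, $(d,c)$, $(c,1)$ respectively, with $\eta_R(x)=\eta_L(-x)$, $\eta_M(x)=\eta_M(-x)$, normalized so that $$\int_{-1}^{d}\eta_Lq_\ell\,dx=-\int_d^c\eta_Mq_\ell\,dx=\int_c^1\eta_Rq_\ell\,dx=1.$$ Put $B_L=\int_{-1}^dq_\ell\,dx$, $B_M=-\int_d^cq_\ell\,dx$, $B_R=\int_c^1q_\ell\,dx$, and for $(u,v)\in\Delta_*$ put $\delta_L=u+1$, $\delta_M=u-v$, $\delta_R=1-v$. Fix a positive continuous function $\varepsilon:\Delta_*\to(0,\infty)$ which extends continuously to $\overline{\Delta_*}$, satisfies $\varepsilon(-v,-u)=\varepsilon(u,v)$ and $\varepsilon(u,v)B_i<\delta_i$ for $i=L,M,R$. (For example, $\varepsilon(u,v)=\frac14\prod_{i\in\{L,M,R\}}\frac{\delta_i}{(1+B_i)(1+\delta_i)}$.) Set $a_i(u,v)=\delta_i-\varepsilon(u,v)B_i>0$, $$W_{u,v}(x)=\varepsilon(u,v)+\sum_{i\in\{L,M,R\}}a_i(u,v)\eta_i(x),\qquad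 f_{u,v}(x)=-1+\int_{-1}^xW_{u,v}(t)q_\ell(t)\,dt,\quad x\in[-1,1].$$ *)

theory Defs
  imports "HOL-Analysis.Analysis"
begin

section \<open>Smoothness of real functions on open sets\<close>

definition Ck_on :: "nat \<Rightarrow> (real \<Rightarrow> real) \<Rightarrow> real set \<Rightarrow> bool" where
  "Ck_on k g S \<longleftrightarrow>
     open S \<and> (\<forall>j<k. (deriv ^^ j) g differentiable_on S) \<and> continuous_on S ((deriv ^^ k) g)"

definition smooth :: "(real \<Rightarrow> real) \<Rightarrow> bool" where
  "smooth g \<longleftrightarrow> (\<forall>k. Ck_on k g UNIV)"

definition Ck_diffeo :: "nat \<Rightarrow> real set \<Rightarrow> real set \<Rightarrow> (real \<Rightarrow> real) \<Rightarrow> (real \<Rightarrow> real) \<Rightarrow> bool" where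
  "Ck_diffeo k U V g h \<longleftrightarrow> homeomorphism U V g h \<and> Ck_on k g U \<and> Ck_on k h V"

section \<open>Bimodal maps\<close>

text \<open>
  A self-map of the interval \<open>[-1,1]\<close> is a function on all reals of which only the values on
  \<open>{-1..1}\<close> matter; derivatives are taken within \<open>{-1..1}\<close>, hence one-sided at \<open>-1\<close> and \<open>1\<close>.
\<close>

definition C1_self_map :: "(real \<Rightarrow> real) \<Rightarrow> bool" where
  "C1_self_map f \<longleftrightarrow>
     f ` {-1..1} \<subseteq> {-1..1} \<and>
     (\<exists>f'. continuous_on {-1..1} f' \<and>
        (\<forall>x\<in>{-1..1}. (f has_real_derivative f' x) (at x within {-1..1})))"

definition critical_points :: "(real \<Rightarrow> real) \<Rightarrow> real set" where
  "critical_points f = {x \<in> {-1..1}. (f has_real_derivative 0) (at x within {-1..1})}"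

definition turning_point :: "(real \<Rightarrow> real) \<Rightarrow> real \<Rightarrow> bool" where
  "turning_point f x \<longleftrightarrow>
     x \<in> {-1<..<1} \<and>
     ((\<forall>\<^sub>F y in nhds x. f y \<le> f x) \<or> (\<forall>\<^sub>F y in nhds x. f x \<le> f y))"

definition strictly_monotone_on :: "real set \<Rightarrow> (real \<Rightarrow> real) \<Rightarrow> bool" where
  "strictly_monotone_on S f \<longleftrightarrow> strict_mono_on S f \<or> strict_antimono_on S f"

definition bimodal :: "(real \<Rightarrow> real) \<Rightarrow> real \<Rightarrow> real \<Rightarrow> bool" where
  "bimodal f d c \<longleftrightarrow>
     C1_self_map f \<and> f ` {-1, 1} = {-1, 1} \<and>
     -1 < d \<and> d < c \<and> c < 1 \<and> critical_points f = {d, c} \<and>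
     turning_point f d \<and> turning_point f c \<and>
     strictly_monotone_on {-1..d} f \<and> strictly_monotone_on {d..c} f \<and>
     strictly_monotone_on {c..1} f"

definition positive_map :: "(real \<Rightarrow> real) \<Rightarrow> bool" where
  "positive_map f \<longleftrightarrow> f (-1) = -1 \<and> f 1 = 1"

definition symmetric_map :: "(real \<Rightarrow> real) \<Rightarrow> bool" where
  "symmetric_map f \<longleftrightarrow> (\<forall>x\<in>{-1..1}. f (- x) = - f x)"

text \<open>
  \<open>\<phi>'\<close> and \<open>\<psi>'\<close> are the inverses of the local diffeomorphisms \<open>\<phi>\<close> and \<open>\<psi>\<close>.
\<close>

definition has_critical_order :: "(real \<Rightarrow> real) \<Rightarrow> real \<Rightarrow> real \<Rightarrow> bool" where
  "has_critical_order f x l \<longleftrightarrow>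
     l > 1 \<and>
     (\<exists>\<phi> \<phi>' U V \<psi> \<psi>' X Y.
        Ck_diffeo 3 U V \<phi> \<phi>' \<and> 0 \<in> U \<and> \<phi> 0 = x \<and>
        Ck_diffeo 3 X Y \<psi> \<psi>' \<and> 0 \<in> X \<and> \<psi> 0 = f x \<and>
        (\<forall>\<^sub>F t in nhds 0. f (\<phi> t) \<in> Y \<and> \<bar>\<psi>' (f (\<phi> t))\<bar> = \<bar>t\<bar> powr l))"

section \<open>Fibonacci combinatorics\<close>

definition recurrent :: "(real \<Rightarrow> real) \<Rightarrow> real \<Rightarrow> bool" where
  "recurrent f x \<longleftrightarrow> (\<forall>e>0. \<exists>\<^sub>F n in sequentially. dist ((f ^^ n) x) x < e)"

definition periodic :: "(real \<Rightarrow> real) \<Rightarrow> real \<Rightarrow> bool" where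
  "periodic f x \<longleftrightarrow> (\<exists>n\<ge>1. (f ^^ n) x = x)"

definition return_domain :: "(real \<Rightarrow> real) \<Rightarrow> real set \<Rightarrow> real set" where
  "return_domain f A = {x \<in> A. \<exists>n\<ge>1. (f ^^ n) x \<in> A}"

definition return_time :: "(real \<Rightarrow> real) \<Rightarrow> real set \<Rightarrow> real \<Rightarrow> nat" where
  "return_time f A x = (LEAST n. n \<ge> 1 \<and> (f ^^ n) x \<in> A)"

text \<open>
  The pair of nests \<open>(U\<^sup>k, V\<^sup>k)\<close> around \<open>d\<close> and \<open>c\<close>; a component is empty if the critical point
  does not lie in the domain of the first return map.
\<close>

primrec return_nest ::
  "(real \<Rightarrow> real) \<Rightarrow> real \<Rightarrow> real \<Rightarrow> real \<Rightarrow> real \<Rightarrow> real \<Rightarrow> nat \<Rightarrow> real set \<times> real set" where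
  "return_nest f d c p1 p2 p3 0 = ({p1<..<p2}, {p2<..<p3})"
| "return_nest f d c p1 p2 p3 (Suc k) =
     (let D = return_domain f
                (fst (return_nest f d c p1 p2 p3 k) \<union> snd (return_nest f d c p1 p2 p3 k))
      in (connected_component_set D d, connected_component_set D c))"

definition nest_union ::
  "(real \<Rightarrow> real) \<Rightarrow> real \<Rightarrow> real \<Rightarrow> real \<Rightarrow> real \<Rightarrow> real \<Rightarrow> nat \<Rightarrow> real set" where
  "nest_union f d c p1 p2 p3 k =
     fst (return_nest f d c p1 p2 p3 k) \<union> snd (return_nest f d c p1 p2 p3 k)"

text \<open>The value at \<open>0\<close> only seeds the recursion, so that the values at \<open>1, 2\<close> are \<open>2, 3\<close>.\<close>

fun fib_time :: "nat \<Rightarrow> nat" where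
  "fib_time 0 = 1"
| "fib_time (Suc 0) = 2"
| "fib_time (Suc (Suc k)) = fib_time (Suc k) + fib_time k"

text \<open>
  The points \<open>p1\<close>, \<open>p\<close>, \<open>p3\<close> are determined by the two set equations. Membership of \<open>d\<close> and \<open>c\<close>
  in the return domain says that the return times are defined.
\<close>

definition fibonacci_combinatorics :: "(real \<Rightarrow> real) \<Rightarrow> real \<Rightarrow> real \<Rightarrow> bool" where
  "fibonacci_combinatorics f d c \<longleftrightarrow>
     bimodal f d c \<and> positive_map f \<and>
     recurrent f d \<and> recurrent f c \<and> \<not> periodic f d \<and> \<not> periodic f c \<and>
     (\<exists>p1 p p3.
        {x \<in> {d<..<c}. f x = x} = {p} \<and> {x \<in> {-1..1}. f x = p} = {p1, p, p3} \<and>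
        p1 < d \<and> d < p \<and> p < c \<and> c < p3 \<and>
        (\<forall>k\<ge>1. let A = nest_union f d c p1 p p3 (k - 1) in
           d \<in> return_domain f A \<and> c \<in> return_domain f A \<and>
           return_time f A d = fib_time k \<and> return_time f A c = fib_time k))"

section \<open>The two-parameter family\<close>

datatype lap = Lft | Mid | Rgt

definition crit_d :: real where "crit_d = -1/3"
definition crit_c :: real where "crit_c = 1/3"

definition Delta_star :: "(real \<times> real) set" where
  "Delta_star = {(u, v). -1 \<le> v \<and> v < u \<and> u \<le> 1}"

definition rho :: "real \<Rightarrow> real \<Rightarrow> real" where
  "rho l t = (if t = 0 then 0 else t * \<bar>t\<bar> powr (l - 2))"

definition q :: "real \<Rightarrow> real \<Rightarrow> real" where
  "q l x = rho l (x - crit_d) * rho l (x - crit_c)"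

fun lap_interior :: "lap \<Rightarrow> real set" where
  "lap_interior Lft = {-1<..<crit_d}"
| "lap_interior Mid = {crit_d<..<crit_c}"
| "lap_interior Rgt = {crit_c<..<1}"

text \<open>The middle lap, where \<open>q\<close> is negative, is counted with the opposite sign.\<close>

fun lap_integral :: "real \<Rightarrow> lap \<Rightarrow> (real \<Rightarrow> real) \<Rightarrow> real" where
  "lap_integral l Lft g = integral {-1..crit_d} (\<lambda>x. g x * q l x)"
| "lap_integral l Mid g = - integral {crit_d..crit_c} (\<lambda>x. g x * q l x)"
| "lap_integral l Rgt g = integral {crit_c..1} (\<lambda>x. g x * q l x)"

definition B :: "real \<Rightarrow> lap \<Rightarrow> real" where
  "B l i = lap_integral l i (\<lambda>x. 1)"

fun delta :: "lap \<Rightarrow> real \<Rightarrow> real \<Rightarrow> real" where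
  "delta Lft u v = u + 1"
| "delta Mid u v = u - v"
| "delta Rgt u v = 1 - v"

definition admissible_bumps :: "real \<Rightarrow> (lap \<Rightarrow> real \<Rightarrow> real) \<Rightarrow> bool" where
  "admissible_bumps l \<eta> \<longleftrightarrow>
     (\<forall>i. smooth (\<eta> i) \<and> (\<forall>x. 0 \<le> \<eta> i x) \<and>
          closure {x. \<eta> i x \<noteq> 0} \<subseteq> lap_interior i \<and>
          lap_integral l i (\<eta> i) = 1) \<and>
     (\<forall>x. \<eta> Rgt x = \<eta> Lft (- x)) \<and> (\<forall>x. \<eta> Mid x = \<eta> Mid (- x))"

definition admissible_eps :: "real \<Rightarrow> (real \<times> real \<Rightarrow> real) \<Rightarrow> bool" where
  "admissible_eps l \<epsilon> \<longleftrightarrow>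
     continuous_on Delta_star \<epsilon> \<and>
     (\<exists>g. continuous_on (closure Delta_star) g \<and> (\<forall>z\<in>Delta_star. g z = \<epsilon> z)) \<and>
     (\<forall>(u, v)\<in>Delta_star.
        0 < \<epsilon> (u, v) \<and> \<epsilon> (- v, - u) = \<epsilon> (u, v) \<and> (\<forall>i. \<epsilon> (u, v) * B l i < delta i u v))"

definition weight ::
  "real \<Rightarrow> (lap \<Rightarrow> real \<Rightarrow> real) \<Rightarrow> (real \<times> real \<Rightarrow> real) \<Rightarrow> real \<Rightarrow> real \<Rightarrow> real \<Rightarrow> real" where
  "weight l \<eta> \<epsilon> u v x =
     \<epsilon> (u, v) + (\<Sum>i\<in>{Lft, Mid, Rgt}. (delta i u v - \<epsilon> (u, v) * B l i) * \<eta> i x)"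

definition family ::
  "real \<Rightarrow> (lap \<Rightarrow> real \<Rightarrow> real) \<Rightarrow> (real \<times> real \<Rightarrow> real) \<Rightarrow> real \<Rightarrow> real \<Rightarrow> real \<Rightarrow> real" where
  "family l \<eta> \<epsilon> u v x = -1 + integral {-1..x} (\<lambda>t. weight l \<eta> \<epsilon> u v t * q l t)"

end

(*
  By oddness it suffices to study G = |F| on [0,1], which folds at c = 1/3 with critical value a and
  vanishes at 0 and at the preimage p > c of 0. The return nest V_k around c is the pull-back under G
  of a nest W_k of intervals around a, and in terms of S_k = fib_time k the Fibonacci combinatorics is
  the condition that a lies in every W_k: G^(S_k) maps c out of V_k, to a prescribed side, and then
  G^(S_(k-1)) brings it into V_k.

  Existence of a: if the map a -> G_a^(S_k)(c) sweeps over V_(k-1) on a parameter interval, then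
  a -> G_a^(S_(k+1))(c) sweeps over V_k on a compact subinterval of its interior; intersect.

  Recurrence: if the W_k did not shrink to the point a, there would be an interval J = [w, a] in all
  of them. Its close returns lie in V_(k-1) - V_k, so they get short and infinitely many of them are
  not longer than their predecessors; these have space of comparable size on both sides. The weight
  W_(u,v) is log-Lipschitz and |q| is log-concave between the critical points, so F increases the log
  of a cross ratio on T at most by the factor exp(Lip |T|); the intervals T in question have bounded
  total length, so the space pulls back to J, but one end of W_k converges to w.

  Critical order: near c one has F(c + y) - F(c) = |y|^l g(y) with g smooth and positive, and
  y g(y)^(1/l) is the required coordinate.
*)
theory Submission
  imports Defs
begin

section \<open>Intervals and closed sets\<close>

text \<open>Passing to \<open>|F|\<close> forgets signs: a close return of the fold to
  \<open>c\<close> may be one of \<open>F\<close> to \<open>- c\<close>. The signs at the times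
  \<open>fib_time k\<close> obey a multiplicative Fibonacci recursion and run -1, -1, 1
  periodically, so every third return is a return of \<open>F\<close> to \<open>c\<close> itself. No
  monotonicity in the parameter is available, and for a general parameter the sets of the nest need
  not be intervals. Hence the parameter is found by continuity alone: the nest is described by
  inequalities along orbits, in an open and a closed version, and interval statements are made only
  once \<open>a\<close> lies in the sets concerned. The prescribed sides have period four: each
  passage through the fold reverses the orientation inherited from two levels before. Distortion
  enters only through an inequality for pairs of points,
  \<open>D x * D y * (x - y)^2 \<le> K * (F x - F y)^2\<close>. It integrates to a bound on cross
  ratios without any third derivative. Images of an interval are disjoint up to a first entry, so
  they have total length at most 1; the iterate in question consists of two such pieces and one
  single step, whence \<open>exp (3 * Lip)\<close>.\<close>

lemma strict_mono_interval_preimage: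
  fixes h :: "real \<Rightarrow> real"
  assumes "continuous_on {lo..hi} h" "strict_mono_on {lo..hi} h"
    and "lo \<le> hi" "h lo < L" "L \<le> R" "R < h hi"
  obtains lo' hi' where "lo < lo'" "lo' \<le> hi'" "hi' < hi" "h lo' = L" "h hi' = R"
    "\<And>y. y \<in> {lo..hi} \<Longrightarrow> (L \<le> h y \<longleftrightarrow> lo' \<le> y) \<and> (L < h y \<longleftrightarrow> lo' < y) \<and>
       (h y \<le> R \<longleftrightarrow> y \<le> hi') \<and> (h y < R \<longleftrightarrow> y < hi')"
proof -
  obtain lo' where a: "lo \<le> lo'" "lo' \<le> hi" "h lo' = L"
    using IVT'[of h lo L hi] assms by auto
  obtain hi' where b: "lo \<le> hi'" "hi' \<le> hi" "h hi' = R"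
    using IVT'[of h lo R hi] assms by auto
  have mono: "h x \<le> h y \<longleftrightarrow> x \<le> y" "h x < h y \<longleftrightarrow> x < y"
    if "x \<in> {lo..hi}" "y \<in> {lo..hi}" for x y
    using strict_mono_on_less_eq[OF assms(2) that] strict_mono_on_less[OF assms(2) that] by auto
  show thesis
  proof
    show "lo < lo'" "hi' < hi" using a b assms by (auto simp: less_le)
    show "lo' \<le> hi'" using mono(1)[of lo' hi'] a b assms by auto
    show "h lo' = L" "h hi' = R" by fact+
    show "(L \<le> h y \<longleftrightarrow> lo' \<le> y) \<and> (L < h y \<longleftrightarrow> lo' < y) \<and>
       (h y \<le> R \<longleftrightarrow> y \<le> hi') \<and> (h y < R \<longleftrightarrow> y < hi')" if "y \<in> {lo..hi}" for y
      using mono[of lo' y] mono[of y hi'] a b that by auto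
  qed
qed

text \<open>\<open>t'\<close> is the first point of \<open>R\<close> beyond \<open>s\<close>, and
  \<open>s'\<close> the last point of \<open>L\<close> before \<open>t'\<close>; disjointness keeps
  them apart.\<close>

lemma gap_between_closed_sets:
  fixes L R :: "real set"
  assumes "closed L" "closed R" "s \<in> L" "t \<in> R" "s < t" "L \<inter> R = {}"
  obtains s' t' where "s \<le> s'" "s' < t'" "t' \<le> t" "s' \<in> L" "t' \<in> R" "{s'<..<t'} \<inter> (L \<union> R) = {}"
proof -
  define t' where "t' = Inf (R \<inter> {s..})"
  have bb: "bdd_below (R \<inter> {s..})" by (rule bdd_belowI[of _ s]) auto
  have "t' \<in> R \<inter> {s..}"
    unfolding t'_def using assms bb by (intro closed_contains_Inf) auto
  moreover have "t' \<le> t" unfolding t'_def using assms bb by (intro cInf_lower) auto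
  ultimately have t': "t' \<in> R" "s \<le> t'" "t' \<le> t" by auto
  have tl: "x \<notin> R" if "s \<le> x" "x < t'" for x
    using that cInf_lower[OF _ bb, of x] unfolding t'_def by force
  define s' where "s' = Sup (L \<inter> {..t'})"
  have ba: "bdd_above (L \<inter> {..t'})" by (rule bdd_aboveI[of _ t']) auto
  have "s' \<in> L \<inter> {..t'}"
    unfolding s'_def using assms t' ba by (intro closed_contains_Sup) auto
  moreover have ss: "s \<le> s'" unfolding s'_def using assms t' ba by (intro cSup_upper) auto
  ultimately have s': "s' \<in> L" "s' \<le> t'" by auto
  have sl: "x \<notin> L" if "s' < x" "x \<le> t'" for x
    using that cSup_upper[OF _ ba, of x] unfolding s'_def by force
  have "s' \<noteq> t'" using s' t' assms by auto
  then show thesis using that[of s' t'] s' t' ss tl sl by fastforce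
qed

text \<open>Everything happens to the right of the last zero \<open>t0\<close> of \<open>g\<close>:
  just after \<open>t0\<close> the points belong to \<open>R\<close>, just before \<open>hi\<close>
  to \<open>L\<close>, and a gap lies between. In the application \<open>g\<close> is the signed
  position of one close return, and \<open>L\<close>, \<open>R\<close> are the parameters at which
  the next one has left its nest interval on either side. Those sets are cut down to the open
  interval, hence the local form of \<open>cl\<close>.\<close>

lemma sweep_right:
  fixes g :: "real \<Rightarrow> real" and L R :: "real set"
  assumes ab: "lo < hi" and cont: "continuous_on {lo..hi} g" and neg: "g lo < 0" and pos: "g hi > 0"
    and cl: "\<And>s t. lo < s \<Longrightarrow> t < hi \<Longrightarrow> closed (L \<inter> {s..t})"
      "\<And>s t. lo < s \<Longrightarrow> t < hi \<Longrightarrow> closed (R \<inter> {s..t})"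
    and disj: "L \<inter> R = {}"
    and zero: "\<And>t. t \<in> {lo<..<hi} \<Longrightarrow> g t = 0 \<Longrightarrow> eventually (\<lambda>x. x \<in> R) (nhds t)"
    and near: "eventually (\<lambda>x. x \<in> {lo<..<hi} \<longrightarrow> x \<in> L) (nhds hi)"
  obtains lo' hi' where "lo < lo'" "lo' < hi'" "hi' < hi" "\<And>t. t \<in> {lo'..hi'} \<Longrightarrow> g t > 0"
    "{lo'<..<hi'} \<inter> (L \<union> R) = {}" "lo' \<in> R" "hi' \<in> L"
proof -
  define K where "K = {t \<in> {lo..hi}. g t \<le> 0}"
  have clK: "closed K"
    using continuous_closed_preimage[OF cont, of "{..0}"] by (simp add: K_def vimage_def Int_def)
  have bK: "bdd_above K" unfolding K_def by (rule bdd_aboveI[of _ hi]) auto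
  define t0 where "t0 = Sup K"
  have t0: "t0 \<in> K" unfolding t0_def
  proof (rule closed_contains_Sup[OF _ bK clK])
    show "K \<noteq> {}" using neg ab by (auto simp: K_def intro!: exI[of _ lo])
  qed
  have up: "g t > 0" if "t0 < t" "t \<le> hi" for t
  proof (rule ccontr)
    assume "\<not> g t > 0"
    then have "t \<in> K" using that t0 by (auto simp: K_def)
    then show False using cSup_upper[OF _ bK, of t] that by (simp add: t0_def)
  qed
  have t0b: "t0 < hi" using t0 pos by (auto simp: K_def less_le)
  have "\<exists>t\<ge>t0. t \<le> hi \<and> g t = 0"
    using t0 pos t0b by (intro IVT') (auto simp: K_def intro: continuous_on_subset[OF cont])
  then obtain t1 where "t0 \<le> t1" "t1 \<le> hi" "g t1 = 0" by blast
  with up[of t1] have z: "g t0 = 0" by (cases "t0 = t1") auto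
  then have "t0 \<in> {lo<..<hi}" using t0 t0b neg by (auto simp: K_def less_le)
  from zero[OF this z] obtain e where e: "e > 0" "\<And>x. dist x t0 < e \<Longrightarrow> x \<in> R"
    unfolding eventually_nhds_metric by blast
  define b where "b = t0 + e"
  have b: "t0 < b" "\<And>x. t0 < x \<Longrightarrow> x < b \<Longrightarrow> x \<in> R"
    using e by (auto simp: b_def dist_real_def)
  have at0: "lo < t0" using \<open>t0 \<in> {lo<..<hi}\<close> by simp
  from near obtain d where d: "d > 0" "\<And>x. dist x hi < d \<Longrightarrow> x \<in> {lo<..<hi} \<Longrightarrow> x \<in> L"
    unfolding eventually_nhds_metric by blast
  define b' where "b' = max t0 (hi - d)"
  have b': "b' < hi" "\<And>x. b' < x \<Longrightarrow> x < hi \<Longrightarrow> x \<in> L"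
    using d t0b at0 by (auto simp: b'_def dist_real_def)
  obtain s where s: "t0 < s" "s < min b hi" using dense[of t0 "min b hi"] b t0b by auto
  obtain t where t: "max b' s < t" "t < hi" using dense[of "max b' s" hi] b' s by auto
  have st: "s \<in> R" "t \<in> L" "s < t" using s t b b' by auto
  obtain lo' hi' where *: "s \<le> lo'" "lo' < hi'" "hi' \<le> t" "lo' \<in> R \<inter> {s..t}" "hi' \<in> L \<inter> {s..t}"
    "{lo'<..<hi'} \<inter> (R \<inter> {s..t} \<union> L \<inter> {s..t}) = {}"
    using gap_between_closed_sets[OF cl(2)[of s t] cl(1)[of s t], of s t] st disj s t at0 by auto
  show thesis
    by (rule that[of lo' hi']) (use * s t at0 up in auto)
qed

text \<open>The reflection \<open>t\<close> to \<open>- t\<close> exchanges the two orders of signs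
  and swaps the ends, hence the alternative in the conclusion.\<close>

lemma sweep:
  fixes g :: "real \<Rightarrow> real" and L R :: "real set"
  assumes ab: "lo < hi" and cont: "continuous_on {lo..hi} g" and sign: "g lo * g hi < 0"
    and cl: "\<And>s t. lo < s \<Longrightarrow> t < hi \<Longrightarrow> closed (L \<inter> {s..t})"
      "\<And>s t. lo < s \<Longrightarrow> t < hi \<Longrightarrow> closed (R \<inter> {s..t})"
    and disj: "L \<inter> R = {}"
    and zero: "\<And>t. t \<in> {lo<..<hi} \<Longrightarrow> g t = 0 \<Longrightarrow> eventually (\<lambda>x. x \<in> R) (nhds t)"
    and near: "\<And>t. t = lo \<or> t = hi \<Longrightarrow> g t > 0 \<Longrightarrow>
      eventually (\<lambda>x. x \<in> {lo<..<hi} \<longrightarrow> x \<in> L) (nhds t)"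
  obtains lo' hi' where "lo < lo'" "lo' < hi'" "hi' < hi" "\<And>t. t \<in> {lo'..hi'} \<Longrightarrow> g t > 0"
    "{lo'<..<hi'} \<inter> (L \<union> R) = {}" "lo' \<in> R \<and> hi' \<in> L \<or> lo' \<in> L \<and> hi' \<in> R"
proof (cases "g hi > 0")
  case True
  then have neg: "g lo < 0" using sign by (simp add: mult_less_0_iff)
  show thesis
    by (rule sweep_right[OF ab cont neg True cl disj zero near]) (use True in \<open>auto intro: that\<close>)
next
  case False
  then have signs: "g hi < 0" "g lo > 0" using sign by (auto simp: mult_less_0_iff)
  have refl: "eventually (\<lambda>x. P (- x)) (nhds (- t))" if ev: "eventually P (nhds t)" for P and t :: real
  proof -
    obtain d where "d > 0" "\<And>x. dist x t < d \<Longrightarrow> P x" using ev unfolding eventually_nhds_metric by blast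
    then show ?thesis unfolding eventually_nhds_metric
      by (intro exI[of _ d]) (auto simp: dist_real_def abs_minus_commute)
  qed
  have clm: "closed (uminus ` M \<inter> {s..t})" if "closed (M \<inter> {- t..- s})" for M :: "real set" and s t
  proof -
    have "uminus ` M \<inter> {s..t} = uminus ` (M \<inter> {- t..- s})" by force
    then show ?thesis using closed_negations[OF that] by simp
  qed
  have mem: "x \<in> uminus ` M \<longleftrightarrow> - x \<in> M" for x and M :: "real set" by force
  obtain lo' hi' where *: "- hi < lo'" "lo' < hi'" "hi' < - lo" "\<And>t. t \<in> {lo'..hi'} \<Longrightarrow> g (- t) > 0"
    "{lo'<..<hi'} \<inter> (uminus ` L \<union> uminus ` R) = {}" "lo' \<in> uminus ` R" "hi' \<in> uminus ` L"
  proof (rule sweep_right[of "- hi" "- lo" "\<lambda>x. g (- x)" "uminus ` L" "uminus ` R"])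
    show "continuous_on {- hi..- lo} (\<lambda>x. g (- x))"
      by (rule continuous_on_compose2[OF cont]) (auto intro: continuous_intros)
    show "closed (uminus ` L \<inter> {s..t})" "closed (uminus ` R \<inter> {s..t})" if "- hi < s" "t < - lo" for s t
      using that by (intro clm cl; simp)+
    show "uminus ` L \<inter> uminus ` R = {}" using disj by auto
    show "eventually (\<lambda>x. x \<in> uminus ` R) (nhds t)" if "t \<in> {- hi<..<- lo}" "g (- t) = 0" for t
      using refl[OF zero[of "- t"]] that by (simp add: mem)
    show "eventually (\<lambda>x. x \<in> {- hi<..<- lo} \<longrightarrow> x \<in> uminus ` L) (nhds (- lo))"
      using refl[OF near[of lo]] signs by (auto simp: mem elim!: eventually_mono)
  qed (use ab signs in auto)
  show thesis
  proof (rule that[of "- hi'" "- lo'"])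
    show "{- hi'<..<- lo'} \<inter> (L \<union> R) = {}"
    proof (rule ccontr)
      assume "{- hi'<..<- lo'} \<inter> (L \<union> R) \<noteq> {}"
      then obtain x where "x \<in> {- hi'<..<- lo'}" "x \<in> L \<union> R" by blast
      then have "- x \<in> {lo'<..<hi'} \<inter> (uminus ` L \<union> uminus ` R)" by (auto simp: mem)
      then show False using *(5) by blast
    qed
    show "g t > 0" if "t \<in> {- hi'..- lo'}" for t using *(4)[of "- t"] that by auto
  qed (use * in \<open>auto simp: mem\<close>)
qed

section \<open>The nest of a folded bimodal map\<close>

text \<open>\<open>fib_time k - 1\<close>: iterates are counted from the critical value instead of the critical point.\<close>

fun pre_time :: "nat \<Rightarrow> nat" where
  "pre_time 0 = 0"
| "pre_time (Suc 0) = 1"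
| "pre_time (Suc (Suc k)) = Suc (pre_time (Suc k) + pre_time k)"

lemma fib_time_eq: "fib_time k = Suc (pre_time k)"
  by (induction k rule: fib_time.induct) auto

text \<open>The side of \<open>c\<close> on which the close return of \<open>c\<close> after \<open>fib_time k\<close> steps has to lie.\<close>

fun side :: "nat \<Rightarrow> real" where
  "side 0 = 1"
| "side (Suc 0) = 1"
| "side (Suc (Suc k)) = - side k"

lemma side_cases: "side k = 1 \<or> side k = -1"
  by (induction k rule: side.induct) auto

text \<open>For odd \<open>F\<close> this is the factor of \<open>F\<close> on the quotient of the
  interval by the identification of \<open>x\<close> with \<open>- x\<close>.\<close>

definition quot :: "(real \<Rightarrow> real) \<Rightarrow> real \<Rightarrow> real" where
  "quot F x = \<bar>F x\<bar>"

text \<open>For the maps below this is the interval from 0 to the zero \<open>p\<close>, expressed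
  by the sign of \<open>F\<close> so that the condition is open in the pair of map and
  point.\<close>

definition base_open :: "(real \<Rightarrow> real) \<Rightarrow> real set" where
  "base_open F = {x \<in> {0<..<1}. F x < 0}"

definition base_closed :: "(real \<Rightarrow> real) \<Rightarrow> real set" where
  "base_closed F = {x \<in> {0..1}. F x \<le> 0}"

text \<open>
  \<open>nest_open c F k\<close> will be the \<open>k\<close>-th interval of the return nest around \<open>c\<close> and
  \<open>val_open c F k\<close> its extension beyond the critical value on the side of the values.
  Defined by itineraries, they depend semicontinuously on \<open>F\<close> even where they are not intervals;
  the closed variants are their closures when the critical value lies in \<open>val_open c F k\<close>. The inequality \<open>y \<ge> c\<close> in the closed variant
  only excludes \<open>y = 0\<close>.
\<close>

fun val_open :: "real \<Rightarrow> (real \<Rightarrow> real) \<Rightarrow> nat \<Rightarrow> real set" where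
  "val_open c F 0 = {0<..<1}"
| "val_open c F (Suc 0) = {y \<in> {0..1}. F y > 0 \<and> F (quot F y) < 0}"
| "val_open c F (Suc (Suc k)) = {y \<in> val_open c F (Suc k).
     side (Suc k) * ((quot F ^^ pre_time (Suc k)) y - c) > 0 \<and>
     (quot F ^^ pre_time (Suc (Suc k))) y \<in> base_open F \<and>
     (quot F ^^ Suc (pre_time (Suc (Suc k)))) y \<in> val_open c F (Suc k)}"

fun val_closed :: "real \<Rightarrow> (real \<Rightarrow> real) \<Rightarrow> nat \<Rightarrow> real set" where
  "val_closed c F 0 = {0..1}"
| "val_closed c F (Suc 0) = {y \<in> {0..1}. y \<ge> c \<and> F y \<ge> 0 \<and> F (quot F y) \<le> 0}"
| "val_closed c F (Suc (Suc k)) = {y \<in> val_closed c F (Suc k).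
     side (Suc k) * ((quot F ^^ pre_time (Suc k)) y - c) \<ge> 0 \<and>
     (quot F ^^ pre_time (Suc (Suc k))) y \<in> base_closed F \<and>
     (quot F ^^ Suc (pre_time (Suc (Suc k)))) y \<in> val_closed c F (Suc k)}"

definition nest_open :: "real \<Rightarrow> (real \<Rightarrow> real) \<Rightarrow> nat \<Rightarrow> real set" where
  "nest_open c F k = {x \<in> base_open F. quot F x \<in> val_open c F k}"

definition nest_closed :: "real \<Rightarrow> (real \<Rightarrow> real) \<Rightarrow> nat \<Rightarrow> real set" where
  "nest_closed c F k = {x \<in> base_closed F. quot F x \<in> val_closed c F k}"

text \<open>Since \<open>pre_time\<close> counts from critical values, joining two blocks costs one
  application of the fold.\<close>

lemma funpow_pre_time_Suc_Suc:
  "(G ^^ pre_time (Suc (Suc k))) y = (G ^^ pre_time k) (G ((G ^^ pre_time (Suc k)) y))"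
proof -
  have "pre_time (Suc (Suc k)) = pre_time k + (1 + pre_time (Suc k))" by simp
  then show ?thesis by (simp only: funpow_add) simp
qed

locale half_bimodal =
  fixes F :: "real \<Rightarrow> real" and c p a :: real
  assumes cont: "continuous_on {0..1} F"
    and F_vals: "F 0 = 0" "F c = - a" "F p = 0" "F 1 = 1"
    and order: "0 < c" "c < p" "p < 1" "0 < a" "a \<le> 1"
    and dec: "strict_antimono_on {0..c} F"
    and inc: "strict_mono_on {c..1} F"
begin

abbreviation "G \<equiv> quot F"
abbreviation "W \<equiv> val_open c F"
abbreviation "Z \<equiv> val_closed c F"
abbreviation "V \<equiv> nest_open c F"
abbreviation "C \<equiv> nest_closed c F"
abbreviation "\<Psi> k \<equiv> G ^^ pre_time k"

section \<open>Signs of the map and monotone laps of the fold\<close>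

lemma F_neg: "F x < 0" if "0 < x" "x < p"
proof (cases "x \<le> c")
  case True
  then show ?thesis using monotone_onD[OF dec, of 0 x] that F_vals by auto
next
  case False
  then show ?thesis using monotone_onD[OF inc, of x p] that F_vals order by auto
qed

lemma F_pos: "F x > 0" if "p < x" "x \<le> 1"
  using monotone_onD[OF inc, of p x] that F_vals order by auto

lemma F_le_0: "F x \<le> 0" if "0 \<le> x" "x \<le> p"
  using F_neg[of x] F_vals that by (cases "x = 0"; cases "x = p") auto

lemma F_ge_0: "F x \<ge> 0" if "p \<le> x" "x \<le> 1"
  using F_pos[of x] F_vals that by (cases "x = p") auto

lemma base_open_eq: "base_open F = {0<..<p}"
proof -
  have "F x < 0 \<longleftrightarrow> x < p" if "0 < x" "x < 1" for x
    using F_neg[of x] F_ge_0[of x] that by (cases "x < p") auto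
  then show ?thesis unfolding base_open_def using order by auto
qed

lemma base_closed_eq: "base_closed F = {0..p}"
proof -
  have "F x \<le> 0 \<longleftrightarrow> x \<le> p" if "0 \<le> x" "x \<le> 1" for x
    using F_le_0[of x] F_pos[of x] that by (cases "x \<le> p") auto
  then show ?thesis unfolding base_closed_def using order by auto
qed

lemma G_neg: "G x = - F x" if "0 \<le> x" "x \<le> p"
  using F_le_0[OF that] by (simp add: quot_def)

lemma G_pos: "G x = F x" if "p \<le> x" "x \<le> 1"
  using F_ge_0[OF that] by (simp add: quot_def)

lemma G_vals [simp]: "G 0 = 0" "G c = a" "G p = 0" "G 1 = 1"
  using F_vals order by (auto simp: quot_def)

lemma G_inc: "G x < G y" if "0 \<le> x" "x < y" "y \<le> c"
  using monotone_onD[OF dec, of x y] that order by (auto simp: G_neg)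

lemma G_dec: "G y < G x" if "c \<le> x" "x < y" "y \<le> p"
  using monotone_onD[OF inc, of x y] that order by (auto simp: G_neg)

lemma G_inc': "G x < G y" if "p \<le> x" "x < y" "y \<le> 1"
  using monotone_onD[OF inc, of x y] that order by (auto simp: G_pos)

lemma G_le_a: "G x \<le> a" if "0 \<le> x" "x \<le> p"
  using G_inc[of x c] G_dec[of c x] that by (cases x c rule: linorder_cases) auto

lemma G_bounds: "0 \<le> G x \<and> G x \<le> 1" if "0 \<le> x" "x \<le> 1"
proof (cases "x \<le> p")
  case True
  then show ?thesis using G_le_a[of x] that order by (simp add: quot_def)
next
  case False
  then show ?thesis using G_inc'[of x 1] that order F_vals by (cases "x = 1") (auto simp: quot_def)
qed

lemma cont_G: "continuous_on {0..1} G"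
  unfolding quot_def using cont by (auto intro: continuous_intros)

lemma funpow_maps: "x \<in> {0..1} \<Longrightarrow> (G ^^ n) x \<in> {0..1}"
  by (induction n) (use G_bounds in auto)

lemma cont_funpow: "continuous_on {0..1} (G ^^ n)"
proof (induction n)
  case (Suc n)
  have "continuous_on {0..1} (G \<circ> (G ^^ n))"
    by (rule continuous_on_compose[OF Suc continuous_on_subset[OF cont_G]]) (use funpow_maps in blast)
  then show ?case by (simp add: o_def)
qed (simp add: id_def)

text \<open>On \<open>{0..p}\<close> the fold is unimodal with maximum \<open>a\<close> at
  \<open>c\<close>, so its superlevel sets are intervals around \<open>c\<close>. This turns value
  intervals around \<open>a\<close> into nest intervals around \<open>c\<close>.\<close>

lemma fold_preimage:
  assumes v: "0 \<le> v" "v < a"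
  obtains l r where "0 \<le> l" "l < c" "c < r" "r \<le> p" "G l = v" "G r = v"
    "\<And>x. x \<in> {0..p} \<Longrightarrow> (v \<le> G x \<longleftrightarrow> x \<in> {l..r}) \<and> (v < G x \<longleftrightarrow> x \<in> {l<..<r})"
proof -
  have "\<exists>l\<ge>0. l \<le> c \<and> G l = v"
    by (rule IVT') (use v order in \<open>auto intro: continuous_on_subset[OF cont_G]\<close>)
  then obtain l where l: "0 \<le> l" "l \<le> c" "G l = v" by blast
  have "\<exists>r\<ge>c. r \<le> p \<and> G r = v"
    by (rule IVT2') (use v order in \<open>auto intro: continuous_on_subset[OF cont_G]\<close>)
  then obtain r where r: "c \<le> r" "r \<le> p" "G r = v" by blast
  have ne: "l \<noteq> c" "r \<noteq> c" using l r v by auto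
  have "(v \<le> G x \<longleftrightarrow> x \<in> {l..r}) \<and> (v < G x \<longleftrightarrow> x \<in> {l<..<r})" if "x \<in> {0..p}" for x
  proof (cases "x \<le> c")
    case True
    then show ?thesis using G_inc[of x l] G_inc[of l x] l r ne that
      by (cases x l rule: linorder_cases) auto
  next
    case False
    then show ?thesis using G_dec[of x r] G_dec[of r x] l r ne that
      by (cases x r rule: linorder_cases) auto
  qed
  then show thesis using that[of l r] l r ne by simp
qed


section \<open>Interval structure of the levels and the links between them\<close>

definition lv :: "nat \<Rightarrow> real" where "lv k = Inf (Z k)"
definition uv :: "nat \<Rightarrow> real" where "uv k = Sup (Z k)"
definition nl :: "nat \<Rightarrow> real" where "nl k = Inf (C k)"
definition nr :: "nat \<Rightarrow> real" where "nr k = Sup (C k)"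

text \<open>The end of \<open>C k\<close> on the side \<open>s\<close> of \<open>c\<close>; with
  signs as arguments both orientations are covered by one argument.\<close>

definition edge :: "nat \<Rightarrow> real \<Rightarrow> real" where
  "edge k s = (if s > 0 then nr k else nl k)"

text \<open>\<open>side k\<close> is the orientation of \<open>\<Psi> k\<close> on
  \<open>Z k\<close>. Both ends of \<open>C k\<close> go to the lower end \<open>lv k\<close>,
  because on \<open>{0..p}\<close> the fold does not exceed \<open>a < uv k\<close>.\<close>

definition good :: "nat \<Rightarrow> bool" where
  "good k \<longleftrightarrow> W k = {lv k<..<uv k} \<and> Z k = {lv k..uv k} \<and>
     0 \<le> lv k \<and> lv k < a \<and> a < uv k \<and> uv k \<le> 1 \<and>
     strict_mono_on {lv k..uv k} (\<lambda>y. side k * \<Psi> k y) \<and>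
     V k = {nl k<..<nr k} \<and> C k = {nl k..nr k} \<and>
     0 \<le> nl k \<and> nl k < c \<and> c < nr k \<and> nr k \<le> p \<and> G (nl k) = lv k \<and> G (nr k) = lv k"

text \<open>What two consecutive levels must share for the induction. By the first two equations
  \<open>\<Psi> (Suc k)\<close> stretches \<open>Z (Suc k)\<close> over \<open>C k\<close>. By the
  last two, \<open>\<Psi> k\<close> takes \<open>lv k\<close> and the points of
  \<open>Z (Suc k)\<close>, in particular \<open>a\<close>, to opposite sides of
  \<open>C (Suc k)\<close>, which forces the next branch to cross that interval completely.\<close>

definition linked :: "nat \<Rightarrow> bool" where
  "linked k \<longleftrightarrow>
     \<Psi> (Suc k) (lv (Suc k)) = edge k (- side (Suc k)) \<and>
     \<Psi> (Suc k) (uv (Suc k)) = edge k (side (Suc k)) \<and>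
     nl k < nl (Suc k) \<and> nr (Suc k) < nr k \<and> lv k < lv (Suc k) \<and> uv (Suc k) \<le> uv k \<and>
     (\<forall>y\<in>Z (Suc k). \<forall>x\<in>C (Suc k). side k * x < side k * \<Psi> k y) \<and>
     (\<forall>x\<in>C (Suc k). side k * \<Psi> k (lv k) < side k * x)"

lemma val_closed_Suc_Suc:
  "Z (Suc (Suc k)) = {y \<in> Z (Suc k). side (Suc k) * (\<Psi> (Suc k) y - c) \<ge> 0 \<and>
     \<Psi> (Suc (Suc k)) y \<in> C (Suc k)}"
  by (auto simp: nest_closed_def)

lemma val_open_Suc_Suc:
  "W (Suc (Suc k)) = {y \<in> W (Suc k). side (Suc k) * (\<Psi> (Suc k) y - c) > 0 \<and>
     \<Psi> (Suc (Suc k)) y \<in> V (Suc k)}"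
  by (auto simp: nest_open_def)

text \<open>The half of \<open>good\<close> about \<open>V k\<close> and \<open>C k\<close> follows
  from the half about \<open>W k\<close> and \<open>Z k\<close> by unimodality of the fold.\<close>

lemma goodI:
  assumes "W k = {v<..<u}" "Z k = {v..u}" "0 \<le> v" "v < a" "a < u" "u \<le> 1"
    and "strict_mono_on {v..u} (\<lambda>y. side k * \<Psi> k y)"
  shows "good k" "lv k = v" "uv k = u"
proof -
  show lu: "lv k = v" "uv k = u" using assms by (auto simp: lv_def uv_def)
  obtain l r where lr: "0 \<le> l" "l < c" "c < r" "r \<le> p" "G l = v" "G r = v"
    "\<And>x. x \<in> {0..p} \<Longrightarrow> (v \<le> G x \<longleftrightarrow> x \<in> {l..r}) \<and> (v < G x \<longleftrightarrow> x \<in> {l<..<r})"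
    using fold_preimage[OF assms(3,4)] by metis
  have C: "C k = {l..r}"
  proof -
    have "x \<in> C k \<longleftrightarrow> x \<in> {l..r}" for x
      using lr(7)[of x] G_le_a[of x] assms lr by (auto simp: nest_closed_def base_closed_eq)
    then show ?thesis by blast
  qed
  have V: "V k = {l<..<r}"
  proof -
    have "x \<in> V k \<longleftrightarrow> x \<in> {l<..<r}" for x
      using lr(7)[of x] G_le_a[of x] assms lr by (auto simp: nest_open_def base_open_eq)
    then show ?thesis by blast
  qed
  have "nl k = l" "nr k = r" using C lr by (auto simp: nl_def nr_def)
  then show "good k" using assms lu C V lr by (auto simp: good_def)
qed

lemma edge_props:
  assumes "good k" "s = 1 \<or> s = -1"
  shows "x \<in> C k \<longleftrightarrow> s * edge k (- s) \<le> s * x \<and> s * x \<le> s * edge k s"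
    and "x \<in> V k \<longleftrightarrow> s * edge k (- s) < s * x \<and> s * x < s * edge k s"
    and "s * edge k (- s) < s * c" "s * c < s * edge k s"
    and "edge k s \<in> C k" "G (edge k s) = lv k"
  using assms by (auto simp: good_def edge_def)

lemma good_C_sub: "good k \<Longrightarrow> x \<in> C k \<Longrightarrow> x \<in> {0..p}"
  by (auto simp: good_def)

lemma good_C_Z: "x \<in> C k \<Longrightarrow> G x \<in> Z k"
  by (auto simp: nest_closed_def)

lemma Psi_less:
  assumes "good k" "y \<in> Z k" "y' \<in> Z k" "y < y'"
  shows "side k * \<Psi> k y < side k * \<Psi> k y'"
  using assms monotone_onD[of "{lv k..uv k}" "(<)" "(<)" "\<lambda>y. side k * \<Psi> k y" y y']
  by (auto simp: good_def)

text \<open>\<open>\<Psi> k\<close> after \<open>G\<close> is unimodal on \<open>C k\<close>: its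
  turning value at \<open>c\<close> is extremal in the direction \<open>side k\<close>, and moving
  outwards on either half decreases it.\<close>

lemma half_fold_less:
  assumes g: "good k" and s: "s = 1 \<or> s = -1" and x: "x \<in> C k" "x' \<in> C k"
    and ord: "0 \<le> s * (x - c)" "s * (x - c) < s * (x' - c)"
  shows "side k * \<Psi> k (G x') < side k * \<Psi> k (G x)"
proof -
  have "G x' < G x"
    using s G_inc[of x' x] G_dec[of x x'] ord good_C_sub[OF g x(1)] good_C_sub[OF g x(2)] by auto
  then show ?thesis using Psi_less[OF g good_C_Z[OF x(2)] good_C_Z[OF x(1)]] by simp
qed

lemma cont_Psi: "A \<subseteq> {0..1} \<Longrightarrow> continuous_on A (\<Psi> k)"
  using continuous_on_subset[OF cont_funpow] by blast

lemma good_0: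
  assumes "a < 1"
  shows "good 0" "lv 0 = 0" "uv 0 = 1"
  by (rule goodI(1)[of 0 0 1] goodI(2)[of 0 0 1] goodI(3)[of 0 0 1];
      use assms order in \<open>auto simp: monotone_on_def\<close>)+

lemma nest_0: assumes "a < 1" shows "nl 0 = 0" "nr 0 = p"
  using order by (auto simp: nl_def nr_def nest_closed_def base_closed_eq
      intro!: cInf_eq_minimum cSup_eq_maximum dest: G_bounds)

lemma val_open_1_less: "y \<in> W (Suc 0) \<Longrightarrow> y < 1 \<and> p < y"
  using F_le_0[of y] by (cases "y = 1"; cases "y = p"; force simp: F_vals)

text \<open>Beyond \<open>p\<close> the fold increases from 0 to 1; \<open>u\<close> is the point
  there with \<open>G u = p\<close>, and the first value interval is
  \<open>{p<..<u}\<close>.\<close>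

lemma good_1:
  assumes "a \<in> W (Suc 0)"
  shows "good (Suc 0)" "linked 0" "\<forall>y\<in>Z (Suc 0). p \<le> y"
proof -
  have a1: "a < 1" "p < a" using val_open_1_less assms by auto
  have m: "strict_mono_on {p..1} G" using G_inc' by (auto simp: monotone_on_def)
  have "\<exists>u\<ge>p. u \<le> 1 \<and> G u = p"
    by (rule IVT') (use order in \<open>auto intro: continuous_on_subset[OF cont_G]\<close>)
  then obtain u where u: "p \<le> u" "u \<le> 1" "G u = p" by auto
  have Gu: "(G y \<le> p \<longleftrightarrow> y \<le> u) \<and> (0 < G y \<longleftrightarrow> p < y) \<and> (G y < p \<longleftrightarrow> y < u)" if "y \<in> {p..1}" for y
    using that u strict_mono_on_less[OF m, of p y] strict_mono_on_less[OF m, of y u]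
      strict_mono_on_less_eq[OF m, of y u] order by auto
  have ge: "p \<le> y" if "y \<in> {0..1}" "c \<le> y" "0 \<le> F y" for y
    using that F_neg[of y] order by (cases "y < p") auto
  have Z: "Z (Suc 0) = {p..u}"
  proof -
    have "y \<in> Z (Suc 0) \<longleftrightarrow> y \<in> {p..u}" for y
    proof (cases "y \<in> {p..1}")
      case True
      then have "F (G y) \<le> 0 \<longleftrightarrow> G y \<le> p"
        using F_le_0[of "G y"] F_pos[of "G y"] G_bounds[of y] order by (cases "G y \<le> p") auto
      then show ?thesis using True Gu[of y] F_ge_0[of y] order by auto
    next
      case False
      then show ?thesis using ge[of y] u order by auto
    qed
    then show ?thesis by blast
  qed
  have W: "W (Suc 0) = {p<..<u}"
  proof -
    have "y \<in> W (Suc 0) \<longleftrightarrow> y \<in> {p<..<u}" for y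
    proof (cases "y \<in> {p..1}")
      case True
      then have "G y > 0 \<Longrightarrow> F (G y) < 0 \<longleftrightarrow> G y < p"
        using F_neg[of "G y"] F_ge_0[of "G y"] G_bounds[of y] order by (cases "G y < p") auto
      moreover have "F y > 0 \<longleftrightarrow> y > p" "F y = G y"
        using True F_pos[of y] F_vals order G_pos[of y] by (cases "y = p"; force)+
      ultimately show ?thesis using True Gu[of y] by auto
    next
      case False
      then show ?thesis using F_le_0[of y] u order by auto
    qed
    then show ?thesis by blast
  qed
  have u1: "a < u" "u \<le> 1" using assms W u by auto
  have "strict_mono_on {p..u} (\<lambda>y. side (Suc 0) * \<Psi> (Suc 0) y)"
    using u1 by (auto intro!: monotone_onI G_inc')
  note g = goodI[OF W Z _ _ _ _ this]
  show g1: "good (Suc 0)" using g(1) u1 order a1 by auto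
  have lu: "lv (Suc 0) = p" "uv (Suc 0) = u" using g u1 order a1 by auto
  have "G (nl (Suc 0)) = p" "G (nr (Suc 0)) = p" using g1 lu by (auto simp: good_def)
  then have ne: "0 \<noteq> nl (Suc 0)" "p \<noteq> nr (Suc 0)"
    using order G_vals(1,3) by (metis less_trans less_irrefl)+
  have rng: "0 \<le> nl (Suc 0)" "nr (Suc 0) \<le> p" "C (Suc 0) = {nl (Suc 0)..nr (Suc 0)}"
    using g1 by (auto simp: good_def)
  then show "linked 0" using lu nest_0 good_0 a1 ne u u1 Z order
    by (auto simp: linked_def edge_def)
  show "\<forall>y\<in>Z (Suc 0). p \<le> y" using Z by auto
qed

text \<open>At \<open>y0\<close> the iterate \<open>\<Psi> (Suc k)\<close> hits \<open>c\<close>;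
  beyond \<open>y0\<close> it stays on the prescribed side of \<open>c\<close>, where the fold is
  monotone. The ends of this half branch therefore go to \<open>\<Psi> k\<close> of the critical
  value \<open>a\<close> and of \<open>lv k\<close>. The fold turns the orientation into
  \<open>- side k\<close>, which is the recursion of \<open>side\<close>.\<close>

lemma branch:
  assumes gk: "good k" and gm: "good (Suc k)" and lk: "linked k"
  obtains y0 where "lv (Suc k) < y0" "y0 < uv (Suc k)"
    "\<And>y. y \<in> Z (Suc k) \<Longrightarrow> 0 \<le> side (Suc k) * (\<Psi> (Suc k) y - c) \<longleftrightarrow> y0 \<le> y"
    "\<And>y. y \<in> Z (Suc k) \<Longrightarrow> 0 < side (Suc k) * (\<Psi> (Suc k) y - c) \<longleftrightarrow> y0 < y"
    "strict_mono_on {y0..uv (Suc k)} (\<lambda>y. - side k * \<Psi> (Suc (Suc k)) y)"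
    "continuous_on {y0..uv (Suc k)} (\<lambda>y. - side k * \<Psi> (Suc (Suc k)) y)"
    "\<Psi> (Suc (Suc k)) y0 = \<Psi> k a" "\<Psi> (Suc (Suc k)) (uv (Suc k)) = \<Psi> k (lv k)"
proof -
  define m where "m = Suc k"
  define s where "s = side m"
  define t where "t = side k"
  have s: "s = 1 \<or> s = -1" and t: "t = 1 \<or> t = -1"
    using side_cases by (auto simp: s_def t_def)
  note gm = gm[folded m_def]
  note ek = edge_props[OF gk s]
  have Zm: "Z m = {lv m..uv m}" "lv m < a" "a < uv m" "0 \<le> lv m" "uv m \<le> 1"
    using gm by (auto simp: good_def)
  have lk1: "\<Psi> m (lv m) = edge k (- s)" "\<Psi> m (uv m) = edge k s"
    using lk by (auto simp: linked_def m_def s_def)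
  have h: "\<Psi> (Suc m) y = \<Psi> k (G (\<Psi> m y))" for y
    unfolding m_def by (rule funpow_pre_time_Suc_Suc)
  have Psm: "s * \<Psi> m y < s * \<Psi> m y'" if "y \<in> Z m" "y' \<in> Z m" "y < y'" for y y'
    using Psi_less[OF gm that] by (simp add: s_def)
  have cm: "continuous_on {lv m..uv m} (\<lambda>y. s * \<Psi> m y)"
    using Zm by (intro continuous_intros cont_Psi) auto
  have "\<exists>y0\<ge>lv m. y0 \<le> uv m \<and> s * \<Psi> m y0 = s * c"
    by (rule IVT'[OF _ _ _ cm]) (use lk1 ek Zm in auto)
  then obtain y0 where y0: "lv m \<le> y0" "y0 \<le> uv m" "\<Psi> m y0 = c" using s by auto
  have y0ne: "lv m \<noteq> y0" "y0 \<noteq> uv m" using y0 ek lk1 s by auto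
  have pos: "0 \<le> s * (\<Psi> m y - c) \<longleftrightarrow> y0 \<le> y" "0 < s * (\<Psi> m y - c) \<longleftrightarrow> y0 < y"
    if "y \<in> Z m" for y
    using Psm[of y y0] Psm[of y0 y] y0 that Zm
    by (cases y y0 rule: linorder_cases; simp add: algebra_simps)+
  have PC: "\<Psi> m y \<in> C k" if "y \<in> Z m" for y
    using Psm[of "lv m" y] Psm[of y "uv m"] that Zm lk1 ek(1)
    by (cases "y = lv m"; cases "y = uv m") auto
  have Hm: "strict_mono_on {y0..uv m} (\<lambda>y. - t * \<Psi> (Suc m) y)"
  proof (rule monotone_onI)
    fix y y' assume y: "y \<in> {y0..uv m}" "y' \<in> {y0..uv m}" "y < y'"
    then have yZ: "y \<in> Z m" "y' \<in> Z m" using y0 Zm by auto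
    have "side k * \<Psi> k (G (\<Psi> m y')) < side k * \<Psi> k (G (\<Psi> m y))"
      by (rule half_fold_less[OF gk s PC PC])
        (use yZ y pos(1)[of y] Psm[of y y'] in \<open>auto simp: algebra_simps\<close>)
    then show "- t * \<Psi> (Suc m) y < - t * \<Psi> (Suc m) y'" by (simp add: h t_def)
  qed
  have Hc: "continuous_on {y0..uv m} (\<lambda>y. - t * \<Psi> (Suc m) y)"
    using Zm y0 by (intro continuous_intros cont_Psi) auto
  show thesis
  proof (rule that[of y0, folded m_def, folded s_def t_def])
    show "lv m < y0" "y0 < uv m" using y0 y0ne by auto
    show "0 \<le> s * (\<Psi> m y - c) \<longleftrightarrow> y0 \<le> y" "0 < s * (\<Psi> m y - c) \<longleftrightarrow> y0 < y"
      if "y \<in> Z m" for y using pos[OF that] by auto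
    show "\<Psi> (Suc m) y0 = \<Psi> k a" unfolding h y0(3) by simp
    show "\<Psi> (Suc m) (uv m) = \<Psi> k (lv k)" unfolding h lk1(2) ek(6) by simp
  qed (fact Hm Hc)+
qed

text \<open>By \<open>linked k\<close> the ends of the half branch lie on opposite sides of
  \<open>C (Suc k)\<close>, so the branch crosses it and \<open>Z (Suc (Suc k))\<close> is a compact
  interval in its interior. The last claim strengthens \<open>linked (Suc k)\<close> from
  \<open>C (Suc (Suc k))\<close> to the larger \<open>C (Suc k)\<close>.\<close>

lemma good_step:
  assumes gk: "good k" and gm: "good (Suc k)" and lk: "linked k"
    and a: "a \<in> W (Suc (Suc k))"
  shows "good (Suc (Suc k))" "linked (Suc k)"
    "\<forall>y\<in>Z (Suc (Suc k)). \<forall>x\<in>C (Suc k). side (Suc k) * x < side (Suc k) * \<Psi> (Suc k) y"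
proof -
  define m where "m = Suc k"
  define s where "s = side m"
  define t where "t = side k"
  have s: "s = 1 \<or> s = -1" and t: "t = 1 \<or> t = -1"
    using side_cases by (auto simp: s_def t_def)
  have sm: "side (Suc m) = - t" by (simp add: m_def t_def)
  note gm = gm[folded m_def]
  have Zm: "Z m = {lv m..uv m}" "W m = {lv m<..<uv m}" "C m = {nl m..nr m}" "V m = {nl m<..<nr m}"
    "lv m < a" "a < uv m" "0 \<le> lv m" "uv m \<le> 1" "nl m < c" "c < nr m"
    using gm by (auto simp: good_def)
  have lk1: "\<Psi> m (lv m) = edge k (- s)" "\<Psi> m (uv m) = edge k s"
    using lk by (auto simp: linked_def m_def s_def)
  have lk2: "y \<in> Z m \<Longrightarrow> x \<in> C m \<Longrightarrow> t * x < t * \<Psi> k y"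
    and lk3: "x \<in> C m \<Longrightarrow> t * \<Psi> k (lv k) < t * x" for x y
    using lk by (auto simp: linked_def m_def t_def)
  have lk4: "nl k < nl m" "nr m < nr k"
    using lk by (auto simp: linked_def m_def)
  define h where "h = \<Psi> (Suc m)"
  have h: "h y = \<Psi> k (G (\<Psi> m y))" for y
    unfolding h_def m_def by (rule funpow_pre_time_Suc_Suc)
  define H where "H y = - t * h y" for y
  have He: "H = (\<lambda>y. - side k * \<Psi> (Suc (Suc k)) y)" by (simp add: H_def h_def m_def t_def fun_eq_iff)
  obtain y0 where y0: "lv m < y0" "y0 < uv m"
    "\<And>y. y \<in> Z m \<Longrightarrow> 0 \<le> s * (\<Psi> m y - c) \<longleftrightarrow> y0 \<le> y"
    "\<And>y. y \<in> Z m \<Longrightarrow> 0 < s * (\<Psi> m y - c) \<longleftrightarrow> y0 < y"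
    "strict_mono_on {y0..uv m} H" "continuous_on {y0..uv m} H"
    "h y0 = \<Psi> k a" "h (uv m) = \<Psi> k (lv k)"
    by (rule branch[OF gk gm[unfolded m_def] lk], rule that[unfolded He h_def s_def m_def])
  note pos = y0(3,4) and Hm = y0(5) and Hc = y0(6)
  have aZ: "a \<in> Z m" using Zm by auto
  note em = edge_props[OF gm t]
  have Hy0: "H y0 < - t * edge m t"
    using lk2[OF aZ em(5)] y0 by (simp add: H_def)
  have mt: "- t = 1 \<or> - t = - 1" using t by auto
  have HuR: "- t * edge m (- t) < H (uv m)"
    using lk3[OF edge_props(5)[OF gm mt]] y0 by (simp add: H_def)
  have LR: "- t * edge m t < - t * edge m (- t)" using em by simp
  obtain v' u' where vu: "y0 < v'" "v' \<le> u'" "u' < uv m" "H v' = - t * edge m t"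
    "H u' = - t * edge m (- t)"
    "\<And>y. y \<in> {y0..uv m} \<Longrightarrow> (- t * edge m t \<le> H y \<longleftrightarrow> v' \<le> y) \<and> (- t * edge m t < H y \<longleftrightarrow> v' < y) \<and>
       (H y \<le> - t * edge m (- t) \<longleftrightarrow> y \<le> u') \<and> (H y < - t * edge m (- t) \<longleftrightarrow> y < u')"
    by (rule strict_mono_interval_preimage[OF Hc Hm less_imp_le[OF y0(2)] Hy0 less_imp_le[OF LR] HuR], rule that)
  have mem: "(y \<in> Z (Suc m) \<longleftrightarrow> y \<in> {v'..u'}) \<and> (y \<in> W (Suc m) \<longleftrightarrow> y \<in> {v'<..<u'})" for y
  proof (cases "y \<in> {y0<..<uv m}")
    case True
    then have "y \<in> Z m" "y \<in> W m" using y0 Zm by auto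
    then have "y \<in> Z (Suc m) \<longleftrightarrow> h y \<in> C m" "y \<in> W (Suc m) \<longleftrightarrow> h y \<in> V m"
      using True pos[of y] unfolding m_def val_closed_Suc_Suc val_open_Suc_Suc by (auto simp: s_def h_def m_def)
    then show ?thesis using True vu(6)[of y] em(1,2)[of "h y"] by (auto simp: H_def)
  next
    case False
    have "h y0 \<notin> C m" "h (uv m) \<notin> C m" using Hy0 HuR em(1) by (auto simp: H_def)
    then have "y \<notin> Z (Suc m)" "y \<notin> W (Suc m)"
      using False Zm pos[of y]
      unfolding m_def val_closed_Suc_Suc val_open_Suc_Suc
      by (cases "y = y0"; cases "y = uv m"; auto simp: s_def h_def m_def)+
    then show ?thesis using False vu by auto
  qed
  then have Z': "Z (Suc m) = {v'..u'}" and W': "W (Suc m) = {v'<..<u'}" by blast+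
  have a': "v' < a" "a < u'" using a W' by (auto simp: m_def)
  have sm': "strict_mono_on {v'..u'} (\<lambda>y. side (Suc m) * \<Psi> (Suc m) y)"
    using Hm vu y0 unfolding sm h_def[symmetric] H_def
    by (auto simp: monotone_on_def)
  note gs = goodI[OF W' Z' _ _ _ _ sm']
  have g2: "good (Suc m)" and lu: "lv (Suc m) = v'" "uv (Suc m) = u'"
    using gs a' vu y0 Zm by auto
  show "good (Suc (Suc k))" using g2 by (simp add: m_def)
  have Gl: "G (nl m) = lv m" "G (nr m) = lv m" "0 \<le> nl m" "nr m \<le> p"
    using gm by (auto simp: good_def)
  have Gl': "G (nl (Suc m)) = v'" "G (nr (Suc m)) = v'" "0 \<le> nl (Suc m)" "nr (Suc m) \<le> p"
    "C (Suc m) = {nl (Suc m)..nr (Suc m)}" "nl (Suc m) < c" "c < nr (Suc m)"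
    using g2 lu by (auto simp: good_def)
  have lvlt: "lv m < v'" using vu y0 by auto
  have l: "nl m < nl (Suc m)"
    using lvlt Gl Gl' G_inc[of "nl (Suc m)" "nl m"] Zm
    by (cases "nl m" "nl (Suc m)" rule: linorder_cases) auto
  have r: "nr (Suc m) < nr m"
    using lvlt Gl Gl' G_dec[of "nr m" "nr (Suc m)"] Zm
    by (cases "nr m" "nr (Suc m)" rule: linorder_cases) auto
  \<comment> \<open>If \<open>\<Psi> m y\<close> were in \<open>C m\<close>, its image under the
    fold would be a point of \<open>Z m\<close>, and \<open>\<Psi> k\<close> of that image is
    \<open>h y\<close>. By \<open>lk2\<close> this lies strictly beyond \<open>C m\<close>, although
    \<open>h y\<close> belongs to \<open>C m\<close>.\<close>
  have strong: "s * x < s * \<Psi> m y" if y: "y \<in> Z (Suc m)" and x: "x \<in> C m" for x y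
  proof -
    have yZ: "y \<in> Z m" "0 \<le> s * (\<Psi> m y - c)" "h y \<in> C m"
      using y unfolding m_def val_closed_Suc_Suc by (auto simp: s_def m_def h_def)
    have "\<Psi> m y \<notin> C m"
    proof
      assume "\<Psi> m y \<in> C m"
      then have "G (\<Psi> m y) \<in> Z m" by (rule good_C_Z)
      from lk2[OF this yZ(3)] show False by (simp add: h)
    qed
    then show ?thesis using yZ(2) x Zm s by (auto simp: algebra_simps)
  qed
  then show "\<forall>y\<in>Z (Suc (Suc k)). \<forall>x\<in>C (Suc k). side (Suc k) * x < side (Suc k) * \<Psi> (Suc k) y"
    by (auto simp: m_def s_def)
  have e1: "\<Psi> (Suc m) v' = edge m t" "\<Psi> (Suc m) u' = edge m (- t)"
    using vu(4,5) t by (auto simp: H_def h_def)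
  have sub: "x \<in> C m" if "x \<in> C (Suc m)" for x using that Gl' l r Zm by auto
  have "s * \<Psi> m (lv m) < s * x" if "x \<in> C (Suc m)" for x
    using sub[OF that] Zm lk4 lk1(1) s gk by (auto simp: edge_def)
  then show "linked (Suc k)"
    using e1 lu l r lvlt vu(3) strong sub unfolding linked_def m_def[symmetric] sm
    by (auto simp: s_def)
qed

text \<open>The sets \<open>W k\<close> decrease, so one membership supplies the hypothesis of every
  step. The last statement excludes \<open>k = 0\<close> because \<open>p\<close> lies in both
  \<open>C 0\<close> and \<open>Z (Suc 0)\<close>.\<close>

lemma good_all:
  assumes "a \<in> W (Suc n)"
  shows "k \<le> Suc n \<Longrightarrow> good k" and "k \<le> n \<Longrightarrow> linked k"
    and "k \<le> n \<Longrightarrow> y \<in> Z (Suc k) \<Longrightarrow> x \<in> C k \<Longrightarrow> k > 0 \<Longrightarrow> side k * x < side k * \<Psi> k y"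
proof -
  have down: "a \<in> W (Suc j)" if "j \<le> n" for j
    using that assms by (induction rule: inc_induct) auto
  have a1: "a < 1" using down[of 0] val_open_1_less by auto
  have main: "good j \<and> good (Suc j) \<and> linked j \<and>
      (j > 0 \<longrightarrow> (\<forall>y\<in>Z (Suc j). \<forall>x\<in>C j. side j * x < side j * \<Psi> j y))" if "j \<le> n" for j
    using that
  proof (induction j)
    case 0
    then show ?case using good_0[OF a1] good_1[OF down[of 0]] by auto
  next
    case (Suc j)
    then show ?case using good_step[of j, OF _ _ _ down[of "Suc j"]] by auto
  qed
  show "good k" if "k \<le> Suc n" using main[of "k - 1"] good_0[OF a1] that by (cases k) auto
  show "linked k" if "k \<le> n" using main that by auto
  show "side k * x < side k * \<Psi> k y" if "k \<le> n" "y \<in> Z (Suc k)" "x \<in> C k" "k > 0"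
    using main[of k] that by auto
qed

end

section \<open>Distortion of cross ratios\<close>

text \<open>
  The logarithm on the left is the integral of \<open>D x * D y / (f x - f y)\<^sup>2\<close> over
  \<open>[a, b] \<times> [c, d]\<close>.
\<close>

lemma ln_cross_ratio_le:
  fixes f D :: "real \<Rightarrow> real"
  assumes ord: "a < b" "b < c" "c < d"
    and cont: "continuous_on {a..d} f" and mono: "strict_mono_on {a..d} f"
    and der: "\<And>x. a < x \<Longrightarrow> x < d \<Longrightarrow> (f has_real_derivative D x) (at x)"
    and dist: "\<And>x y. a < x \<Longrightarrow> x < y \<Longrightarrow> y < d \<Longrightarrow> D x * D y * (x - y)\<^sup>2 \<le> K * (f x - f y)\<^sup>2"
  shows "ln (((f c - f a) * (f d - f b)) / ((f c - f b) * (f d - f a)))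
      \<le> K * ln (((c - a) * (d - b)) / ((c - b) * (d - a)))"
proof -
  have less: "f x < f y" if "a \<le> x" "x < y" "y \<le> d" for x y
    using monotone_onD[OF mono, of x y] that by auto
  have inner: "D x * (1 / (f c - f x) - 1 / (f d - f x)) \<le> K * (1 / (c - x) - 1 / (d - x))"
    if x: "a < x" "x < b" for x
  proof -
    \<comment> \<open>Integration in \<open>y\<close> for fixed \<open>x\<close>: by
      \<open>dist\<close> the derivative of \<open>g\<close> is nonnegative.\<close>
    define g where "g y = D x / (f y - f x) - K / (y - x)" for y
    have "g c \<le> g d"
    proof (rule DERIV_nonneg_imp_increasing_open[of c d g])
      show "c \<le> d" using ord by simp
      fix y assume y: "c < y" "y < d"
      have fy: "f x < f y" using less x y ord by auto
      have "(g has_real_derivative (K / (y - x)\<^sup>2 - D x * D y / (f y - f x)\<^sup>2)) (at y)"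
        unfolding g_def using fy x y ord
        by (auto intro!: derivative_eq_intros der simp: power2_eq_square)
      moreover have "D x * D y / (f y - f x)\<^sup>2 \<le> K / (y - x)\<^sup>2"
        using dist[of x y] fy x y ord by (simp add: field_simps power2_commute)
      ultimately show "\<exists>z. (g has_real_derivative z) (at y) \<and> 0 \<le> z"
        by (meson diff_ge_0_iff_ge)
    next
      have "continuous_on {c..d} f" using cont ord by (auto intro: continuous_on_subset)
      moreover have "f y - f x \<noteq> 0" if "y \<in> {c..d}" for y using less[of x y] that x ord by auto
      ultimately show "continuous_on {c..d} g" unfolding g_def
        using x ord by (intro continuous_intros) auto
    qed
    then show ?thesis by (simp add: g_def algebra_simps)
  qed
  \<comment> \<open>Integration in \<open>x\<close>: the derivative of \<open>H\<close> is the
    difference of the two sides of \<open>inner\<close>.\<close>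
  define H where "H x = K * (ln (d - x) - ln (c - x)) - (ln (f d - f x) - ln (f c - f x))" for x
  have HH: "H a \<le> H b"
  proof (rule DERIV_nonneg_imp_increasing_open[of a b H])
    show "a \<le> b" using ord by simp
    fix x assume x: "a < x" "x < b"
    have fx: "f x < f c" "f x < f d" using less x ord by auto
    have "(H has_real_derivative (K * (1 / (c - x) - 1 / (d - x)) -
        D x * (1 / (f c - f x) - 1 / (f d - f x)))) (at x)"
      unfolding H_def using fx x ord
      by (auto intro!: derivative_eq_intros der simp: algebra_simps)
    then show "\<exists>z. (H has_real_derivative z) (at x) \<and> 0 \<le> z" using inner[OF x] by force
  next
    have "continuous_on {a..b} f" using cont ord by (auto intro: continuous_on_subset)
    moreover have "f d - f x \<noteq> 0" "f c - f x \<noteq> 0" if "x \<in> {a..b}" for x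
      using less[of x c] less[of x d] that ord by auto
    ultimately show "continuous_on {a..b} H" unfolding H_def
      using ord by (intro continuous_intros) auto
  qed
  have fl: "f a < f b" "f b < f c" "f c < f d" using less ord by auto
  have ln4: "ln ((A * B) / (C * E)) = ln A + ln B - ln C - ln E"
    if "A > 0" "B > 0" "C > 0" "E > 0" for A B C E :: real
    using that by (simp add: ln_mult_pos ln_div)
  have "ln (((f c - f a) * (f d - f b)) / ((f c - f b) * (f d - f a))) =
      ln (f c - f a) + ln (f d - f b) - ln (f c - f b) - ln (f d - f a)"
    "ln (((c - a) * (d - b)) / ((c - b) * (d - a))) =
      ln (c - a) + ln (d - b) - ln (c - b) - ln (d - a)"
    using fl ord by (intro ln4; simp)+
  then show ?thesis using HH unfolding H_def by (simp only:) (simp add: algebra_simps)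
qed

text \<open>For ordered points this is the logarithm of one plus
  \<open>|b - a| |d - c| / (|c - b| |d - a|)\<close>; it is large when the middle interval is short
  compared with both adjacent gaps. The absolute values make it insensitive to orientation.\<close>

definition cross_ratio :: "real \<Rightarrow> real \<Rightarrow> real \<Rightarrow> real \<Rightarrow> real" where
  "cross_ratio a b c d = ln ((\<bar>c - a\<bar> * \<bar>d - b\<bar>) / (\<bar>c - b\<bar> * \<bar>d - a\<bar>))"

definition ordered4 :: "real \<Rightarrow> real \<Rightarrow> real \<Rightarrow> real \<Rightarrow> bool" where
  "ordered4 a b c d \<longleftrightarrow> (a < b \<and> b < c \<and> c < d) \<or> (d < c \<and> c < b \<and> b < a)"

lemma cross_ratio_rev: "cross_ratio a b c d = cross_ratio d c b a"
  by (simp add: cross_ratio_def abs_minus_commute mult.commute)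

text \<open>Ptolemy's identity for four points on a line.\<close>

lemma cross_ratio_eq:
  assumes "ordered4 a b c d"
  shows "cross_ratio a b c d = ln (1 + (\<bar>b - a\<bar> * \<bar>d - c\<bar>) / (\<bar>c - b\<bar> * \<bar>d - a\<bar>))"
proof -
  have "\<bar>c - a\<bar> * \<bar>d - b\<bar> = \<bar>c - b\<bar> * \<bar>d - a\<bar> + \<bar>b - a\<bar> * \<bar>d - c\<bar>"
    using assms by (auto simp: ordered4_def abs_if algebra_simps)
  moreover have "\<bar>c - b\<bar> * \<bar>d - a\<bar> \<noteq> 0" using assms by (auto simp: ordered4_def)
  ultimately show ?thesis by (simp add: cross_ratio_def add_divide_distrib)
qed

text \<open>Within the quadruple \<open>y - x\<close> is at most \<open>|d - a|\<close>, so the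
  pointwise factor is dominated by one constant. Decreasing maps are replaced by their negatives,
  decreasing quadruples are read backwards.\<close>

lemma cross_ratio_image_le:
  fixes f D :: "real \<Rightarrow> real"
  assumes ord: "ordered4 a b c d" and sub: "{min a d..max a d} \<subseteq> {lo..hi}"
    and cont: "continuous_on {lo..hi} f"
    and mono: "strict_mono_on {lo..hi} f \<or> strict_antimono_on {lo..hi} f"
    and der: "\<And>x. lo < x \<Longrightarrow> x < hi \<Longrightarrow> (f has_real_derivative D x) (at x)"
    and dist: "\<And>x y. lo < x \<Longrightarrow> x < y \<Longrightarrow> y < hi \<Longrightarrow>
       D x * D y * (x - y)\<^sup>2 \<le> exp (Lip * (y - x)) * (f x - f y)\<^sup>2"
    and L: "0 \<le> Lip"
  shows "cross_ratio (f a) (f b) (f c) (f d) \<le> exp (Lip * \<bar>d - a\<bar>) * cross_ratio a b c d"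
proof -
  have main: "cross_ratio (f a) (f b) (f c) (f d) \<le> exp (Lip * \<bar>d - a\<bar>) * cross_ratio a b c d"
    if ord: "a < b" "b < c" "c < d" and sub: "{a..d} \<subseteq> {lo..hi}"
      and cont: "continuous_on {lo..hi} f" and mono: "strict_mono_on {lo..hi} f"
      and der: "\<And>x. lo < x \<Longrightarrow> x < hi \<Longrightarrow> (f has_real_derivative D x) (at x)"
      and dist: "\<And>x y. lo < x \<Longrightarrow> x < y \<Longrightarrow> y < hi \<Longrightarrow>
         D x * D y * (x - y)\<^sup>2 \<le> exp (Lip * (y - x)) * (f x - f y)\<^sup>2"
    for a b c d f and D :: "real \<Rightarrow> real"
  proof -
    have ab: "lo \<le> a" "d \<le> hi" using sub ord by auto
    have m: "strict_mono_on {a..d} f" using mono sub by (rule monotone_on_subset)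
    have less: "f x < f y" if "a \<le> x" "x < y" "y \<le> d" for x y
      using monotone_onD[OF m, of x y] that by auto
    have "ln (((f c - f a) * (f d - f b)) / ((f c - f b) * (f d - f a)))
      \<le> exp (Lip * (d - a)) * ln (((c - a) * (d - b)) / ((c - b) * (d - a)))"
    proof (rule ln_cross_ratio_le[OF ord _ m, of D])
      show "continuous_on {a..d} f" using cont sub by (rule continuous_on_subset)
      show "(f has_real_derivative D x) (at x)" if "a < x" "x < d" for x using der that ab by auto
      fix x y assume xy: "a < x" "x < y" "y < d"
      have "D x * D y * (x - y)\<^sup>2 \<le> exp (Lip * (y - x)) * (f x - f y)\<^sup>2" using dist xy ab by auto
      also have "\<dots> \<le> exp (Lip * (d - a)) * (f x - f y)\<^sup>2"
        using xy L by (intro mult_right_mono) (auto intro: mult_left_mono)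
      finally show "D x * D y * (x - y)\<^sup>2 \<le> exp (Lip * (d - a)) * (f x - f y)\<^sup>2" .
    qed
    then show ?thesis using less ord by (simp add: cross_ratio_def abs_of_pos)
  qed
  have inc: "cross_ratio (f a) (f b) (f c) (f d) \<le> exp (Lip * \<bar>d - a\<bar>) * cross_ratio a b c d"
    if "a < b" "b < c" "c < d" "{a..d} \<subseteq> {lo..hi}" for a b c d
  proof (cases "strict_mono_on {lo..hi} f")
    case True
    then show ?thesis using main[OF that cont True der dist] by blast
  next
    case False
    then have m: "strict_mono_on {lo..hi} (\<lambda>x. - f x)"
      using mono by (auto simp: monotone_on_def)
    have "cross_ratio (- f a) (- f b) (- f c) (- f d) \<le> exp (Lip * \<bar>d - a\<bar>) * cross_ratio a b c d"
    proof (rule main[OF that _ m, of "\<lambda>x. - D x"])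
      show "continuous_on {lo..hi} (\<lambda>x. - f x)" using cont by (intro continuous_intros)
      show "((\<lambda>x. - f x) has_real_derivative - D x) (at x)" if "lo < x" "x < hi" for x
        using der[OF that] by (rule DERIV_minus)
      show "- D x * - D y * (x - y)\<^sup>2 \<le> exp (Lip * (y - x)) * (- f x - - f y)\<^sup>2"
        if "lo < x" "x < y" "y < hi" for x y
        using dist[OF that] by (simp add: power2_commute)
    qed
    then show ?thesis by (simp add: cross_ratio_def abs_minus_commute)
  qed
  show ?thesis
  proof (cases "a < d")
    case True
    then show ?thesis using inc[of a b c d] ord sub by (auto simp: ordered4_def)
  next
    case False
    then have "cross_ratio (f d) (f c) (f b) (f a) \<le> exp (Lip * \<bar>a - d\<bar>) * cross_ratio d c b a"
      using ord sub by (intro inc) (auto simp: ordered4_def)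
    then show ?thesis by (simp add: cross_ratio_rev[of d] abs_minus_commute cross_ratio_rev[of "f d"])
  qed
qed

text \<open>The sum is the Lebesgue measure of a union inside the unit interval.\<close>

lemma sum_disjoint_intervals_le:
  fixes l u :: "nat \<Rightarrow> real"
  assumes "\<And>j. j < N \<Longrightarrow> l j \<le> u j \<and> 0 \<le> l j \<and> u j \<le> 1"
    and "\<And>i j. i < j \<Longrightarrow> j < N \<Longrightarrow> {l i<..<u i} \<inter> {l j<..<u j} = {}"
  shows "(\<Sum>j<N. u j - l j) \<le> 1"
proof -
  have "(\<Sum>j<N. u j - l j) = (\<Sum>j<N. measure lborel {l j<..<u j})"
    using assms(1) by (intro sum.cong) auto
  also have "\<dots> = measure lborel (\<Union>j<N. {l j<..<u j})"
  proof (rule measure_finite_Union[symmetric])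
    show "disjoint_family_on (\<lambda>j. {l j<..<u j}) {..<N}"
      unfolding disjoint_family_on_def
    proof (intro ballI impI)
      fix i j assume "i \<in> {..<N}" "j \<in> {..<N}" "i \<noteq> j"
      then show "{l i<..<u i} \<inter> {l j<..<u j} = {}"
        using assms(2)[of i j] assms(2)[of j i] by (cases i j rule: linorder_cases) auto
    qed
  qed (use assms in auto)
  also have "\<dots> \<le> measure lborel {0..1::real}"
  proof (rule measure_mono_fmeasurable)
    show "(\<Union>j<N. {l j<..<u j}) \<subseteq> {0..1}" using assms(1) by fastforce
  qed (auto intro!: fmeasurable_compact)
  finally show ?thesis by simp
qed

section \<open>Return times under Fibonacci combinatorics\<close>

locale fib_map = half_bimodal +
  assumes fib: "\<And>k. a \<in> val_open c F k"
begin

lemma good: "good k"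
  using good_all(1)[OF fib, of k k] by simp

lemma linked: "linked k"
  using good_all(2)[OF fib, of k k] by simp

lemma side_less: "y \<in> Z (Suc k) \<Longrightarrow> x \<in> C k \<Longrightarrow> k > 0 \<Longrightarrow> side k * x < side k * \<Psi> k y"
  using good_all(3)[OF fib, of k k] by simp

lemma a_bounds: "p < a" "a < 1"
  using val_open_1_less[OF fib[of 1, simplified One_nat_def]] by auto

lemma W_eq: "W k = {lv k<..<uv k}" and Z_eq: "Z k = {lv k..uv k}"
  and V_eq: "V k = {nl k<..<nr k}" and C_eq: "C k = {nl k..nr k}"
  using good[of k] by (auto simp: good_def)

lemma lv_bounds: "0 \<le> lv k" "lv k < a" "a < uv k" "uv k \<le> 1"
  and nest_bounds: "0 \<le> nl k" "nl k < c" "c < nr k" "nr k \<le> p"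
  and G_ends: "G (nl k) = lv k" "G (nr k) = lv k"
  using good[of k] by (auto simp: good_def)

lemma C_Suc_sub: "C (Suc k) \<subseteq> V k"
  using linked[of k] unfolding C_eq V_eq linked_def by auto

lemma V_sub_C: "V k \<subseteq> C k"
  unfolding C_eq V_eq by auto

lemma V_Suc_sub: "V (Suc k) \<subseteq> V k"
  using C_Suc_sub V_sub_C by blast

lemma C_unit: "x \<in> C k \<Longrightarrow> x \<in> {0..1}"
  using good_C_sub[OF good] order by fastforce

lemma a_mem_Z: "a \<in> Z k"
  using lv_bounds[of k] unfolding Z_eq by auto

lemma Psi_C: "y \<in> Z (Suc k) \<Longrightarrow> \<Psi> (Suc k) y \<in> C k"
proof (cases k)
  case 0
  assume "y \<in> Z (Suc k)"
  then show ?thesis using 0 G_bounds[of y] G_bounds[of "G y"]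
    by (auto simp: nest_closed_def base_closed_def)
qed (auto simp: nest_closed_def)

lemma Psi_V: "y \<in> W (Suc k) \<Longrightarrow> \<Psi> (Suc k) y \<in> V k"
proof (cases k)
  case 0
  assume y: "y \<in> W (Suc k)"
  then have "F (G y) < 0" "y \<in> {0..1}" using 0 by auto
  then have "G y \<in> {0<..<p}" using G_bounds[of y] F_ge_0[of "G y"] F_vals
    by (cases "G y = 0"; cases "G y < p") auto
  moreover have "V 0 = {0<..<p}" using nest_0[OF a_bounds(2)] by (simp add: V_eq)
  ultimately show ?thesis using 0 by simp
qed (auto simp: nest_open_def)

text \<open>For \<open>k = Suc m\<close> the time consists of a block
  \<open>pre_time (Suc m)\<close>, one fold and a block \<open>pre_time m\<close>. Induction covers
  the first block; at its end the point is outside \<open>C (Suc m)\<close> by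
  \<open>side_less\<close>; after the fold it is a point of \<open>Z m\<close>, and induction
  applies again, the block being empty for \<open>m = 0\<close>.\<close>

lemma return_not_before:
  "y \<in> Z (Suc k) \<Longrightarrow> j < pre_time (Suc k) \<Longrightarrow> (G ^^ j) y \<notin> V k"
proof (induction k arbitrary: y j rule: less_induct)
  case (less k)
  show ?case
  proof (cases k)
    case 0
    have "p \<le> y" using good_1(3)[OF fib] less.prems 0 by auto
    then have "y \<notin> V 0" using nest_bounds(4)[of 0] unfolding V_eq by auto
    then show ?thesis using less.prems 0 by auto
  next
    case (Suc m)
    have y: "y \<in> Z (Suc m)" "\<Psi> (Suc m) y \<in> C m"
      using less.prems Psi_C[of y m] by (auto simp: Suc)
    consider "j < pre_time (Suc m)" | "j = pre_time (Suc m)" | "j > pre_time (Suc m)" by linarith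
    then show ?thesis
    proof cases
      case 1
      then show ?thesis using less.IH[of m y j] y Suc V_Suc_sub by auto
    next
      case 2
      have "\<Psi> (Suc m) y \<notin> C (Suc m)" using side_less[of y "Suc m"] less.prems Suc by blast
      then show ?thesis using 2 Suc V_sub_C by blast
    next
      case 3
      define i where "i = j - pre_time (Suc m) - 1"
      have i: "j = i + Suc (pre_time (Suc m))" "i < pre_time m"
        using 3 less.prems Suc by (auto simp: i_def)
      then obtain n where n: "m = Suc n" by (cases m) auto
      have "(G ^^ j) y = (G ^^ i) (G (\<Psi> (Suc m) y))" unfolding i funpow_add by simp
      moreover have "(G ^^ i) (G (\<Psi> (Suc m) y)) \<notin> V n"
        using less.IH[of n "G (\<Psi> (Suc m) y)" i] good_C_Z[OF y(2)] i n Suc by auto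
      ultimately show ?thesis using V_Suc_sub Suc n by auto
    qed
  qed
qed

text \<open>Starting one step before the value turns \<open>pre_time\<close> into
  \<open>fib_time\<close>. All points of \<open>V (Suc k)\<close> share this first return time to
  \<open>V k\<close>, not only \<open>c\<close>.\<close>

lemma fold_return:
  "x \<in> V (Suc k) \<Longrightarrow> (G ^^ fib_time (Suc k)) x \<in> V k"
  "x \<in> C (Suc k) \<Longrightarrow> 0 < j \<Longrightarrow> j < fib_time (Suc k) \<Longrightarrow> (G ^^ j) x \<notin> V k"
proof -
  have e: "(G ^^ Suc n) x = (G ^^ n) (G x)" for n by (simp add: funpow_swap1)
  show "x \<in> V (Suc k) \<Longrightarrow> (G ^^ fib_time (Suc k)) x \<in> V k"
    unfolding fib_time_eq e by (rule Psi_V) (auto simp: nest_open_def)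
  assume x: "x \<in> C (Suc k)" and j: "0 < j" "j < fib_time (Suc k)"
  then obtain i where "j = Suc i" by (cases j) auto
  then show "(G ^^ j) x \<notin> V k"
    using return_not_before[OF good_C_Z[OF x], of i] j by (simp add: e fib_time_eq del: funpow.simps)
qed

text \<open>\<open>lv (Suc k)\<close> runs to an end of \<open>C k\<close> without meeting
  \<open>V k\<close>, and one fold later it is at \<open>lv k\<close>. Thus all lower ends finally
  land on the fixed point 0.\<close>

lemma lv_Suc_avoids:
  assumes IH: "\<And>i. (G ^^ i) (lv k) \<notin> V k"
  shows "(G ^^ i) (lv (Suc k)) \<notin> V k"
proof -
  have l: "lv (Suc k) \<in> Z (Suc k)" using lv_bounds[of "Suc k"] by (simp add: Z_eq)
  have e: "\<Psi> (Suc k) (lv (Suc k)) = edge k (- side (Suc k))"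
    using linked[of k] by (auto simp: linked_def)
  consider "i < pre_time (Suc k)" | "i = pre_time (Suc k)" | "i > pre_time (Suc k)" by linarith
  then show ?thesis
  proof cases
    case 1
    then show ?thesis using return_not_before[OF l] by blast
  next
    case 2
    then show ?thesis using e by (auto simp: edge_def V_eq)
  next
    case 3
    define n where "n = i - pre_time (Suc k) - 1"
    have n: "i = n + Suc (pre_time (Suc k))" using 3 by (auto simp: n_def)
    have "(G ^^ i) (lv (Suc k)) = (G ^^ n) (G (\<Psi> (Suc k) (lv (Suc k))))"
      unfolding n funpow_add by simp
    also have "\<dots> = (G ^^ n) (lv k)" unfolding e using G_ends by (simp add: edge_def)
    finally show ?thesis using IH by simp
  qed
qed

lemma lv_never_returns: "(G ^^ i) (lv k) \<notin> V k"
proof (induction k arbitrary: i)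
  case 0
  have "(G ^^ i) 0 = 0" by (induction i) auto
  then show ?case using good_0(2)[OF a_bounds(2)] nest_0(1)[OF a_bounds(2)] by (simp add: V_eq)
next
  case (Suc k)
  then show ?case using lv_Suc_avoids V_Suc_sub by blast
qed

text \<open>The ends of \<open>V (Suc k)\<close> do not belong to the return domain of
  \<open>V k\<close>, so \<open>V (Suc k)\<close> is a whole component of it and not a part of
  one.\<close>

lemma ends_avoid:
  assumes "j > 0" shows "(G ^^ j) (nl (Suc k)) \<notin> V k" "(G ^^ j) (nr (Suc k)) \<notin> V k"
proof -
  obtain i where j: "j = Suc i" using assms by (cases j) auto
  show "(G ^^ j) (nl (Suc k)) \<notin> V k" "(G ^^ j) (nr (Suc k)) \<notin> V k"
    unfolding j funpow_Suc_right using lv_Suc_avoids[OF lv_never_returns, of i k] G_ends[of "Suc k"] by auto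
qed

lemma fib_time_gt: "k < fib_time k"
proof (induction k rule: fib_time.induct)
  case (3 k)
  moreover have "fib_time k > 0" by (simp add: fib_time_eq)
  ultimately show ?case by simp
qed auto

lemma c_mem_V: "c \<in> V k"
  using nest_bounds[of k] by (auto simp: V_eq)

text \<open>A period \<open>n\<close> would be a return of \<open>c\<close> to \<open>V n\<close>
  before the first return time \<open>fib_time (Suc n)\<close>, which exceeds
  \<open>n\<close>.\<close>

lemma not_periodic:
  assumes "n > 0" shows "(G ^^ n) c \<noteq> c"
  using fold_return(2)[of c n n] c_mem_V[of "Suc n"] c_mem_V[of n] V_sub_C assms
    fib_time_gt[of "Suc n"] by force

end

section \<open>Absence of wandering intervals\<close>

lemma ordered4_image:
  fixes f :: "real \<Rightarrow> real"
  assumes ord: "a < b" "b < c" "c < d" and cont: "continuous_on {a..d} f" and inj: "inj_on f {a..d}"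
  shows "ordered4 (f a) (f b) (f c) (f d)"
proof -
  have mid: "(f x < f y \<and> f y < f z) \<or> (f z < f y \<and> f y < f x)"
    if "x < y" "y < z" "a \<le> x" "z \<le> d" for x y z
    using continuous_inj_imp_mono[of x y z f] continuous_on_subset[OF cont, of "{x..z}"]
      inj_on_subset[OF inj, of "{x..z}"] that by auto
  show ?thesis using mid[of a b c] mid[of b c d] ord unfolding ordered4_def by force
qed

lemma between_endpoints_image:
  fixes f :: "real \<Rightarrow> real"
  assumes "continuous_on {x..n} f" "x \<le> n"
  shows "{min (f x) (f n)..max (f x) (f n)} \<subseteq> f ` {x..n}"
proof (rule connected_contains_Icc)
  show "connected (f ` {x..n})" using assms by (intro connected_continuous_image) auto
qed (use assms in \<open>auto simp: min_def max_def\<close>)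

lemma sum_lessThan_add:
  fixes f :: "nat \<Rightarrow> real"
  shows "(\<Sum>j<m + n. f j) = (\<Sum>j<m. f j) + (\<Sum>j<n. f (j + m))"
  by (induction n) (auto simp: add.commute)

context half_bimodal
begin

text \<open>Near each of the turning points \<open>c\<close> and \<open>p\<close> of the fold some
  value is taken on both sides.\<close>

lemma inj_on_G_lap:
  assumes sub: "{x..y} \<subseteq> {0..1}" and xy: "x < y" and inj: "inj_on G {x..y}"
  shows "{x..y} \<subseteq> {0..c} \<or> {x..y} \<subseteq> {c..p} \<or> {x..y} \<subseteq> {p..1}"
proof -
  have b: "0 \<le> x" "y \<le> 1" using sub xy by auto
  have "\<not> (x < c \<and> c < y)"
  proof
    assume *: "x < c \<and> c < y"
    define y' where "y' = min y p"
    define v where "v = max (G x) (G y')"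
    have y': "c < y'" "y' \<le> p" "y' \<le> y" using * order by (auto simp: y'_def)
    have v: "0 \<le> v" "v < a"
      using G_inc[of x c] G_dec[of c y'] G_bounds[of x] * y' b order by (auto simp: v_def)
    obtain l r where lr: "0 \<le> l" "l < c" "c < r" "r \<le> p" "G l = v" "G r = v"
      "\<And>z. z \<in> {0..p} \<Longrightarrow> (v \<le> G z \<longleftrightarrow> z \<in> {l..r}) \<and> (v < G z \<longleftrightarrow> z \<in> {l<..<r})"
      by (rule fold_preimage[OF v]) (rule that)
    have "x \<le> l" using lr(7)[of x] lr(2,3) * b order by (auto simp: v_def)
    moreover have "r \<le> y'" using lr(7)[of y'] lr(2,3) * y' order by (auto simp: v_def)
    ultimately show False using inj_onD[OF inj, of l r] lr y' * by auto
  qed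
  moreover have "\<not> (c \<le> x \<and> x < p \<and> p < y)"
  proof
    assume *: "c \<le> x \<and> x < p \<and> p < y"
    define v where "v = min (G x) (G y)"
    have v: "0 < v" using G_dec[of x p] G_inc'[of p y] * b by (auto simp: v_def)
    have "\<exists>s\<ge>x. s \<le> p \<and> G s = v"
      by (rule IVT2') (use v b * order in \<open>auto simp: v_def intro: continuous_on_subset[OF cont_G]\<close>)
    then obtain s where s: "x \<le> s" "s \<le> p" "G s = v" by auto
    have "\<exists>t\<ge>p. t \<le> y \<and> G t = v"
      by (rule IVT') (use v b * order in \<open>auto simp: v_def intro: continuous_on_subset[OF cont_G]\<close>)
    then obtain t where t: "p \<le> t" "t \<le> y" "G t = v" by auto
    have "s = t" using inj_onD[OF inj, of s t] s t * by auto
    then show False using s t v by auto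
  qed
  ultimately show ?thesis using b by auto
qed

text \<open>The images at times below \<open>N\<close> are disjoint: a common point of the images at
  times \<open>i < j\<close> would enter \<open>U\<close> after \<open>N - j\<close> further steps,
  hence a point of the interval would have entered at the positive time
  \<open>N - j + i < N\<close>.\<close>

lemma sum_lengths_until_entry:
  assumes xn: "0 \<le> x" "x < n" "n \<le> 1"
    and entry: "\<And>y. x < y \<Longrightarrow> y < n \<Longrightarrow> (G ^^ N) y \<in> U"
    and before: "\<And>y j. x < y \<Longrightarrow> y < n \<Longrightarrow> 0 < j \<Longrightarrow> j < N \<Longrightarrow> (G ^^ j) y \<notin> U"
  shows "(\<Sum>j<N. \<bar>(G ^^ j) n - (G ^^ j) x\<bar>) \<le> 1"
proof -
  define l where "l j = min ((G ^^ j) x) ((G ^^ j) n)" for j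
  define u where "u j = max ((G ^^ j) x) ((G ^^ j) n)" for j
  have lu: "l j \<le> u j \<and> 0 \<le> l j \<and> u j \<le> 1" for j
    using funpow_maps[of x j] funpow_maps[of n j] xn by (auto simp: l_def u_def)
  have pre: "\<exists>y. x < y \<and> y < n \<and> z = (G ^^ j) y" if "z \<in> {l j<..<u j}" for z j
  proof -
    have "continuous_on {x..n} (G ^^ j)"
      using xn by (intro continuous_on_subset[OF cont_funpow]) auto
    from between_endpoints_image[OF this] xn
    have "{l j..u j} \<subseteq> (G ^^ j) ` {x..n}" by (simp add: l_def u_def)
    moreover have "z \<in> {l j..u j}" using that by simp
    ultimately obtain y where y: "y \<in> {x..n}" "z = (G ^^ j) y" by blast
    then have "y \<noteq> x" "y \<noteq> n" using that by (auto simp: l_def u_def)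
    then show ?thesis using y by (intro exI[of _ y]) auto
  qed
  have "(\<Sum>j<N. u j - l j) \<le> 1"
  proof (rule sum_disjoint_intervals_le[OF lu])
    fix i j assume ij: "i < j" "j < N"
    show "{l i<..<u i} \<inter> {l j<..<u j} = {}"
    proof (rule ccontr)
      assume "{l i<..<u i} \<inter> {l j<..<u j} \<noteq> {}"
      then obtain z where z: "z \<in> {l i<..<u i}" "z \<in> {l j<..<u j}" by blast
      then obtain y y' where y: "x < y" "y < n" "z = (G ^^ i) y" "x < y'" "y' < n" "z = (G ^^ j) y'"
        using pre[OF z(1)] pre[OF z(2)] by blast
      have "(G ^^ (N - j)) z = (G ^^ (N - j + j)) y'" unfolding y(6) funpow_add by simp
      then have 1: "(G ^^ (N - j)) z \<in> U" using ij entry y by simp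
      have "(G ^^ (N - j)) z = (G ^^ (N - j + i)) y" unfolding y(3) funpow_add by simp
      moreover have "0 < N - j + i" "N - j + i < N" using ij by auto
      ultimately show False using 1 before[of y "N - j + i"] y by metis
    qed
  qed
  moreover have "u j - l j = \<bar>(G ^^ j) n - (G ^^ j) x\<bar>" for j by (auto simp: l_def u_def)
  ultimately show ?thesis by simp
qed

end

text \<open>With \<open>Lip = 0\<close> the inequality is the one satisfied by maps of negative
  Schwarzian derivative; the exponential pays for the weight. Pairs are taken on one side of
  \<open>c\<close>, where \<open>D\<close> keeps its sign.\<close>

locale fib_map_distortion = fib_map +
  fixes D :: "real \<Rightarrow> real" and Lip :: real
  assumes Lip: "0 \<le> Lip"
    and deriv: "\<And>x. 0 < x \<Longrightarrow> x < 1 \<Longrightarrow> (F has_real_derivative D x) (at x)"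
    and distortion: "\<And>x y. 0 < x \<Longrightarrow> x < y \<Longrightarrow> y < 1 \<Longrightarrow> y < c \<or> c < x \<Longrightarrow>
       D x * D y * (x - y)\<^sup>2 \<le> exp (Lip * (y - x)) * (F x - F y)\<^sup>2"
begin

text \<open>Injectivity places the quadruple in one lap of the fold, where \<open>G\<close> is
  \<open>F\<close> or \<open>- F\<close>; the laps on both sides of \<open>p\<close> belong to the
  same lap of \<open>F\<close>.\<close>

lemma cross_ratio_G_le:
  assumes ord: "ordered4 x1 x2 x3 x4" and sub: "{min x1 x4..max x1 x4} \<subseteq> {0..1}"
    and inj: "inj_on G {min x1 x4..max x1 x4}"
  shows "cross_ratio (G x1) (G x2) (G x3) (G x4) \<le> exp (Lip * \<bar>x4 - x1\<bar>) * cross_ratio x1 x2 x3 x4"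
proof -
  have mem: "x1 \<in> {min x1 x4..max x1 x4}" "x2 \<in> {min x1 x4..max x1 x4}"
    "x3 \<in> {min x1 x4..max x1 x4}" "x4 \<in> {min x1 x4..max x1 x4}"
    using ord by (auto simp: ordered4_def)
  have lt: "min x1 x4 < max x1 x4" using ord by (auto simp: ordered4_def)
  obtain lo hi sn where lap: "{min x1 x4..max x1 x4} \<subseteq> {lo..hi}" "lo = 0 \<and> hi = c \<or> lo = c \<and> hi = 1"
    and G: "\<bar>sn\<bar> = 1" "\<And>x. x \<in> {min x1 x4..max x1 x4} \<Longrightarrow> G x = sn * F x"
  proof -
    consider "{min x1 x4..max x1 x4} \<subseteq> {0..c}" | "{min x1 x4..max x1 x4} \<subseteq> {c..p}"
      | "{min x1 x4..max x1 x4} \<subseteq> {p..1}"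
      using inj_on_G_lap[OF sub lt inj] by auto
    then show thesis
    proof cases
      case 1
      then show thesis using order by (intro that[of 0 c "-1"]) (auto simp: G_neg)
    next
      case 2
      then show thesis using order by (intro that[of c 1 "-1"]) (auto simp: G_neg)
    next
      case 3
      then show thesis using order by (intro that[of c 1 1]) (auto simp: G_pos)
    qed
  qed
  have "cross_ratio (F x1) (F x2) (F x3) (F x4) \<le> exp (Lip * \<bar>x4 - x1\<bar>) * cross_ratio x1 x2 x3 x4"
    by (rule cross_ratio_image_le[OF ord lap(1) _ _ _ _ Lip, where D = D])
      (use lap(2) dec inc deriv distortion order in \<open>auto intro: continuous_on_subset[OF cont]\<close>)
  moreover have "\<bar>G x - G y\<bar> = \<bar>F x - F y\<bar>"
    if "x \<in> {min x1 x4..max x1 x4}" "y \<in> {min x1 x4..max x1 x4}" for x y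
    unfolding G(2)[OF that(1)] G(2)[OF that(2)] right_diff_distrib[symmetric] abs_mult G(1) by simp
  ultimately show ?thesis using mem by (simp only: cross_ratio_def)
qed

text \<open>Injectivity of the last iterate passes to all earlier ones, so every step stays in one
  lap, and the exponents add up to \<open>Lip\<close> times the total length.\<close>

lemma cross_ratio_funpow_le:
  assumes pts: "0 \<le> x1" "x1 < x2" "x2 < x3" "x3 < x4" "x4 \<le> 1"
    and inj: "inj_on (G ^^ N) {x1..x4}"
  shows "cross_ratio ((G ^^ N) x1) ((G ^^ N) x2) ((G ^^ N) x3) ((G ^^ N) x4)
    \<le> exp (Lip * (\<Sum>j<N. \<bar>(G ^^ j) x4 - (G ^^ j) x1\<bar>)) * cross_ratio x1 x2 x3 x4"
  using inj
proof (induction N)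
  case (Suc N)
  define S where "S = (\<Sum>j<N. \<bar>(G ^^ j) x4 - (G ^^ j) x1\<bar>)"
  have cm: "inj_on (G \<circ> (G ^^ N)) {x1..x4}" using Suc.prems by (simp add: o_def)
  then have inj: "inj_on (G ^^ N) {x1..x4}" by (rule inj_on_imageI2)
  have cont: "continuous_on {x1..x4} (G ^^ N)"
    using pts by (intro continuous_on_subset[OF cont_funpow]) auto
  have ord: "ordered4 ((G ^^ N) x1) ((G ^^ N) x2) ((G ^^ N) x3) ((G ^^ N) x4)"
    using ordered4_image[OF pts(2-4) cont inj] .
  have sub: "{min ((G ^^ N) x1) ((G ^^ N) x4)..max ((G ^^ N) x1) ((G ^^ N) x4)} \<subseteq> (G ^^ N) ` {x1..x4}"
    using between_endpoints_image[OF cont] pts by simp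
  have "(G ^^ N) ` {x1..x4} \<subseteq> {0..1}" using funpow_maps pts by force
  with sub have sub': "{min ((G ^^ N) x1) ((G ^^ N) x4)..max ((G ^^ N) x1) ((G ^^ N) x4)} \<subseteq> {0..1}"
    by blast
  have injG: "inj_on G {min ((G ^^ N) x1) ((G ^^ N) x4)..max ((G ^^ N) x1) ((G ^^ N) x4)}"
    using inj_on_subset[OF inj_on_imageI[OF cm] sub] .
  have "cross_ratio ((G ^^ Suc N) x1) ((G ^^ Suc N) x2) ((G ^^ Suc N) x3) ((G ^^ Suc N) x4)
    \<le> exp (Lip * \<bar>(G ^^ N) x4 - (G ^^ N) x1\<bar>) *
        cross_ratio ((G ^^ N) x1) ((G ^^ N) x2) ((G ^^ N) x3) ((G ^^ N) x4)"
    using cross_ratio_G_le[OF ord sub' injG] by simp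
  also have "\<dots> \<le> exp (Lip * \<bar>(G ^^ N) x4 - (G ^^ N) x1\<bar>) * (exp (Lip * S) * cross_ratio x1 x2 x3 x4)"
    using Suc.IH[OF inj] by (intro mult_left_mono) (auto simp: S_def)
  also have "\<dots> = exp (Lip * (S + \<bar>(G ^^ N) x4 - (G ^^ N) x1\<bar>)) * cross_ratio x1 x2 x3 x4"
    by (simp add: distrib_left exp_add)
  finally show ?case by (simp add: S_def)
qed simp

text \<open>The close return lies in \<open>C i\<close> but not in \<open>C (Suc i)\<close>, and the
  fold sends the ends of these intervals to \<open>lv i\<close> and \<open>lv (Suc i)\<close>.
  Lengths of images at level \<open>i\<close> are thus bounded by the increments of
  \<open>lv\<close>.\<close>

lemma G_Psi_range:
  assumes "y \<in> Z (Suc (Suc i))"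
  shows "lv i \<le> G (\<Psi> (Suc i) y)" "G (\<Psi> (Suc i) y) < lv (Suc i)"
proof -
  have C: "\<Psi> (Suc i) y \<in> C i" using assms Psi_C[of y i] by auto
  show "lv i \<le> G (\<Psi> (Suc i) y)" using good_C_Z[OF C] by (simp add: Z_eq)
  have x: "\<Psi> (Suc i) y \<in> {0..p}" using good_C_sub[OF good C] .
  have "\<Psi> (Suc i) y \<notin> C (Suc i)" using side_less[OF assms] by blast
  then have "G (\<Psi> (Suc i) y) \<notin> Z (Suc i)" using x by (auto simp: nest_closed_def base_closed_eq)
  moreover have "G (\<Psi> (Suc i) y) \<le> a" using G_le_a x by auto
  ultimately show "G (\<Psi> (Suc i) y) < lv (Suc i)" using lv_bounds[of "Suc i"] by (auto simp: Z_eq)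
qed

lemma G_Psi_less:
  assumes y: "y \<in> Z (Suc (Suc i))" "y' \<in> Z (Suc (Suc i))" "y < y'"
  shows "G (\<Psi> (Suc i) y') < G (\<Psi> (Suc i) y)"
proof -
  have C: "\<Psi> (Suc i) y \<in> {0..p}" "\<Psi> (Suc i) y' \<in> {0..p}"
    using y Psi_C[of y i] Psi_C[of y' i] good_C_sub[OF good] by auto
  have Z': "y \<in> Z (Suc i)" "y' \<in> Z (Suc i)" using y by auto
  have "c \<in> C (Suc i)" using c_mem_V V_sub_C by blast
  then have "side (Suc i) * c < side (Suc i) * \<Psi> (Suc i) y"
    using side_less[OF y(1)] by simp
  moreover have "side (Suc i) * \<Psi> (Suc i) y < side (Suc i) * \<Psi> (Suc i) y'"
    using Psi_less[OF good Z' y(3)] .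
  ultimately show ?thesis
    using side_cases[of "Suc i"] C G_inc[of "\<Psi> (Suc i) y'" "\<Psi> (Suc i) y"]
      G_dec[of "\<Psi> (Suc i) y" "\<Psi> (Suc i) y'"] by auto
qed

end

context fib_map_distortion
begin

text \<open>
  With \<open>k = Suc i\<close>, \<open>G ^^ fib_time (k + 2)\<close> maps an interval \<open>[x1, x4]\<close> around \<open>[w, a]\<close>
  monotonically onto \<open>[lv k, a]\<close>, with iterates of total length at most 3. By \<open>small\<close>, the
  image of \<open>[w, a]\<close> has space on both sides, hence the gap \<open>[x1, w]\<close> is not small.
\<close>

lemma gap_lower_bound:
  assumes w: "\<And>k. lv k \<le> w" "w < a"
    and small: "G (\<Psi> (Suc (Suc (Suc i))) w) - G (\<Psi> (Suc (Suc (Suc i))) a)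
        \<le> G (\<Psi> (Suc (Suc i)) w) - G (\<Psi> (Suc (Suc i)) a)"
  shows "(a - w) * ln (1 + (a - w)) \<le> exp (3 * Lip) * (w - lv (Suc (Suc (Suc i))))"
proof -
  define k where "k = Suc i"
  define m where "m = Suc k"
  define t where "t = side k"
  have t: "- t = 1 \<or> - t = -1" and s2: "side (Suc m) = - t"
    using side_cases[of k] by (auto simp: t_def m_def)
  have wZ: "w \<in> Z j" for j using w(1)[of j] w(2) lv_bounds(3)[of j] by (simp add: Z_eq)
  define h where "h = \<Psi> (Suc m)"
  define H where "H y = - t * h y" for y
  have He: "H = (\<lambda>y. - side k * \<Psi> (Suc (Suc k)) y)" by (simp add: H_def h_def m_def t_def fun_eq_iff)
  obtain y0 where y0: "lv m < y0" "y0 < uv m"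
    "\<And>y. y \<in> Z m \<Longrightarrow> 0 \<le> side m * (\<Psi> m y - c) \<longleftrightarrow> y0 \<le> y"
    "\<And>y. y \<in> Z m \<Longrightarrow> 0 < side m * (\<Psi> m y - c) \<longleftrightarrow> y0 < y"
    "strict_mono_on {y0..uv m} H" "continuous_on {y0..uv m} H"
    "h y0 = \<Psi> k a" "h (uv m) = \<Psi> k (lv k)"
    by (rule branch[OF good[of k] good linked], rule that[unfolded He h_def m_def])
  have cC: "c \<in> C j" for j using c_mem_V V_sub_C by blast
  have i_k: "nl i < nl k" "nr k < nr i" "\<Psi> k (lv k) = edge i (- t)"
    using linked[of i] by (auto simp: linked_def k_def t_def)
  have tPa: "t * c < t * \<Psi> k a"
    using linked[of k] a_mem_Z cC by (auto simp: linked_def t_def)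
  note ek = edge_props[OF good[of k] t]
  have b1: "H y0 < - t * c" using tPa y0(7) by (simp add: H_def)
  have b2: "- t * c \<le> - t * edge k (- t)" using ek(4) by simp
  have b3: "- t * edge k (- t) < H (uv m)"
    using i_k t by (auto simp: H_def y0(8) edge_def)
  \<comment> \<open>At \<open>x1\<close> and \<open>x4\<close> the map \<open>h\<close> takes the
    values \<open>c\<close> and \<open>edge k (- t)\<close>, which the fold sends to
    \<open>a\<close> and \<open>lv k\<close>: this extension of \<open>[w, a]\<close> provides the
    space on both sides of the image.\<close>
  obtain x1 x4 where x14: "y0 < x1" "x1 \<le> x4" "x4 < uv m" "H x1 = - t * c"
    "H x4 = - t * edge k (- t)"
    "\<And>y. y \<in> {y0..uv m} \<Longrightarrow> (- t * c \<le> H y \<longleftrightarrow> x1 \<le> y) \<and> (- t * c < H y \<longleftrightarrow> x1 < y) \<and>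
       (H y \<le> - t * edge k (- t) \<longleftrightarrow> y \<le> x4) \<and> (H y < - t * edge k (- t) \<longleftrightarrow> y < x4)"
    by (rule strict_mono_interval_preimage[OF y0(6,5) less_imp_le[OF y0(2)] b1 b2 b3], rule that)
  have h14: "h x1 = c" "h x4 = edge k (- t)" using x14(4,5) t by (auto simp: H_def)
  have y0_le: "y \<in> {y0..uv m}" if "y \<in> Z (Suc m)" for y
  proof -
    have "y \<in> Z m" "0 \<le> side m * (\<Psi> m y - c)"
      using that unfolding m_def val_closed_Suc_Suc by auto
    then show ?thesis using y0(3)[of y] by (simp add: Z_eq)
  qed
  have "- t * c < H w"
    using side_less[OF wZ[of "Suc (Suc m)"] cC] s2 by (simp add: H_def h_def)
  then have x1w: "x1 < w" using x14(6)[OF y0_le[OF wZ]] by simp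
  have "h a \<in> V m" unfolding h_def by (rule Psi_V[OF fib])
  then have "h a \<in> V k" using V_Suc_sub by (auto simp: m_def)
  then have "H a < - t * edge k (- t)" using ek(2)[of "h a"] by (simp add: H_def)
  then have ax4: "a < x4" using x14(6)[OF y0_le[OF a_mem_Z]] by simp
  have u1: "0 \<le> x1" "x4 \<le> 1" using lv_bounds[of m] x14 y0 by auto
  have x14m: "y \<in> W m" if "x1 \<le> y" "y \<le> x4" for y using that x14 y0 by (simp add: W_eq)
  have x14Z: "y \<in> Z m" if "x1 \<le> y" "y \<le> x4" for y using that x14 y0 by (simp add: Z_eq)
  have hk: "0 \<le> - t * (h y - c)" "h y \<in> C k" if "x1 \<le> y" "y \<le> x4" for y
  proof -
    have "- t * c \<le> H y" "H y \<le> - t * edge k (- t)" using x14(6)[of y] that x14 y0 by auto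
    then show "0 \<le> - t * (h y - c)" "h y \<in> C k"
      using ek(1)[of "h y"] ek(3) by (auto simp: H_def algebra_simps)
  qed
  have dec_h: "G (h y') < G (h y)" if "x1 \<le> y" "y < y'" "y' \<le> x4" for y y'
  proof -
    have "H y < H y'" using monotone_onD[OF y0(5), of y y'] that x14 by auto
    then show ?thesis
      using t hk[of y] hk[of y'] that good_C_sub[OF good, of "h y" k] good_C_sub[OF good, of "h y'" k]
        G_inc[of "h y'" "h y"] G_dec[of "h y" "h y'"] by (auto simp: H_def)
  qed
  have fib_Suc: "(G ^^ fib_time (Suc m)) y = G (h y)" for y
    by (simp add: fib_time_eq h_def del: pre_time.simps)
  have inj: "inj_on (G ^^ fib_time (Suc m)) {x1..x4}"
  proof (rule linorder_inj_onI')
    fix y y' assume "y \<in> {x1..x4}" "y' \<in> {x1..x4}" "y < y'"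
    then show "(G ^^ fib_time (Suc m)) y \<noteq> (G ^^ fib_time (Suc m)) y'"
      using dec_h[of y y'] unfolding fib_Suc by auto
  qed
  \<comment> \<open>The time splits into the entry into \<open>V k\<close>, a return from
    \<open>V k\<close> to \<open>V i\<close>, and one last step, each contributing at most
    1.\<close>
  define L where "L j = \<bar>(G ^^ j) x4 - (G ^^ j) x1\<bar>" for j
  have "(\<Sum>j<pre_time m. L j) \<le> 1"
    unfolding L_def
  proof (rule sum_lengths_until_entry[OF u1(1) _ u1(2), of _ "V k"])
    show "x1 < x4" using x1w w(2) ax4 by simp
    fix y assume y: "x1 < y" "y < x4"
    show "\<Psi> m y \<in> V k" unfolding m_def by (rule Psi_V) (use x14m[of y] y in \<open>simp add: m_def\<close>)
    show "(G ^^ j) y \<notin> V k" if "j < pre_time m" for j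
      using return_not_before[of y k j] x14Z[of y] y that by (simp add: m_def)
  qed
  moreover have "(\<Sum>j<fib_time k. L (j + pre_time m)) \<le> 1"
  proof -
    define z1 where "z1 = min (\<Psi> m x1) (\<Psi> m x4)"
    define z4 where "z4 = max (\<Psi> m x1) (\<Psi> m x4)"
    have xx: "x1 < x4" using x1w w(2) ax4 by simp
    have "\<Psi> m x1 \<noteq> \<Psi> m x4"
      using Psi_less[OF good x14Z x14Z xx] xx by auto
    then have zz: "z1 < z4" by (auto simp: z1_def z4_def)
    have "\<Psi> m x1 \<in> C k" "\<Psi> m x4 \<in> C k"
      using Psi_C[of x1 k] Psi_C[of x4 k] x14Z[of x1] x14Z[of x4] xx by (auto simp: m_def)
    then have zC: "z1 \<in> C k" "z4 \<in> C k" by (auto simp: z1_def z4_def min_def max_def)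
    have Li: "L (j + pre_time m) = \<bar>(G ^^ j) z4 - (G ^^ j) z1\<bar>" for j
      unfolding L_def funpow_add by (auto simp: z1_def z4_def min_def max_def abs_minus_commute)
    have zV: "z \<in> V k" if "z1 < z" "z < z4" for z using that zC by (auto simp: C_eq V_eq)
    show ?thesis unfolding Li
    proof (rule sum_lengths_until_entry[OF _ zz, of _ "V i"])
      show "0 \<le> z1" "z4 \<le> 1" using zC C_unit by auto
      fix y assume y: "z1 < y" "y < z4"
      show "(G ^^ fib_time k) y \<in> V i"
        unfolding k_def by (rule fold_return(1)) (use zV[OF y] in \<open>simp add: k_def\<close>)
      show "(G ^^ j) y \<notin> V i" if "0 < j" "j < fib_time k" for j
        using fold_return(2)[of y i j] zV[OF y] V_sub_C that by (auto simp: k_def)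
    qed
  qed
  moreover have "L (pre_time (Suc m)) \<le> 1"
    using funpow_maps[of x1 "pre_time (Suc m)"] funpow_maps[of x4 "pre_time (Suc m)"] u1 x1w w(2) ax4
    unfolding L_def by auto
  moreover have "fib_time (Suc m) = Suc (pre_time m + fib_time k)" "pre_time (Suc m) = pre_time m + fib_time k"
    by (simp_all add: fib_time_eq m_def)
  ultimately have sumL: "(\<Sum>j<fib_time (Suc m). L j) \<le> 3"
    by (simp add: sum_lessThan_add del: fib_time.simps pre_time.simps)
  define a' where "a' = G (h a)"
  define w' where "w' = G (h w)"
  have ends: "G (h x1) = a" "G (h x4) = lv k" unfolding h14 using edge_props(6)[OF good t] by auto
  have ord: "lv k < a'" "a' < w'" "w' < a"
    using dec_h[of a x4] dec_h[of w a] dec_h[of x1 w] x1w w(2) ax4 ends by (auto simp: a'_def w'_def)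
  have o1: "ordered4 x1 w a x4" and o2: "ordered4 a w' a' (lv k)"
    using ord x1w w(2) ax4 by (auto simp: ordered4_def)
  define X where "X = ((w - x1) * (x4 - a)) / ((a - w) * (x4 - x1))"
  have cr1: "cross_ratio x1 w a x4 = ln (1 + X)"
    using cross_ratio_eq[OF o1] x1w w(2) ax4 by (simp add: X_def)
  have X0: "0 \<le> X" using x1w w(2) ax4 by (simp add: X_def)
  have "X = (w - x1) / (a - w) * ((x4 - a) / (x4 - x1))" by (simp add: X_def)
  also have "\<dots> \<le> (w - x1) / (a - w)"
    using x1w w(2) ax4 by (intro mult_left_le) auto
  also have "\<dots> \<le> (w - lv (Suc m)) / (a - w)"
  proof -
    \<comment> \<open>\<open>h x1 = c\<close> lies in \<open>C m\<close>, so \<open>x1\<close>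
      belongs to \<open>Z (Suc m)\<close> and is not below its lower end.\<close>
    have "x1 \<in> Z (Suc m)"
    proof -
      have "x1 \<in> Z m" "y0 \<le> x1" "h x1 \<in> C m" using x14Z[of x1] x14 h14 cC by auto
      then show ?thesis using y0(3)[of x1] unfolding m_def val_closed_Suc_Suc by (auto simp: h_def m_def)
    qed
    then have "lv (Suc m) \<le> x1" by (simp add: Z_eq)
    then show ?thesis using w by (intro divide_right_mono) auto
  qed
  finally have X1: "X \<le> (w - lv (Suc m)) / (a - w)" .
  \<comment> \<open>The gap from \<open>w'\<close> to \<open>a\<close> contains
    \<open>[w, a]\<close>, because \<open>w' < lv (Suc m) \<le> w\<close>. The gap from
    \<open>lv k\<close> to \<open>a'\<close> contains \<open>[lv k, lv m]\<close>, which by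
    \<open>small\<close> is at least as long as \<open>[a', w']\<close>. The remaining factor
    \<open>a - lv k\<close> is at most 1.\<close>
  have "a - w \<le> ((a - w') * (a' - lv k)) / ((w' - a') * (a - lv k))"
  proof -
    have "lv m \<le> a'" "w' < lv (Suc m)"
      using G_Psi_range[OF a_mem_Z[of "Suc (Suc m)"]] G_Psi_range[OF wZ[of "Suc (Suc m)"]]
      by (auto simp: a'_def w'_def h_def)
    moreover have "w' - a' \<le> lv m - lv k"
      using small G_Psi_range[OF a_mem_Z[of "Suc (Suc k)"]]
        G_Psi_range[OF wZ[of "Suc (Suc k)"]]
      by (simp add: a'_def w'_def h_def m_def k_def del: pre_time.simps)
    ultimately have d: "a - w \<le> a - w'" "w' - a' \<le> a' - lv k" using w(1)[of "Suc m"] by auto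
    have "(a - w) * ((w' - a') * (a - lv k)) \<le> (a - w) * ((w' - a') * 1)"
      using ord w(2) a_bounds lv_bounds[of k] by (intro mult_left_mono) auto
    also have "\<dots> \<le> (a - w') * (a' - lv k)"
      using d ord w(2) by (simp add: mult_mono)
    finally show ?thesis using ord by (simp add: pos_le_divide_eq)
  qed
  then have "ln (1 + (a - w)) \<le> cross_ratio a w' a' (lv k)"
    using ord w(2) by (subst cross_ratio_eq[OF o2]) (simp add: abs_minus_commute)
  also have "\<dots> \<le> exp (Lip * (\<Sum>j<fib_time (Suc m). L j)) * cross_ratio x1 w a x4"
    using cross_ratio_funpow_le[OF u1(1) x1w w(2) ax4 u1(2) inj] ends
    unfolding fib_Suc L_def a'_def w'_def by simp
  also have "\<dots> \<le> exp (3 * Lip) * ln (1 + X)"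
    unfolding cr1 using sumL Lip X0 mult_left_mono[OF sumL Lip] by (intro mult_right_mono) auto
  also have "\<dots> \<le> exp (3 * Lip) * X"
    using X0 by (intro mult_left_mono ln_add_one_self_le_self) auto
  also have "\<dots> \<le> exp (3 * Lip) * ((w - lv (Suc m)) / (a - w))"
    using X1 by (intro mult_left_mono) auto
  finally show ?thesis using w(2) by (simp add: m_def k_def field_simps)
qed

lemma lv_tendsto: "lv \<longlonglongrightarrow> a"
proof -
  have step: "lv k < lv (Suc k)" for k using linked[of k] by (simp add: linked_def)
  have inc: "incseq lv" by (rule incseq_SucI) (use step in \<open>auto intro: less_imp_le\<close>)
  obtain w where lim: "lv \<longlonglongrightarrow> w" and le: "\<And>k. lv k \<le> w"
    using incseq_convergent[OF inc, of a] lv_bounds(2) less_imp_le by metis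
  have wa: "w \<le> a" by (rule LIMSEQ_le_const2[OF lim]) (use lv_bounds(2) in \<open>auto intro: less_imp_le\<close>)
  have "w = a"
  proof (rule ccontr)
    assume "w \<noteq> a"
    with wa have lt: "w < a" by simp
    have wZ: "w \<in> Z j" for j using le[of j] lt lv_bounds(3)[of j] by (simp add: Z_eq)
    define d where "d i = G (\<Psi> (Suc i) w) - G (\<Psi> (Suc i) a)" for i
    have d0: "0 < d i" for i using G_Psi_less[OF wZ a_mem_Z lt] by (simp add: d_def)
    have d1: "d i \<le> lv (Suc i) - lv i" for i
      using G_Psi_range[OF wZ[of "Suc (Suc i)"]] G_Psi_range[OF a_mem_Z[of "Suc (Suc i)"]]
      by (simp add: d_def)
    have lim0: "(\<lambda>i. lv (Suc i) - lv i) \<longlonglongrightarrow> 0"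
      using tendsto_diff[OF LIMSEQ_Suc[OF lim] lim] by simp
    have dlim: "d \<longlonglongrightarrow> 0"
      by (rule tendsto_sandwich[OF _ _ tendsto_const lim0]) (use d0 d1 in \<open>auto intro!: always_eventually less_imp_le\<close>)
    \<comment> \<open>The lower bound that \<open>gap_lower_bound\<close> gives for the gap between
      \<open>lv\<close> and \<open>w\<close>. Once the gap is smaller, \<open>d\<close> can only
      increase, which is impossible for a positive sequence tending to 0.\<close>
    define \<kappa> where "\<kappa> = (a - w) * ln (1 + (a - w)) / exp (3 * Lip)"
    have k0: "\<kappa> > 0" using lt by (simp add: \<kappa>_def)
    have "eventually (\<lambda>k. w - lv k < \<kappa>) sequentially"
      using order_tendstoD(1)[OF lim, of "w - \<kappa>"] k0 by (auto elim: eventually_mono)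
    then obtain N where N: "\<And>k. k \<ge> N \<Longrightarrow> w - lv k < \<kappa>" by (auto simp: eventually_sequentially)
    have "\<not> d (Suc (Suc i)) \<le> d (Suc i)" if "i \<ge> N" for i
    proof
      assume "d (Suc (Suc i)) \<le> d (Suc i)"
      from gap_lower_bound[OF le lt, of i] this
      have "\<kappa> \<le> w - lv (Suc (Suc (Suc i)))"
        by (simp add: d_def \<kappa>_def pos_divide_le_eq mult.commute del: pre_time.simps)
      then show False using N[of "Suc (Suc (Suc i))"] that by simp
    qed
    then have "d (Suc i + N) < d (Suc (Suc i) + N)" for i by (simp add: not_le)
    then have "incseq (\<lambda>i. d (Suc i + N))"
      by (intro incseq_SucI) (auto intro: less_imp_le)
    then have "d (Suc 0 + N) \<le> d (Suc i + N)" for i using incseqD[of _ 0 i] by fastforce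
    moreover have "(\<lambda>i. d (i + Suc N)) \<longlonglongrightarrow> 0" using LIMSEQ_ignore_initial_segment[OF dlim] .
    ultimately have "d (Suc 0 + N) \<le> 0" by (intro LIMSEQ_le_const) auto
    then show False using d0[of "Suc 0 + N"] by simp
  qed
  then show ?thesis using lim by simp
qed

text \<open>Points of \<open>C j\<close> have values close to the maximum \<open>a\<close>, and on
  \<open>{0..p}\<close> the fold takes such values only near \<open>c\<close>.\<close>

lemma nest_shrinks:
  assumes "e > 0" shows "\<exists>k. \<forall>j\<ge>k. \<forall>x\<in>C j. \<bar>x - c\<bar> < e"
proof -
  define e' where "e' = min e (min c (p - c))"
  have e': "0 < e'" "e' \<le> e" "e' \<le> c" "e' \<le> p - c" using assms order by (auto simp: e'_def)
  define b where "b = max (G (c - e')) (G (c + e'))"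
  have "b < a" using G_inc[of "c - e'" c] G_dec[of c "c + e'"] e' order by (auto simp: b_def)
  then have "eventually (\<lambda>k. b < lv k) sequentially" using order_tendstoD(1)[OF lv_tendsto] by auto
  then obtain k where k: "\<And>j. j \<ge> k \<Longrightarrow> b < lv j" by (auto simp: eventually_sequentially)
  have "\<bar>x - c\<bar> < e" if j: "j \<ge> k" and x: "x \<in> C j" for j x
  proof -
    have "b < G x" "x \<in> {0..p}" using k[OF j] good_C_Z[OF x] good_C_sub[OF good x] by (auto simp: Z_eq)
    then have "c - e' < x" "x < c + e'"
      using G_inc[of x "c - e'"] G_dec[of "c + e'" x] e' order
      by (cases x "c - e'" rule: linorder_cases; force simp: b_def)
         (cases x "c + e'" rule: linorder_cases; use \<open>b < G x\<close> \<open>x \<in> {0..p}\<close> G_dec[of "c + e'" x] e' order in \<open>auto simp: b_def\<close>)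
    then show ?thesis using e' by auto
  qed
  then show ?thesis by blast
qed

end

section \<open>From the folded map to the odd map\<close>

lemma connected_component_set_eq_interval:
  fixes S :: "real set"
  assumes sub: "{l<..<r} \<subseteq> S" and ends: "l \<notin> S" "r \<notin> S" and x: "x \<in> {l<..<r}"
  shows "connected_component_set S x = {l<..<r}"
proof
  show "{l<..<r} \<subseteq> connected_component_set S x"
    using sub x by (intro connected_component_maximal) auto
  show "connected_component_set S x \<subseteq> {l<..<r}"
  proof
    fix y assume y: "y \<in> connected_component_set S x"
    have con: "connected (connected_component_set S x)" by simp
    have xx: "x \<in> connected_component_set S x" using sub x by auto
    have sub': "connected_component_set S x \<subseteq> S" by (rule connected_component_subset)
    show "y \<in> {l<..<r}"
    proof (rule ccontr)
      assume "y \<notin> {l<..<r}"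
      then consider "y \<le> l" | "r \<le> y" by force
      then show False
      proof cases
        case 1
        then have "l \<in> {y..x}" using x by simp
        then show False using connected_contains_Icc[OF con y xx] ends sub' by blast
      next
        case 2
        then have "r \<in> {x..y}" using x by simp
        then show False using connected_contains_Icc[OF con xx y] ends sub' by blast
      qed
    qed
  qed
qed

text \<open>The sign between \<open>F ^^ fib_time k\<close> and \<open>G ^^ fib_time k\<close> on
  \<open>V k\<close>. The initial values come from \<open>F < 0\<close> on \<open>V 0\<close> and
  from one reversal by oddness in the second iterate on \<open>V 1\<close>.\<close>

fun orbit_sign :: "nat \<Rightarrow> real" where
  "orbit_sign 0 = -1"
| "orbit_sign (Suc 0) = -1"
| "orbit_sign (Suc (Suc k)) = orbit_sign (Suc k) * orbit_sign k"

text \<open>Two signs -1 in succession are followed by 1 and then by -1, -1 again.\<close>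

lemma orbit_sign_period: "orbit_sign (3 * k) = -1 \<and> orbit_sign (Suc (3 * k)) = -1"
proof (induction k)
  case (Suc k)
  have "3 * Suc k = Suc (Suc (Suc (3 * k)))" by simp
  then show ?case using Suc by (simp only: orbit_sign.simps) simp
qed simp

locale odd_fib_map = fib_map_distortion +
  assumes odd: "\<And>x. -1 \<le> x \<Longrightarrow> x \<le> 1 \<Longrightarrow> F (- x) = - F x"
begin

lemma abs_F: "\<bar>F x\<bar> = G \<bar>x\<bar>" if "\<bar>x\<bar> \<le> 1" for x
  using odd[of x] that by (cases "x \<ge> 0") (auto simp: quot_def)

lemma abs_funpow:
  assumes "\<bar>x\<bar> \<le> 1" shows "\<bar>(F ^^ n) x\<bar> = (G ^^ n) \<bar>x\<bar>" "\<bar>(F ^^ n) x\<bar> \<le> 1"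
proof -
  have "\<bar>(F ^^ n) x\<bar> = (G ^^ n) \<bar>x\<bar> \<and> \<bar>(F ^^ n) x\<bar> \<le> 1"
  proof (induction n)
    case (Suc n)
    then show ?case using abs_F[of "(F ^^ n) x"] G_bounds[of "\<bar>(F ^^ n) x\<bar>"]
      by (metis abs_ge_zero comp_apply funpow.simps(2))
  qed (use assms in simp)
  then show "\<bar>(F ^^ n) x\<bar> = (G ^^ n) \<bar>x\<bar>" "\<bar>(F ^^ n) x\<bar> \<le> 1" by auto
qed

lemma funpow_odd: "\<bar>x\<bar> \<le> 1 \<Longrightarrow> (F ^^ n) (- x) = - (F ^^ n) x"
proof (induction n)
  case (Suc n)
  have "\<bar>(F ^^ n) x\<bar> \<le> 1" using abs_funpow Suc.prems by blast
  then have "-1 \<le> (F ^^ n) x" "(F ^^ n) x \<le> 1" by linarith+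
  then show ?case using Suc odd by simp
qed simp

definition A :: "nat \<Rightarrow> real set" where
  "A k = {- nr k<..<- nl k} \<union> {nl k<..<nr k}"

lemma mem_A: "x \<in> A k \<longleftrightarrow> \<bar>x\<bar> \<in> V k"
  using nest_bounds(1)[of k] by (auto simp: A_def V_eq)

lemma A_unit: "x \<in> A k \<Longrightarrow> \<bar>x\<bar> \<le> 1"
  using C_unit V_sub_C mem_A by force

lemma funpow_mem_A: "\<bar>x\<bar> \<le> 1 \<Longrightarrow> (F ^^ n) x \<in> A k \<longleftrightarrow> (G ^^ n) \<bar>x\<bar> \<in> V k"
  unfolding mem_A using abs_funpow(1) by simp

lemma return_domain_iff: "x \<in> return_domain F (A k) \<longleftrightarrow> \<bar>x\<bar> \<in> V k \<and> (\<exists>n\<ge>1. (G ^^ n) \<bar>x\<bar> \<in> V k)"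
  using funpow_mem_A[of x _ k] A_unit[of x k] by (auto simp: return_domain_def mem_A)

lemma V_Suc_return: "\<bar>x\<bar> \<in> V (Suc k) \<Longrightarrow> x \<in> return_domain F (A k)"
  unfolding return_domain_iff using V_Suc_sub[of k] fold_return(1)[of "\<bar>x\<bar>" k]
  by (auto intro!: exI[of _ "fib_time (Suc k)"] simp: fib_time_eq simp del: pre_time.simps fib_time.simps)

text \<open>The return domain of \<open>F\<close> is symmetric and determined by that of the fold;
  its components at \<open>c\<close> and \<open>- c\<close> end where \<open>|x|\<close> is an end
  of \<open>V (Suc k)\<close>, since those points never return.\<close>

lemma return_nest_eq:
  "return_nest F (- c) c (- p) 0 p k = ({- nr k<..<- nl k}, {nl k<..<nr k})"
proof (induction k)
  case 0
  then show ?case using nest_0[OF a_bounds(2)] by simp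
next
  case (Suc k)
  have D: "return_nest F (- c) c (- p) 0 p (Suc k) =
      (connected_component_set (return_domain F (A k)) (- c), connected_component_set (return_domain F (A k)) c)"
    by (simp add: Suc A_def Let_def)
  have nb: "0 \<le> nl (Suc k)" "nl (Suc k) < c" "c < nr (Suc k)" using nest_bounds by auto
  have out: "x \<notin> return_domain F (A k)" if "\<bar>x\<bar> = nl (Suc k) \<or> \<bar>x\<bar> = nr (Suc k)" for x
    using ends_avoid[of _ k] that unfolding return_domain_iff by force
  have "connected_component_set (return_domain F (A k)) c = {nl (Suc k)<..<nr (Suc k)}"
  proof (rule connected_component_set_eq_interval)
    show "{nl (Suc k)<..<nr (Suc k)} \<subseteq> return_domain F (A k)"
      using V_Suc_return[of _ k] nb by (auto simp: V_eq)
  qed (use out nb in auto)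
  moreover have "connected_component_set (return_domain F (A k)) (- c) = {- nr (Suc k)<..<- nl (Suc k)}"
  proof (rule connected_component_set_eq_interval)
    show "{- nr (Suc k)<..<- nl (Suc k)} \<subseteq> return_domain F (A k)"
      using V_Suc_return[of _ k] nb by (auto simp: V_eq)
  qed (use out nb in auto)
  ultimately show ?case using D by simp
qed

lemma return_time_eq:
  assumes "\<bar>x\<bar> = c" shows "return_time F (A k) x = fib_time (Suc k)"
  unfolding return_time_def
proof (rule Least_equality)
  have x1: "\<bar>x\<bar> \<le> 1" using assms order by simp
  show "1 \<le> fib_time (Suc k) \<and> (F ^^ fib_time (Suc k)) x \<in> A k"
    unfolding funpow_mem_A[OF x1] assms using fold_return(1)[OF c_mem_V]
    by (simp only: fib_time_eq) simp
  fix n assume n: "1 \<le> n \<and> (F ^^ n) x \<in> A k"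
  then have "(G ^^ n) c \<in> V k" using assms funpow_mem_A[OF x1] by simp
  then show "fib_time (Suc k) \<le> n"
    using fold_return(2)[of c k n] subsetD[OF V_sub_C c_mem_V[of "Suc k"]] n by fastforce
qed

text \<open>At time \<open>fib_time (Suc k)\<close> the orbits under \<open>F\<close> and
  \<open>G\<close> differ by a sign, which oddness carries through the remaining
  \<open>fib_time k\<close> steps.\<close>

lemma F_funpow_fib_time:
  "x \<in> V k \<Longrightarrow> (F ^^ fib_time k) x = orbit_sign k * (G ^^ fib_time k) x"
proof (induction k arbitrary: x rule: orbit_sign.induct)
  case 1
  then have "x \<in> {0..p}" using good_C_sub[OF good] V_sub_C by blast
  then show ?case using G_neg by simp
next
  case 2
  then have "x \<in> {0..p}" "G x \<in> W 1" using good_C_sub[OF good] V_sub_C by (blast, auto simp: nest_open_def)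
  then have "F x = - G x" "G x \<in> {0..1}" "0 < F (G x)" using G_neg by auto
  then have "F (F x) = - G (G x)" using odd[of "G x"] by (auto simp: quot_def)
  then show ?case by (simp add: numeral_2_eq_2)
next
  case (3 k)
  define y where "y = (G ^^ fib_time (Suc k)) x"
  have x: "x \<in> V (Suc k)" using 3 V_Suc_sub by blast
  have y: "y \<in> V k" using fold_return(1)[OF x] by (simp add: y_def)
  then have y1: "\<bar>y\<bar> \<le> 1" using C_unit V_sub_C by force
  have e: "orbit_sign (Suc k) = 1 \<or> orbit_sign (Suc k) = -1"
    by (induction k rule: orbit_sign.induct) auto
  have "fib_time (Suc (Suc k)) = fib_time k + fib_time (Suc k)" by simp
  then have "(F ^^ fib_time (Suc (Suc k))) x = (F ^^ fib_time k) ((F ^^ fib_time (Suc k)) x)"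
    "(G ^^ fib_time (Suc (Suc k))) x = (G ^^ fib_time k) y"
    by (simp_all only: funpow_add y_def o_apply)
  moreover have "(F ^^ fib_time (Suc k)) x = orbit_sign (Suc k) * y"
    using 3(1)[OF x] by (simp add: y_def)
  moreover have "(F ^^ fib_time k) (orbit_sign (Suc k) * y) = orbit_sign (Suc k) * (F ^^ fib_time k) y"
    using e funpow_odd[OF y1] by auto
  ultimately show ?case using 3(2)[OF y] by simp
qed

lemma recurrent_c: "recurrent F c"
  unfolding recurrent_def frequently_sequentially
proof (intro allI impI)
  fix e :: real and N :: nat assume "e > 0"
  then obtain k where k: "\<And>j x. j \<ge> k \<Longrightarrow> x \<in> C j \<Longrightarrow> \<bar>x - c\<bar> < e" using nest_shrinks by metis
  \<comment> \<open>\<open>Suc j\<close> is congruent to 2 modulo 3, where the sign is 1 and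
    \<open>F\<close> returns to \<open>c\<close> rather than to \<open>- c\<close>.\<close>
  define j where "j = 3 * (k + N) + 1"
  define n where "n = fib_time (Suc j)"
  have s: "orbit_sign (Suc j) = 1" using orbit_sign_period[of "k + N"] by (simp add: j_def)
  have "(F ^^ n) c = (G ^^ n) c" using F_funpow_fib_time[OF c_mem_V, of "Suc j"] s by (simp add: n_def)
  moreover have "(G ^^ n) c \<in> V j" unfolding n_def by (rule fold_return(1)[OF c_mem_V])
  ultimately have "dist ((F ^^ n) c) c < e" using k[of j] V_sub_C by (auto simp: dist_real_def j_def)
  moreover have "n \<ge> N" using fib_time_gt[of "Suc j"] by (simp add: n_def j_def)
  ultimately show "\<exists>n\<ge>N. dist ((F ^^ n) c) c < e" by blast
qed

lemma fibonacci_combinatorics: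
  assumes "bimodal F (- c) c" "positive_map F"
  shows "fibonacci_combinatorics F (- c) c"
proof -
  have c1: "\<bar>c\<bar> \<le> 1" "c > 0" using order by auto
  have dist: "dist ((F ^^ n) (- c)) (- c) = dist ((F ^^ n) c) c" for n
    unfolding funpow_odd[OF c1(1)] by (simp add: dist_real_def abs_minus_commute)
  have "recurrent F (- c)" using recurrent_c unfolding recurrent_def dist .
  moreover have np: "\<not> periodic F c"
  proof
    assume "periodic F c"
    then obtain n where n: "n \<ge> 1" "(F ^^ n) c = c" by (auto simp: periodic_def)
    then have "(G ^^ n) c = c" using abs_funpow(1)[OF c1(1), of n] c1 by simp
    then show False using not_periodic[of n] n by simp
  qed
  moreover have "\<not> periodic F (- c)"
    using np unfolding periodic_def funpow_odd[OF c1(1)] by auto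
  moreover have "{x \<in> {- c<..<c}. F x = x} = {0}"
  proof -
    have "F x \<noteq> x" if "- c < x" "x < c" "x \<noteq> 0" for x
      using F_neg[of x] F_neg[of "- x"] odd[of "x"] that order by (cases "x > 0") auto
    then show ?thesis using F_vals c1 by auto
  qed
  moreover have "{x \<in> {-1..1}. F x = 0} = {- p, 0, p}"
  proof -
    have pos: "F x = 0 \<longleftrightarrow> x = 0 \<or> x = p" if "0 \<le> x" "x \<le> 1" for x
      using F_neg[of x] F_pos[of x] F_vals that by (cases x p rule: linorder_cases; cases "x = 0") auto
    have "F x = 0 \<longleftrightarrow> x = - p \<or> x = 0 \<or> x = p" if "-1 \<le> x" "x \<le> 1" for x
      using pos[of x] pos[of "- x"] odd[of x] that order by (cases "x \<ge> 0") auto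
    then show ?thesis using order by auto
  qed
  moreover have "let A = nest_union F (- c) c (- p) 0 p (k - 1) in
           - c \<in> return_domain F A \<and> c \<in> return_domain F A \<and>
           return_time F A (- c) = fib_time k \<and> return_time F A c = fib_time k" if k: "k \<ge> 1" for k
  proof -
    obtain j where j: "k = Suc j" using k by (cases k) auto
    have "nest_union F (- c) c (- p) 0 p (k - 1) = A j"
      by (simp add: nest_union_def return_nest_eq A_def j)
    then show ?thesis
      using return_time_eq[of c j] return_time_eq[of "- c" j] V_Suc_return[of c j] V_Suc_return[of "- c" j]
        c_mem_V[of "Suc j"] c1 by (simp add: Let_def j del: fib_time.simps)
  qed
  ultimately show ?thesis
    unfolding fibonacci_combinatorics_def using assms recurrent_c order c1(2)
    by (intro conjI; (simp; fail)?) (intro exI[of _ "- p"] exI[of _ 0] exI[of _ p], simp)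
qed

end

section \<open>Existence of the parameter\<close>

context half_bimodal
begin

lemma val_closed_mono: "Z (Suc k) \<subseteq> Z k"
  by (cases k) auto

lemma nest_closed_mono: "C (Suc k) \<subseteq> C k"
  using val_closed_mono by (auto simp: nest_closed_def)

lemma base_open_sub_closed: "base_open F \<subseteq> base_closed F"
  by (auto simp: base_open_def base_closed_def)

text \<open>Weakening the inequalities suffices, except for the clause \<open>y \<ge> c\<close>;
  there \<open>F y > 0\<close> gives \<open>y > p\<close>. No membership of \<open>a\<close> is
  assumed, so this holds at every parameter of a family.\<close>

lemma val_open_sub_closed: "W k \<subseteq> Z k"
proof (induction k rule: pre_time.induct)
  case 2
  have "y \<in> Z (Suc 0)" if y: "y \<in> W (Suc 0)" for y
  proof -
    have "c \<le> y" using val_open_1_less[OF y] order by simp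
    then show ?thesis using y by auto
  qed
  then show ?case by blast
next
  case (3 k)
  have "V (Suc k) \<subseteq> C (Suc k)"
    using 3 base_open_sub_closed by (auto simp: nest_open_def nest_closed_def)
  then show ?case using 3 unfolding val_open_Suc_Suc val_closed_Suc_Suc by (auto intro: less_imp_le)
qed auto

lemma nest_open_sub_closed: "V k \<subseteq> C k"
  using val_open_sub_closed base_open_sub_closed by (auto simp: nest_open_def nest_closed_def)

lemma c_mem_nest: "a \<in> W k \<Longrightarrow> c \<in> V k"
  using order by (auto simp: nest_open_def base_open_eq)

lemma good_le:
  assumes "a \<in> W n" "a < 1"
  shows "k \<le> n \<Longrightarrow> good k" "k < n \<Longrightarrow> linked k"
  using good_all(1)[of "n - 1" k] good_all(2)[of "n - 1" k] good_0[OF assms(2)] assms(1)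
  by (cases n; simp)+

text \<open>An end of \<open>C n\<close> is sent to \<open>lv n\<close>, and \<open>\<Psi> n\<close>
  sends that to the end of the preceding interval opposite to \<open>side n\<close>. For
  \<open>n = 0\<close> it is the fixed point 0, kept out of \<open>C (Suc 0)\<close> by the clause
  \<open>y \<ge> c\<close>.\<close>

lemma fold_image_leaves:
  assumes aW: "a \<in> W n" "a < 1" and x: "x \<in> C n" "x \<notin> V n"
  shows "\<Psi> n (G x) \<notin> C (Suc n)" "side n * (\<Psi> n (G x) - c) < 0"
proof -
  have g: "good n" using good_le(1)[OF aW] by simp
  then have Gx: "G x = lv n" using x by (auto simp: good_def)
  have "\<Psi> n (lv n) \<notin> C (Suc n) \<and> side n * (\<Psi> n (lv n) - c) < 0"
  proof (cases n)
    case 0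
    have "(0::real) \<notin> C (Suc 0)" using order by (auto simp: nest_closed_def)
    then show ?thesis using 0 good_0(2)[OF aW(2)] order by simp
  next
    case (Suc m)
    have l: "linked m" "good m" using good_le[OF aW] Suc by auto
    have e: "\<Psi> n (lv n) = edge m (- side n)" using l Suc by (auto simp: linked_def)
    have "C n \<subseteq> {nl m<..<nr m}" using l g unfolding Suc linked_def good_def by auto
    then have "C (Suc n) \<subseteq> {nl m<..<nr m}" using nest_closed_mono[of n] by blast
    then have "edge m (- side n) \<notin> C (Suc n)" by (auto simp: edge_def)
    moreover have "side n * (edge m (- side n) - c) < 0"
      using edge_props(3)[OF l(2) side_cases[of n]] by (simp add: algebra_simps)
    ultimately show ?thesis using e by simp
  qed
  then show "\<Psi> n (G x) \<notin> C (Suc n)" "side n * (\<Psi> n (G x) - c) < 0" using Gx by auto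
qed

end

section \<open>Semicontinuity of the nest in parameter and point\<close>

lemma openin_Collect_pos:
  fixes g :: "'a::topological_space \<Rightarrow> real"
  assumes "continuous_on S g" shows "openin (top_of_set S) {z \<in> S. 0 < g z}"
  using continuous_openin_preimage_gen[OF assms, of "{0<..}"] by (simp add: vimage_def Int_def)

lemma closedin_Collect_nonneg:
  fixes g :: "'a::topological_space \<Rightarrow> real"
  assumes "continuous_on S g" shows "closedin (top_of_set S) {z \<in> S. 0 \<le> g z}"
  using continuous_closedin_preimage[OF assms, of "{0..}"] by (simp add: vimage_def Int_def)

text \<open>\<open>a0 \<le> c\<close> puts the critical value below \<open>pm a0\<close> at the left
  end of the parameter interval, while at the parameter 1 it is the fixed point 1; the first sweep
  runs between these two situations.\<close>

locale bimodal_family =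
  fixes Fm :: "real \<Rightarrow> real \<Rightarrow> real" and pm :: "real \<Rightarrow> real" and c a0 :: real
  assumes bimodal: "\<And>a. a0 \<le> a \<Longrightarrow> a \<le> 1 \<Longrightarrow> half_bimodal (Fm a) c (pm a) a"
    and joint: "continuous_on ({a0..1} \<times> {0..1}) (\<lambda>z. Fm (fst z) (snd z))"
    and a0: "0 < a0" "a0 \<le> c" "c < 1"
begin

abbreviation "K \<equiv> {a0..1} \<times> {0..1::real}"

text \<open>The skew product over the parameter, which makes continuity joint in parameter and
  point.\<close>

definition iter :: "nat \<Rightarrow> real \<times> real \<Rightarrow> real \<times> real" where
  "iter n z = (fst z, (quot (Fm (fst z)) ^^ n) (snd z))"

lemma iter_maps: "z \<in> K \<Longrightarrow> iter n z \<in> K"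
  using half_bimodal.funpow_maps[OF bimodal, of "fst z" "snd z" n] by (auto simp: iter_def)

lemma cont_quot: "continuous_on K (\<lambda>z. quot (Fm (fst z)) (snd z))"
  unfolding quot_def using joint by (intro continuous_intros)

lemma cont_iter: "continuous_on K (iter n)"
proof (induction n)
  case 0
  then show ?case by (simp add: iter_def)
next
  case (Suc n)
  have "continuous_on K (\<lambda>z. quot (Fm (fst (iter n z))) (snd (iter n z)))"
    by (rule continuous_on_compose2[OF cont_quot Suc]) (use iter_maps in blast)
  then have "continuous_on K (\<lambda>z. (fst z, quot (Fm (fst (iter n z))) (snd (iter n z))))"
    by (intro continuous_intros)
  then show ?case by (simp add: iter_def[abs_def])
qed

definition regW where "regW k = {z \<in> K. snd z \<in> val_open c (Fm (fst z)) k}"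
definition regV where "regV k = {z \<in> K. snd z \<in> nest_open c (Fm (fst z)) k}"
definition regZ where "regZ k = {z \<in> K. snd z \<in> val_closed c (Fm (fst z)) k}"
definition regC where "regC k = {z \<in> K. snd z \<in> nest_closed c (Fm (fst z)) k}"

lemma cont_F_iter: "continuous_on K (\<lambda>z. Fm (fst z) ((quot (Fm (fst z)) ^^ n) (snd z)))"
  using continuous_on_compose2[OF joint cont_iter[of n]] iter_maps by (force simp: iter_def)

lemma base_reg:
  "openin (top_of_set K) {z \<in> K. snd z \<in> base_open (Fm (fst z))}"
  "closedin (top_of_set K) {z \<in> K. snd z \<in> base_closed (Fm (fst z))}"
proof -
  have e1: "{z \<in> K. snd z \<in> base_open (Fm (fst z))} =
      {z \<in> K. 0 < snd z} \<inter> {z \<in> K. 0 < 1 - snd z} \<inter> {z \<in> K. 0 < - Fm (fst z) (snd z)}"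
    by (auto simp: base_open_def)
  show "openin (top_of_set K) {z \<in> K. snd z \<in> base_open (Fm (fst z))}"
    unfolding e1 by (intro openin_Int openin_Collect_pos continuous_intros joint)
  have e2: "{z \<in> K. snd z \<in> base_closed (Fm (fst z))} = {z \<in> K. 0 \<le> - Fm (fst z) (snd z)}"
    by (auto simp: base_closed_def)
  show "closedin (top_of_set K) {z \<in> K. snd z \<in> base_closed (Fm (fst z))}"
    unfolding e2 by (intro closedin_Collect_nonneg continuous_intros joint)
qed

lemma reg_nest:
  "openin (top_of_set K) (regW k) \<Longrightarrow> openin (top_of_set K) (regV k)"
  "closedin (top_of_set K) (regZ k) \<Longrightarrow> closedin (top_of_set K) (regC k)"
proof -
  have maps: "iter n \<in> K \<rightarrow> K" for n using iter_maps by blast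
  have "regV k = {z \<in> K. snd z \<in> base_open (Fm (fst z))} \<inter> (K \<inter> iter 1 -` regW k)"
    using iter_maps[of _ 1] by (auto simp: regV_def regW_def nest_open_def iter_def)
  then show "openin (top_of_set K) (regW k) \<Longrightarrow> openin (top_of_set K) (regV k)"
    using base_reg(1) continuous_openin_preimage[OF cont_iter maps] by auto
  have "regC k = {z \<in> K. snd z \<in> base_closed (Fm (fst z))} \<inter> (K \<inter> iter 1 -` regZ k)"
    using iter_maps[of _ 1] by (auto simp: regC_def regZ_def nest_closed_def iter_def)
  then show "closedin (top_of_set K) (regZ k) \<Longrightarrow> closedin (top_of_set K) (regC k)"
    using base_reg(2) continuous_closedin_preimage_gen[OF cont_iter maps] by auto
qed

lemma regW_Suc_Suc: "regW (Suc (Suc k)) = regW (Suc k) \<inter>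
    {z \<in> K. 0 < side (Suc k) * (snd (iter (pre_time (Suc k)) z) - c)} \<inter>
    (K \<inter> iter (pre_time (Suc (Suc k))) -` regV (Suc k))"
  using iter_maps[of _ "pre_time (Suc (Suc k))"]
  by (auto simp: regW_def regV_def nest_open_def iter_def simp del: pre_time.simps)

lemma regZ_Suc_Suc: "regZ (Suc (Suc k)) = regZ (Suc k) \<inter>
    {z \<in> K. 0 \<le> side (Suc k) * (snd (iter (pre_time (Suc k)) z) - c)} \<inter>
    (K \<inter> iter (pre_time (Suc (Suc k))) -` regC (Suc k))"
  using iter_maps[of _ "pre_time (Suc (Suc k))"]
  by (auto simp: regZ_def regC_def nest_closed_def iter_def simp del: pre_time.simps)

lemma openin_regW: "openin (top_of_set K) (regW k)"
proof (induction k rule: pre_time.induct)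
  case 1
  have e: "regW 0 = {z \<in> K. 0 < snd z} \<inter> {z \<in> K. 0 < 1 - snd z}" by (auto simp: regW_def)
  show ?case unfolding e by (intro openin_Int openin_Collect_pos continuous_intros)
next
  case 2
  have e: "regW (Suc 0) = {z \<in> K. 0 < Fm (fst z) (snd z)} \<inter>
      {z \<in> K. 0 < - Fm (fst z) ((quot (Fm (fst z)) ^^ 1) (snd z))}" by (auto simp: regW_def)
  show ?case unfolding e
    by (intro openin_Int openin_Collect_pos continuous_intros joint cont_F_iter)
next
  case (3 k)
  have maps: "iter n \<in> K \<rightarrow> K" for n using iter_maps by blast
  show ?case unfolding regW_Suc_Suc
    by (intro openin_Int 3 openin_Collect_pos continuous_intros cont_iter
        continuous_openin_preimage[OF cont_iter maps reg_nest(1)[OF 3(1)]])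
qed

lemma closedin_regZ: "closedin (top_of_set K) (regZ k)"
proof (induction k rule: pre_time.induct)
  case 1
  have "regZ 0 = K" by (auto simp: regZ_def)
  then show ?case by auto
next
  case 2
  have e: "regZ (Suc 0) = {z \<in> K. 0 \<le> snd z - c} \<inter> {z \<in> K. 0 \<le> Fm (fst z) (snd z)} \<inter>
      {z \<in> K. 0 \<le> - Fm (fst z) ((quot (Fm (fst z)) ^^ 1) (snd z))}" by (auto simp: regZ_def)
  show ?case unfolding e
    by (intro closedin_Int closedin_Collect_nonneg continuous_intros joint cont_F_iter)
next
  case (3 k)
  have maps: "iter n \<in> K \<rightarrow> K" for n using iter_maps by blast
  show ?case unfolding regZ_Suc_Suc
    by (intro closedin_Int 3 closedin_Collect_nonneg continuous_intros cont_iter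
        continuous_closedin_preimage_gen[OF cont_iter maps reg_nest(2)[OF 3(1)]])
qed

section \<open>Close returns as functions of the parameter\<close>

abbreviation "Wp t \<equiv> val_open c (Fm t)"
abbreviation "Vp t \<equiv> nest_open c (Fm t)"
abbreviation "Cp t \<equiv> nest_closed c (Fm t)"

text \<open>The close return of \<open>c\<close> after \<open>fib_time m\<close> steps, counted from
  the critical value, which is the parameter \<open>t\<close> itself.\<close>

definition crit :: "nat \<Rightarrow> real \<Rightarrow> real" where
  "crit m t = (quot (Fm t) ^^ pre_time m) t"

lemma diag_mem: "t \<in> {a0..1} \<Longrightarrow> (t, t) \<in> K"
  using a0 by auto

lemma cont_crit_pair: "continuous_on {a0..1} (\<lambda>t. (t, crit m t))"
proof -
  have "continuous_on {a0..1} (\<lambda>t. iter (pre_time m) (t, t))"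
    by (rule continuous_on_compose2[OF cont_iter]) (use diag_mem in \<open>auto intro!: continuous_intros\<close>)
  then show ?thesis by (simp add: iter_def crit_def)
qed

lemma cont_crit: "continuous_on {a0..1} (crit m)"
  using continuous_on_snd[OF cont_crit_pair] by simp

lemma crit_pair_mem: "t \<in> {a0..1} \<Longrightarrow> (t, crit m t) \<in> K"
  using iter_maps[OF diag_mem, of t "pre_time m"] by (simp add: iter_def crit_def)

lemma openin_crit_nest_open: "openin (top_of_set {a0..1}) {t \<in> {a0..1}. crit m t \<in> Vp t k}"
proof -
  have m: "(\<lambda>t. (t, crit m t)) \<in> {a0..1} \<rightarrow> K" using crit_pair_mem by blast
  have "{t \<in> {a0..1}. crit m t \<in> Vp t k} = {a0..1} \<inter> (\<lambda>t. (t, crit m t)) -` regV k"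
    using crit_pair_mem[of _ m] by (auto simp: regV_def)
  then show ?thesis
    using continuous_openin_preimage[OF cont_crit_pair m reg_nest(1)[OF openin_regW]] by simp
qed

lemma closed_crit_nest_closed: "closed {t \<in> {a0..1}. crit m t \<in> Cp t k}"
proof -
  have m: "(\<lambda>t. (t, crit m t)) \<in> {a0..1} \<rightarrow> K" using crit_pair_mem by blast
  have "{t \<in> {a0..1}. crit m t \<in> Cp t k} = {a0..1} \<inter> (\<lambda>t. (t, crit m t)) -` regC k"
    using crit_pair_mem[of _ m] by (auto simp: regC_def)
  then have "closedin (top_of_set {a0..1}) {t \<in> {a0..1}. crit m t \<in> Cp t k}"
    using continuous_closedin_preimage_gen[OF cont_crit_pair m reg_nest(2)[OF closedin_regZ]] by simp
  then show ?thesis using closedin_closed_trans by blast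
qed

lemma closed_crit_not_nest_open:
  "closed {t \<in> {a0..1}. crit m t \<notin> Vp t k}"
proof -
  have "closedin (top_of_set {a0..1}) ({a0..1} - {t \<in> {a0..1}. crit m t \<in> Vp t k})"
    using openin_crit_nest_open by (auto intro: closedin_diff)
  then show ?thesis using closedin_closed_trans[of "{a0..1}"]
    by (simp add: set_diff_eq Collect_conj_eq[symmetric] conj_commute cong: conj_cong)
qed

lemma closed_crit_le:
  assumes "continuous_on {a0..1} g" shows "closed {t \<in> {a0..1}. (0::real) \<le> g t}"
  using closedin_closed_trans[OF closedin_Collect_nonneg[OF assms]] by simp

text \<open>
  The last condition says that \<open>crit (Suc n)\<close>, which is outside the nest interval at both ends of
  \<open>[lo, hi]\<close>, leaves it through opposite ends.
\<close>

definition stage :: "nat \<Rightarrow> real \<Rightarrow> real \<Rightarrow> bool" where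
  "stage n lo hi \<longleftrightarrow> a0 \<le> lo \<and> lo < hi \<and> hi < 1 \<and>
     (\<forall>t\<in>{lo..hi}. t \<in> Wp t n \<and> side n * (crit n t - c) > 0) \<and>
     (\<forall>t\<in>{lo<..<hi}. t \<in> Wp t (Suc n) \<and> crit (Suc n) t \<in> Vp t n) \<and>
     crit (Suc n) lo \<notin> Vp lo n \<and> crit (Suc n) hi \<notin> Vp hi n \<and>
     (crit (Suc n) lo - c) * (crit (Suc n) hi - c) \<le> 0"

lemma closed_Icc_limit:
  fixes S :: "real set"
  assumes "closed S" "{lo<..<hi} \<subseteq> S" "lo < hi" shows "lo \<in> S" "hi \<in> S"
  using closure_minimal[OF assms(2,1)] assms(3) by (auto simp: closure_greaterThanLessThan)

text \<open>On \<open>L\<close> the critical value is at most \<open>pm t\<close>, on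
  \<open>R\<close> its image is at least \<open>pm t\<close>. Over a gap between them the image of
  the critical value runs from 0 to the zero of the map, thus across \<open>Vp t 0\<close>.\<close>

lemma stage_0: "\<exists>lo hi. stage 0 lo hi"
proof -
  define L where "L = {t \<in> {a0..1}. 0 \<le> - Fm t t}"
  \<comment> \<open>The clause with \<open>c\<close> removes the trivial zero of \<open>Fm t\<close>
    at the image 0, which makes \<open>L\<close> and \<open>R\<close> disjoint.\<close>
  define R where "R = {t \<in> {a0..1}. 0 \<le> Fm t t - c} \<inter> {t \<in> {a0..1}. 0 \<le> Fm t (quot (Fm t) t)}"
  have cF: "continuous_on {a0..1} (\<lambda>t. Fm t t)"
    using continuous_on_compose2[OF joint, of "{a0..1}" "\<lambda>t. (t, t)"] diag_mem
    by (force intro!: continuous_intros)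
  have cFF: "continuous_on {a0..1} (\<lambda>t. Fm t (quot (Fm t) t))"
    using continuous_on_compose2[OF cont_F_iter[of 1], of "{a0..1}" "\<lambda>t. (t, t)"] diag_mem
    by (force intro!: continuous_intros)
  have cl: "closed L" "closed R" unfolding L_def R_def
    by (intro closed_crit_le closed_Int continuous_intros cF cFF)+
  have a0L: "a0 \<in> L" using half_bimodal.F_le_0[OF bimodal[of a0], of a0] half_bimodal.order[OF bimodal[of a0]] a0
    by (simp add: L_def)
  have F1: "Fm 1 1 = 1" using half_bimodal.F_vals[OF bimodal[of 1]] a0 by simp
  have R1: "1 \<in> R" using F1 a0 by (simp add: R_def quot_def)
  have disj: "L \<inter> R = {}" using a0 by (auto simp: L_def R_def)
  obtain lo hi where ab: "a0 \<le> lo" "lo < hi" "hi \<le> 1" "lo \<in> L" "hi \<in> R" "{lo<..<hi} \<inter> (L \<union> R) = {}"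
    by (rule gap_between_closed_sets[OF cl a0L R1 _ disj]) (use a0 in auto)
  have inW: "t \<in> Wp t (Suc 0)" if t: "t \<in> {lo<..<hi}" for t
  proof -
    have t1: "t \<in> {a0..1}" using t ab by auto
    interpret half_bimodal "Fm t" c "pm t" t using bimodal t1 by auto
    have pos: "0 < Fm t t" and "Fm t t < c \<or> Fm t (quot (Fm t) t) < 0"
      using t t1 ab(6) by (auto simp: L_def R_def)
    then have "Fm t (quot (Fm t) t) < 0"
      using F_neg[of "Fm t t"] order by (auto simp: quot_def)
    then show ?thesis using pos t1 a0 by auto
  qed
  have in0: "crit (Suc 0) t \<in> Vp t 0" if t: "t \<in> {lo<..<hi}" for t
  proof -
    have t1: "t \<in> {a0..1}" "t < 1" using t ab by auto
    interpret half_bimodal "Fm t" c "pm t" t using bimodal t1 by auto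
    have W: "0 < Fm t t" "Fm t (quot (Fm t) t) < 0" using inW[OF t] by auto
    define y where "y = quot (Fm t) t"
    have y: "0 < y" "y \<le> 1" "Fm t y < 0" using W G_bounds[of t] t1 a0 by (auto simp: y_def quot_def)
    then have "y < pm t" using F_ge_0[of y] by (cases "y < pm t") auto
    then show ?thesis using y F_neg[of y] G_le_a[of y] t1 order
      by (auto simp: crit_def y_def[symmetric] nest_open_def base_open_eq) (auto simp: quot_def)
  qed
  have sub: "{lo<..<hi} \<subseteq> {t \<in> {a0..1}. 0 \<le> Fm t t}" "{lo<..<hi} \<subseteq> {t \<in> {a0..1}. 0 \<le> - Fm t (quot (Fm t) t)}"
    using inW ab by (force simp: less_imp_le)+
  have lim: "Fm lo lo = 0" "Fm hi (quot (Fm hi) hi) = 0" "Fm hi hi \<ge> c"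
    using closed_Icc_limit(1)[OF _ sub(1) ab(2)] closed_Icc_limit(2)[OF _ sub(2) ab(2)] cF cFF ab(4,5)
      closed_crit_le[OF cF] closed_crit_le[OF continuous_on_minus[OF cFF]]
    by (auto simp: L_def R_def)
  have b1: "hi < 1" using lim F1 ab by (cases "hi = 1") (auto simp: quot_def)
  have ca: "c < lo"
  proof -
    interpret half_bimodal "Fm lo" c "pm lo" lo using bimodal ab by auto
    show ?thesis using F_neg[of lo] lim(1) ab a0 order by (cases "lo < pm lo") auto
  qed
  have "crit (Suc 0) lo = 0" "crit (Suc 0) hi = quot (Fm hi) hi" by (auto simp: crit_def quot_def lim)
  moreover have "c \<le> quot (Fm hi) hi" using lim a0 by (simp add: quot_def)
  moreover have "quot (Fm hi) hi \<notin> base_open (Fm hi)" using lim by (simp add: base_open_def)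
  ultimately have "stage 0 lo hi"
    unfolding stage_def using ab b1 ca inW in0 a0
    by (auto simp: crit_def[of 0] nest_open_def base_open_def mult_nonpos_nonneg)
  then show ?thesis by blast
qed

lemma crit_Suc_Suc: "crit (Suc (Suc n)) t = (quot (Fm t) ^^ pre_time n) (quot (Fm t) (crit (Suc n) t))"
  unfolding crit_def by (rule funpow_pre_time_Suc_Suc)

lemma eventually_closed_compl:
  fixes S :: "real set"
  assumes "closed S" "x \<notin> S" shows "eventually (\<lambda>y. y \<notin> S) (nhds x)"
  using assms eventually_nhds_in_open[of "- S" x] by (auto simp: open_Compl)

text \<open>As \<open>t\<close> runs over \<open>[lo, hi]\<close>, the return
  \<open>crit (Suc n)\<close> crosses \<open>c\<close>. At a crossing the next return is
  \<open>\<Psi> n\<close> of the critical value, which lies beyond the next nest interval on the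
  side \<open>side n\<close>. At the end of \<open>[lo, hi]\<close> where
  \<open>crit (Suc n)\<close> is on the side \<open>side (Suc n)\<close>, it has reached an end of
  its interval, and the next return lies beyond on the opposite side. In between, the next return
  sweeps across.\<close>

lemma stage_Suc:
  assumes st: "stage n lo hi"
  shows "\<exists>lo' hi'. stage (Suc n) lo' hi' \<and> lo < lo' \<and> hi' < hi"
proof -
  have ab: "a0 \<le> lo" "lo < hi" "hi < 1"
    and in0: "\<And>t. t \<in> {lo..hi} \<Longrightarrow> t \<in> Wp t n \<and> side n * (crit n t - c) > 0"
    and in1: "\<And>t. t \<in> {lo<..<hi} \<Longrightarrow> t \<in> Wp t (Suc n) \<and> crit (Suc n) t \<in> Vp t n"
    and out: "\<And>t. t = lo \<or> t = hi \<Longrightarrow> crit (Suc n) t \<notin> Vp t n"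
    and sgn: "(crit (Suc n) lo - c) * (crit (Suc n) hi - c) \<le> 0"
    using st unfolding stage_def by auto
  define m where "m = Suc n"
  define s where "s = side m"
  define sn where "sn = side n"
  have s: "s = 1 \<or> s = -1" and sn: "sn = 1 \<or> sn = -1" using side_cases by (auto simp: s_def sn_def)
  define g where "g t = s * (crit m t - c)" for t
  define h where "h t = sn * (crit (Suc m) t - c)" for t
  define N where "N = {t \<in> {a0..1}. crit (Suc m) t \<notin> Vp t m}"
  \<comment> \<open>The cut to the open interval makes \<open>L\<close> and \<open>R\<close>
    disjoint: there \<open>t\<close> belongs to \<open>Wp t m\<close>, so \<open>c\<close> is in
    \<open>Vp t m\<close> and \<open>h\<close> has no zero on \<open>N\<close>.\<close>
  define R where "R = {t \<in> {a0..1}. 0 \<le> h t} \<inter> N \<inter> {lo<..<hi}"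
  define L where "L = {t \<in> {a0..1}. 0 \<le> - h t} \<inter> N \<inter> {lo<..<hi}"
  have sub: "{lo..hi} \<subseteq> {a0..1}" using ab by auto
  have hb: "half_bimodal (Fm t) c (pm t) t" if "t \<in> {lo..hi}" for t using bimodal that ab by auto
  have cg: "continuous_on {a0..1} g" "continuous_on {a0..1} h"
    unfolding g_def h_def by (intro continuous_intros cont_crit)+
  have clN: "closed N" unfolding N_def by (rule closed_crit_not_nest_open)
  have clps: "closed {t \<in> {a0..1}. 0 \<le> h t}" "closed {t \<in> {a0..1}. 0 \<le> - h t}"
    by (intro closed_crit_le continuous_intros cg)+
  have cin: "c \<in> Vp t k" if "t \<in> {lo..hi}" "t \<in> Wp t k" for t k
    using half_bimodal.c_mem_nest[OF hb] that by blast
  have ne: "crit m t \<noteq> c" if "t = lo \<or> t = hi" for t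
    using out[OF that] cin[of t n] in0[of t] that ab by (auto simp: m_def)
  have sign: "g lo * g hi < 0"
  proof -
    have "g lo * g hi = (crit m lo - c) * (crit m hi - c)" using s by (auto simp: g_def algebra_simps)
    moreover have "(crit m lo - c) * (crit m hi - c) \<noteq> 0" using ne by simp
    ultimately show ?thesis using sgn unfolding m_def by linarith
  qed
  have h_ne: "h t \<noteq> 0" if "t \<in> {lo<..<hi}" "t \<in> N" for t
    using that cin[of t m] in1[of t] sn by (auto simp: N_def h_def m_def)
  have clC: "closed {t \<in> {a0..1}. crit k t \<in> Cp t j}" for k j
    by (rule closed_crit_nest_closed)
  have notC: "t \<in> N" if "t \<in> {a0..1}" "crit (Suc m) t \<notin> Cp t m" for t
    using half_bimodal.nest_open_sub_closed[OF bimodal, of t m] that by (auto simp: N_def)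
  have zero: "eventually (\<lambda>x. x \<in> R) (nhds t)" if t: "t \<in> {lo<..<hi}" "g t = 0" for t
  proof -
    have tt: "t \<in> {lo..hi}" "t < 1" using t ab by auto
    interpret half_bimodal "Fm t" c "pm t" t by (rule hb[OF tt(1)])
    have cm: "crit m t = c" using t(2) s by (auto simp: g_def)
    have e: "crit (Suc m) t = (quot (Fm t) ^^ pre_time n) t" unfolding m_def crit_Suc_Suc using cm by (simp add: m_def)
    have tW: "t \<in> Wp t m" using in1[OF t(1)] by (simp add: m_def)
    have lk: "linked n" using good_le(2)[OF tW tt(2)] by (simp add: m_def)
    have tZ: "t \<in> val_closed c (Fm t) m" using val_open_sub_closed tW by blast
    have lt: "sn * x < sn * crit (Suc m) t" if "x \<in> Cp t m" for x
      using lk tZ that unfolding linked_def e[unfolded m_def] sn_def m_def by blast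
    have "c \<in> Cp t m" using c_mem_nest[OF tW] nest_open_sub_closed by blast
    then have p: "0 < h t" using lt[of c] by (simp add: h_def algebra_simps)
    have "crit (Suc m) t \<notin> Cp t m" using lt by blast
    then have "eventually (\<lambda>x. x \<notin> {t \<in> {a0..1}. crit (Suc m) t \<in> Cp t m}) (nhds t)"
      by (intro eventually_closed_compl[OF clC]) auto
    moreover have "eventually (\<lambda>x. x \<notin> {t \<in> {a0..1}. 0 \<le> - h t}) (nhds t)"
      using p by (intro eventually_closed_compl[OF clps(2)]) auto
    moreover have "eventually (\<lambda>x. x \<in> {lo<..<hi}) (nhds t)"
      using t by (intro eventually_nhds_in_open) auto
    ultimately show ?thesis
    proof eventually_elim
      case (elim x)
      then have "x \<in> {a0..1}" using sub by auto
      then show ?case using elim notC[of x] by (auto simp: R_def)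
    qed
  qed
  have near: "eventually (\<lambda>x. x \<in> {lo<..<hi} \<longrightarrow> x \<in> L) (nhds t)"
    if t: "t = lo \<or> t = hi" and pos: "g t > 0" for t
  proof -
    have tt: "t \<in> {lo..hi}" "t < 1" using t ab by auto
    interpret half_bimodal "Fm t" c "pm t" t by (rule hb[OF tt(1)])
    have tW: "t \<in> Wp t n" using in0[OF tt(1)] by simp
    have "{lo<..<hi} \<subseteq> {t \<in> {a0..1}. crit m t \<in> Cp t n}"
    proof
      fix x assume x: "x \<in> {lo<..<hi}"
      then have "half_bimodal (Fm x) c (pm x) x" by (intro hb) auto
      then show "x \<in> {t \<in> {a0..1}. crit m t \<in> Cp t n}"
        using in1[OF x] x sub half_bimodal.nest_open_sub_closed[of "Fm x" c "pm x" x n] by (auto simp: m_def)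
    qed
    from closed_Icc_limit[OF clC this ab(2)] t have xC: "crit m t \<in> Cp t n" by auto
    have xV: "crit m t \<notin> Vp t n" using out[OF t] by (simp add: m_def)
    have e: "crit (Suc m) t = (quot (Fm t) ^^ pre_time n) (quot (Fm t) (crit m t))"
      unfolding m_def by (rule crit_Suc_Suc)
    have nC: "crit (Suc m) t \<notin> Cp t m" and neg: "h t < 0"
      using fold_image_leaves[OF tW tt(2) xC xV] unfolding e[symmetric] h_def sn_def by (simp_all add: m_def)
    have "eventually (\<lambda>x. x \<notin> {t \<in> {a0..1}. crit (Suc m) t \<in> Cp t m}) (nhds t)"
      using nC by (intro eventually_closed_compl[OF clC]) auto
    moreover have "eventually (\<lambda>x. x \<notin> {t \<in> {a0..1}. 0 \<le> h t}) (nhds t)"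
      using neg by (intro eventually_closed_compl[OF clps(1)]) auto
    ultimately show ?thesis
    proof eventually_elim
      case (elim x)
      show ?case
      proof
        assume x: "x \<in> {lo<..<hi}"
        then have "x \<in> {a0..1}" using sub by auto
        then show "x \<in> L" using elim notC[of x] x by (auto simp: L_def)
      qed
    qed
  qed
  have disj: "L \<inter> R = {}" using h_ne by (force simp: L_def R_def)
  have clL: "closed (L \<inter> {u..v})" and clR: "closed (R \<inter> {u..v})" if "lo < u" "v < hi" for u v
  proof -
    have "L \<inter> {u..v} = {t \<in> {a0..1}. 0 \<le> - h t} \<inter> N \<inter> {u..v}"
      "R \<inter> {u..v} = {t \<in> {a0..1}. 0 \<le> h t} \<inter> N \<inter> {u..v}"
      using that by (auto simp: L_def R_def)
    then show "closed (L \<inter> {u..v})" "closed (R \<inter> {u..v})"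
      using clN clps by (auto intro: closed_Int)
  qed
  obtain lo' hi' where *: "lo < lo'" "lo' < hi'" "hi' < hi" "\<And>t. t \<in> {lo'..hi'} \<Longrightarrow> g t > 0"
    "{lo'<..<hi'} \<inter> (L \<union> R) = {}" "lo' \<in> R \<and> hi' \<in> L \<or> lo' \<in> L \<and> hi' \<in> R"
    by (rule sweep[OF ab(2) continuous_on_subset[OF cg(1) sub] sign clL clR disj zero near]) (auto intro: that)
  have prod: "(crit (Suc m) lo' - c) * (crit (Suc m) hi' - c) \<le> 0"
  proof -
    have "h lo' * h hi' \<le> 0" using *(6) by (auto simp: L_def R_def mult_le_0_iff)
    then show ?thesis using sn by (auto simp: h_def algebra_simps)
  qed
  have inV: "crit (Suc m) t \<in> Vp t m" if t: "t \<in> {lo'<..<hi'}" for t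
  proof -
    have "t \<notin> L" "t \<notin> R" "t \<in> {lo<..<hi}" "t \<in> {a0..1}" using *(5) t * ab by auto
    then have "t \<notin> N" by (cases "0 \<le> h t") (auto simp: L_def R_def)
    then show ?thesis using \<open>t \<in> {a0..1}\<close> by (simp add: N_def)
  qed
  have "stage m lo' hi'"
    unfolding stage_def
  proof (intro conjI ballI)
    fix t assume t: "t \<in> {lo'..hi'}"
    then show "t \<in> Wp t m" using in1[of t] * by (auto simp: m_def)
    show "0 < side m * (crit m t - c)" using *(4)[OF t] by (simp add: g_def s_def)
  next
    fix t assume t: "t \<in> {lo'<..<hi'}"
    then have "t \<in> {lo..hi}" using * by auto
    interpret half_bimodal "Fm t" c "pm t" t by (rule hb) fact
    show "crit (Suc m) t \<in> Vp t m" by (rule inV[OF t])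
    moreover have "0 < side m * (crit m t - c)" using *(4)[of t] t by (simp add: g_def s_def)
    moreover have "t \<in> Wp t m" using in1[of t] * t by (auto simp: m_def)
    ultimately show "t \<in> Wp t (Suc m)"
      unfolding m_def val_open_Suc_Suc by (simp add: crit_def m_def)
  qed (use * ab prod in \<open>auto simp: L_def R_def N_def\<close>)
  then show ?thesis using * by (auto simp: m_def)
qed

text \<open>The parameter intervals are compact and nested, and \<open>stage n\<close> controls
  \<open>Wp t n\<close> up to their ends, so a common point serves all levels.\<close>

theorem fibonacci_parameter: "\<exists>t. a0 \<le> t \<and> t < 1 \<and> (\<forall>k. t \<in> val_open c (Fm t) k)"
proof -
  define P where "P n x \<longleftrightarrow> stage n (fst x) (snd x)" for n :: nat and x :: "real \<times> real"
  define Q where "Q n x y \<longleftrightarrow> fst x < fst y \<and> snd y < snd x" for n :: nat and x y :: "real \<times> real"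
  have "\<exists>f. \<forall>n. P n (f n) \<and> Q n (f n) (f (Suc n))"
  proof (rule dependent_nat_choice)
    show "\<exists>x. P 0 x" using stage_0 by (auto simp: P_def)
    show "\<exists>y. P (Suc n) y \<and> Q n x y" if "P n x" for x n
      using stage_Suc[of n "fst x" "snd x"] that by (auto simp: P_def Q_def)
  qed
  then obtain f where f: "\<And>n. stage n (fst (f n)) (snd (f n))"
    "\<And>n. fst (f n) < fst (f (Suc n))" "\<And>n. snd (f (Suc n)) < snd (f n)"
    unfolding P_def Q_def by blast
  define lo where "lo n = fst (f n)" for n
  define hi where "hi n = snd (f n)" for n
  have inc: "incseq lo" by (rule incseq_SucI) (use f(2) in \<open>auto simp: lo_def intro: less_imp_le\<close>)
  have dec: "decseq hi" by (rule decseq_SucI) (use f(3) in \<open>auto simp: hi_def intro: less_imp_le\<close>)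
  have ab: "lo n < hi n" "a0 \<le> lo n" "hi n < 1" for n
    using f(1)[of n] by (auto simp: stage_def lo_def hi_def)
  have cross: "lo n \<le> hi k" for n k
    using incseqD[OF inc, of n "max n k"] decseqD[OF dec, of k "max n k"] ab(1)[of "max n k"] by auto
  obtain t where t: "lo \<longlonglongrightarrow> t" "\<And>n. lo n \<le> t"
    using incseq_convergent[OF inc, of "hi 0"] cross by metis
  have tb: "t \<le> hi k" for k by (rule LIMSEQ_le_const2[OF t(1)]) (use cross in auto)
  have "t \<in> val_open c (Fm t) k" for k
    using f(1)[of k] t(2)[of k] tb[of k] by (auto simp: stage_def lo_def hi_def)
  moreover have "a0 \<le> t" "t < 1" using t(2)[of 0] tb[of 0] ab[of 0] by auto
  ultimately show ?thesis by blast
qed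

end

section \<open>The symmetric family\<close>

lemma rho_eq: "rho l t = t * \<bar>t\<bar> powr (l - 2)"
  by (simp add: rho_def)

lemma rho_minus: "rho l (- t) = - rho l t"
  by (simp add: rho_def)

lemma abs_rho: "\<bar>rho l t\<bar> = \<bar>t\<bar> powr (l - 1)"
proof (cases "t = 0")
  case False
  then have "\<bar>t\<bar> * \<bar>t\<bar> powr (l - 2) = \<bar>t\<bar> powr (1 + (l - 2))" by (simp only: powr_add) simp
  then show ?thesis by (simp add: rho_eq abs_mult)
qed (simp add: rho_def)

lemma rho_pos: "0 < t \<Longrightarrow> 0 < rho l t" and rho_neg: "t < 0 \<Longrightarrow> rho l t < 0"
  by (auto simp: rho_def mult_neg_pos)

lemma continuous_on_rho:
  assumes "l > 2" shows "continuous_on S (rho l)"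
  unfolding rho_eq[abs_def] using assms by (intro continuous_intros continuous_on_powr') auto

lemma continuous_on_q: "l > 2 \<Longrightarrow> continuous_on S (q l)"
  unfolding q_def
  by (intro continuous_intros continuous_on_compose2[OF continuous_on_rho[of l UNIV]]) auto

lemma q_even: "q l (- x) = q l x"
proof -
  have "- x - crit_d = - (x - crit_c)" "- x - crit_c = - (x - crit_d)"
    by (auto simp: crit_d_def crit_c_def)
  then show ?thesis by (simp only: q_def rho_minus) simp
qed

lemma abs_q: "\<bar>q l x\<bar> = (\<bar>x - crit_d\<bar> * \<bar>x - crit_c\<bar>) powr (l - 1)"
  by (simp add: q_def abs_mult abs_rho powr_mult)

lemma q_pos: "x < crit_d \<or> crit_c < x \<Longrightarrow> 0 < q l x"
  and q_neg: "crit_d < x \<Longrightarrow> x < crit_c \<Longrightarrow> q l x < 0"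
  and q_zero: "x = crit_d \<or> x = crit_c \<Longrightarrow> q l x = 0"
proof -
  have dc: "crit_d < crit_c" by (simp add: crit_d_def crit_c_def)
  show "x < crit_d \<or> crit_c < x \<Longrightarrow> 0 < q l x"
    unfolding q_def
  proof (elim disjE)
    show "x < crit_d \<Longrightarrow> 0 < rho l (x - crit_d) * rho l (x - crit_c)"
      using dc by (intro mult_neg_neg rho_neg) auto
    show "crit_c < x \<Longrightarrow> 0 < rho l (x - crit_d) * rho l (x - crit_c)"
      using dc by (intro mult_pos_pos rho_pos) auto
  qed
  show "crit_d < x \<Longrightarrow> x < crit_c \<Longrightarrow> q l x < 0"
    unfolding q_def by (intro mult_pos_neg rho_pos rho_neg) auto
  show "x = crit_d \<or> x = crit_c \<Longrightarrow> q l x = 0" by (auto simp: q_def rho_def)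
qed

text \<open>
  Log-concavity of \<open>\<bar>q\<bar>\<close> between the critical points. It makes the mean of
  \<open>\<bar>q\<bar>\<close> over an interval at least the geometric mean of its end values, which replaces
  the negative Schwarzian derivative.
\<close>

lemma abs_q_symmetric_pair:
  assumes l: "l > 1" and s: "0 \<le> s" "s \<le> h" and c: "h \<le> \<bar>m - crit_c\<bar>" "h \<le> \<bar>m - crit_d\<bar>"
  shows "\<bar>q l (m - h)\<bar> * \<bar>q l (m + h)\<bar> \<le> \<bar>q l (m - s)\<bar> * \<bar>q l (m + s)\<bar>"
proof -
  have e: "\<bar>m - s - e\<bar> * \<bar>m + s - e\<bar> = (m - e)\<^sup>2 - s\<^sup>2" if "0 \<le> s" "s \<le> \<bar>m - e\<bar>" for s e
  proof -
    have "s\<^sup>2 \<le> (m - e)\<^sup>2" using that by (simp add: abs_le_square_iff[symmetric])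
    moreover have "(m - s - e) * (m + s - e) = (m - e)\<^sup>2 - s\<^sup>2" by (simp add: power2_eq_square algebra_simps)
    ultimately show ?thesis by (simp add: abs_mult[symmetric])
  qed
  have le: "\<bar>m - h - e\<bar> * \<bar>m + h - e\<bar> \<le> \<bar>m - s - e\<bar> * \<bar>m + s - e\<bar>" if "h \<le> \<bar>m - e\<bar>" for e
    using e[of s e] e[of h e] s that power_mono[OF s(2,1), of 2] by simp
  have prod: "\<bar>q l (m - s)\<bar> * \<bar>q l (m + s)\<bar> =
      ((\<bar>m - s - crit_d\<bar> * \<bar>m + s - crit_d\<bar>) * (\<bar>m - s - crit_c\<bar> * \<bar>m + s - crit_c\<bar>)) powr (l - 1)" for s
    unfolding abs_q by (simp add: powr_mult[symmetric] mult_ac)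
  show ?thesis unfolding prod
    using l by (intro powr_mono2 mult_mono le c) auto
qed

locale odd_family =
  fixes l :: real and \<eta> :: "lap \<Rightarrow> real \<Rightarrow> real" and \<epsilon> :: "real \<times> real \<Rightarrow> real"
  assumes l: "l > 3" and bumps: "admissible_bumps l \<eta>" and eps: "admissible_eps l \<epsilon>"
begin

text \<open>The symmetric slice \<open>u = a\<close>, \<open>v = - a\<close>, contained in
  \<open>Delta_star\<close> for \<open>0 < a \<le> 1\<close>.\<close>

definition eps0 :: "real \<Rightarrow> real" where "eps0 a = \<epsilon> (a, - a)"
definition coef :: "real \<Rightarrow> lap \<Rightarrow> real" where "coef a i = delta i a (- a) - eps0 a * B l i"
definition w :: "real \<Rightarrow> real \<Rightarrow> real" where "w a = weight l \<eta> \<epsilon> a (- a)"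
abbreviation f :: "real \<Rightarrow> real \<Rightarrow> real" where "f a \<equiv> family l \<eta> \<epsilon> a (- a)"

lemma eps0_pos: "0 < a \<Longrightarrow> a \<le> 1 \<Longrightarrow> 0 < eps0 a"
  and coef_pos: "0 < a \<Longrightarrow> a \<le> 1 \<Longrightarrow> 0 < coef a i"
  using eps unfolding admissible_eps_def Delta_star_def eps0_def coef_def by auto

lemma \<eta>_nonneg: "0 \<le> \<eta> i x" and \<eta>_integral: "lap_integral l i (\<eta> i) = 1"
  and \<eta>_sym: "\<eta> Rgt x = \<eta> Lft (- x)" "\<eta> Mid x = \<eta> Mid (- x)"
  using bumps unfolding admissible_bumps_def by blast+

lemma \<eta>_zero: "x \<notin> lap_interior i \<Longrightarrow> \<eta> i x = 0"
  using bumps closure_subset[of "{x. \<eta> i x \<noteq> 0}"] unfolding admissible_bumps_def by blast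

lemma \<eta>_deriv: "(\<eta> i has_real_derivative deriv (\<eta> i) x) (at x)"
  and \<eta>_deriv_cont: "continuous_on S (deriv (\<eta> i))"
proof -
  have s: "Ck_on 1 (\<eta> i) UNIV" using bumps unfolding admissible_bumps_def smooth_def by blast
  then have "(\<eta> i) differentiable (at x)"
    unfolding Ck_on_def differentiable_on_def by auto
  then show "(\<eta> i has_real_derivative deriv (\<eta> i) x) (at x)"
    by (metis real_differentiableE DERIV_imp_deriv)
  show "continuous_on S (deriv (\<eta> i))"
    using s unfolding Ck_on_def by (auto intro: continuous_on_subset)
qed

lemma \<eta>_cont: "continuous_on S (\<eta> i)"
  using \<eta>_deriv DERIV_isCont continuous_at_imp_continuous_on by blast

lemma w_eq: "w a x = eps0 a + (coef a Lft * \<eta> Lft x + coef a Mid * \<eta> Mid x + coef a Rgt * \<eta> Rgt x)"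
  unfolding w_def weight_def eps0_def coef_def by simp

lemma w_ge: assumes "0 < a" "a \<le> 1" shows "eps0 a \<le> w a x"
  using coef_pos[OF assms] \<eta>_nonneg by (simp add: w_eq less_imp_le)

lemma w_pos: "0 < a \<Longrightarrow> a \<le> 1 \<Longrightarrow> 0 < w a x"
  using w_ge eps0_pos by (meson less_le_trans)

lemma w_cont: "continuous_on S (w a)"
  unfolding w_eq[abs_def] by (intro continuous_intros \<eta>_cont)

lemma q_cont: "continuous_on S (q l)"
  using continuous_on_q l by simp

text \<open>The weight has bounded derivative and is at least \<open>eps0 a\<close>; the quotient of
  the two bounds is a Lipschitz constant of its logarithm.\<close>

lemma w_log_lipschitz:
  assumes a: "0 < a" "a \<le> 1"
  obtains Lip where "0 \<le> Lip"
    "\<And>x y. x \<in> {-1..1} \<Longrightarrow> y \<in> {-1..1} \<Longrightarrow> w a x * exp (- Lip * \<bar>x - y\<bar>) \<le> w a y"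
proof -
  define w' where "w' x = coef a Lft * deriv (\<eta> Lft) x + coef a Mid * deriv (\<eta> Mid) x + coef a Rgt * deriv (\<eta> Rgt) x" for x
  have der: "(w a has_real_derivative w' x) (at x within {-1..1})" for x
  proof -
    have "(w a has_real_derivative w' x) (at x)"
      unfolding w_eq[abs_def] w'_def by (auto intro!: derivative_eq_intros \<eta>_deriv)
    then show ?thesis by (rule has_field_derivative_at_within)
  qed
  have "continuous_on {-1..1} w'" unfolding w'_def by (intro continuous_intros \<eta>_deriv_cont)
  then have "bounded (w' ` {-1..1})" by (intro compact_imp_bounded compact_continuous_image) auto
  then obtain M where M: "M > 0" "\<And>x. x \<in> {-1..1} \<Longrightarrow> norm (w' x) \<le> M"
    unfolding bounded_pos by auto
  define Lip where "Lip = M / eps0 a"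
  have e: "0 < eps0 a" using eps0_pos a by simp
  show thesis
  proof
    show "0 \<le> Lip" using M e by (simp add: Lip_def)
    fix x y :: real assume xy: "x \<in> {-1..1}" "y \<in> {-1..1}"
    have "norm (w a x - w a y) \<le> M * norm (x - y)"
      by (rule field_differentiable_bound[of "{-1..1}" "w a" w']) (use der M xy in auto)
    then have "w a x \<le> w a y + M * \<bar>x - y\<bar>" by (simp add: abs_if split: if_splits)
    also have "M * \<bar>x - y\<bar> = eps0 a * (Lip * \<bar>x - y\<bar>)" using e by (simp add: Lip_def)
    also have "w a y + eps0 a * (Lip * \<bar>x - y\<bar>) \<le> w a y * (1 + Lip * \<bar>x - y\<bar>)"
      using mult_right_mono[OF w_ge[OF a, of y], of "Lip * \<bar>x - y\<bar>"] \<open>0 \<le> Lip\<close> by (simp add: distrib_left)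
    also have "\<dots> \<le> w a y * exp (Lip * \<bar>x - y\<bar>)"
      using w_pos[OF a, of y] by (intro mult_left_mono exp_ge_add_one_self) auto
    finally show "w a x * exp (- Lip * \<bar>x - y\<bar>) \<le> w a y"
      by (simp add: exp_minus field_simps)
  qed
qed

lemma f_deriv:
  assumes "x \<in> {-1..1}"
  shows "(f a has_real_derivative w a x * q l x) (at x within {-1..1})"
proof -
  have "((\<lambda>x. integral {-1..x} (\<lambda>t. w a t * q l t)) has_real_derivative w a x * q l x) (at x within {-1..1})"
    by (rule integral_has_real_derivative[OF _ assms]) (intro continuous_intros w_cont q_cont)
  then show ?thesis
    unfolding family_def w_def by (auto intro!: derivative_eq_intros)
qed

lemma f_deriv_at:
  assumes "-1 < x" "x < 1"
  shows "(f a has_real_derivative w a x * q l x) (at x)"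
  using f_deriv[of x a] assms at_within_Icc_at[of "-1" x 1] by simp

lemma f_cont: "continuous_on {-1..1} (f a)"
  by (rule DERIV_continuous_on) (rule f_deriv)

lemma lap_integral_w:
  assumes "\<And>j. j \<noteq> i \<Longrightarrow> {lo..hi} \<inter> lap_interior j = {}"
  shows "integral {lo..hi} (\<lambda>x. w a x * q l x) =
    eps0 a * integral {lo..hi} (\<lambda>x. 1 * q l x) + coef a i * integral {lo..hi} (\<lambda>x. \<eta> i x * q l x)"
proof -
  have "integral {lo..hi} (\<lambda>x. w a x * q l x) =
      integral {lo..hi} (\<lambda>x. eps0 a * (1 * q l x) + coef a i * (\<eta> i x * q l x))"
  proof (rule integral_cong)
    fix x assume x: "x \<in> {lo..hi}"
    have "\<eta> j x = 0" if "j \<noteq> i" for j using assms[OF that] x by (intro \<eta>_zero) blast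
    from this[of Lft] this[of Mid] this[of Rgt]
    show "w a x * q l x = eps0 a * (1 * q l x) + coef a i * (\<eta> i x * q l x)"
      by (cases i) (auto simp: w_eq algebra_simps)
  qed
  also have "\<dots> = eps0 a * integral {lo..hi} (\<lambda>x. 1 * q l x) + coef a i * integral {lo..hi} (\<lambda>x. \<eta> i x * q l x)"
    by (subst integral_add)
      (auto intro!: integrable_continuous_real continuous_intros q_cont \<eta>_cont)
  finally show ?thesis .
qed

text \<open>The coefficient of each bump is \<open>delta i\<close> minus the contribution of the
  constant part, so by the normalization the increment over the lap is exactly
  \<open>delta i\<close>, with a minus sign on the middle lap.\<close>

lemma f_vals: "f a (- 1) = - 1" "f a crit_d = a" "f a crit_c = - a" "f a 1 = 1"
proof -
  have cd: "-1 < crit_d" "crit_d < crit_c" "crit_c < 1" by (auto simp: crit_d_def crit_c_def)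
  have int: "(\<lambda>t. w a t * q l t) integrable_on {x..y}" for x y
    by (intro integrable_continuous_real continuous_intros w_cont q_cont)
  have disj: "i \<noteq> Lft \<Longrightarrow> {-1..crit_d} \<inter> lap_interior i = {}"
    "i \<noteq> Mid \<Longrightarrow> {crit_d..crit_c} \<inter> lap_interior i = {}"
    "i \<noteq> Rgt \<Longrightarrow> {crit_c..1} \<inter> lap_interior i = {}" for i
    using cd by (cases i; force)+
  have L: "integral {-1..crit_d} (\<lambda>t. w a t * q l t) = a + 1"
    using lap_integral_w[where i = Lft and a = a, OF disj(1)] \<eta>_integral[of Lft] by (simp add: coef_def B_def)
  have M: "integral {crit_d..crit_c} (\<lambda>t. w a t * q l t) = - 2 * a"
    using lap_integral_w[where i = Mid and a = a, OF disj(2)] \<eta>_integral[of Mid] by (simp add: coef_def B_def algebra_simps)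
  have R: "integral {crit_c..1} (\<lambda>t. w a t * q l t) = 1 + a"
    using lap_integral_w[where i = Rgt and a = a, OF disj(3)] \<eta>_integral[of Rgt] by (simp add: coef_def B_def)
  have LM: "integral {-1..crit_c} (\<lambda>t. w a t * q l t) = a + 1 - 2 * a"
    using Henstock_Kurzweil_Integration.integral_combine[OF _ _ int, of "-1" crit_d crit_c] cd L M by simp
  have LMR: "integral {-1..1} (\<lambda>t. w a t * q l t) = 2"
    using Henstock_Kurzweil_Integration.integral_combine[OF _ _ int, of "-1" crit_c 1] cd LM R by simp
  show "f a (- 1) = - 1" "f a crit_d = a" "f a crit_c = - a" "f a 1 = 1"
    using L LM LMR by (auto simp: family_def w_def[symmetric])
qed

lemma B_sym: "B l Rgt = B l Lft"
proof -
  have "integral {-1..-crit_c} (\<lambda>x. q l (- x)) = integral {crit_c..1} (q l)"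
    using Henstock_Kurzweil_Integration.integral_reflect_real[of 1 crit_c "q l"] by simp
  then show ?thesis by (simp add: B_def q_even crit_d_def crit_c_def)
qed

lemma w_even: "w a (- x) = w a x"
proof -
  have "coef a Rgt = coef a Lft" by (simp add: coef_def B_sym)
  then show ?thesis
    using \<eta>_sym(1)[of x] \<eta>_sym(1)[of "- x"] \<eta>_sym(2)[of x] by (simp add: w_eq)
qed

text \<open>The derivative is even, so \<open>f a x + f a (- x)\<close> is constant, and it vanishes
  at the ends.\<close>

lemma f_odd: assumes "-1 \<le> x" "x \<le> 1" shows "f a (- x) = - f a x"
proof -
  have "f a x + f a (- x) = f a (-1) + f a (- (-1))"
  proof (rule DERIV_isconst2[of "-1" 1 "\<lambda>x. f a x + f a (- x)"])
    show "continuous_on {-1..1} (\<lambda>x. f a x + f a (- x))"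
      by (intro continuous_intros f_cont continuous_on_compose2[OF f_cont]) auto
    fix x :: real assume x: "-1 < x" "x < 1"
    have "((\<lambda>x. f a (- x)) has_real_derivative (w a (- x) * q l (- x)) * (- 1)) (at x)"
      by (rule DERIV_chain2[where f = "f a"]) (use x in \<open>auto intro!: f_deriv_at derivative_eq_intros\<close>)
    from DERIV_add[OF f_deriv_at[OF x, of a] this]
    show "((\<lambda>x. f a x + f a (- x)) has_real_derivative 0) (at x)"
      by (simp add: w_even q_even)
  qed (use assms in auto)
  then show ?thesis using f_vals by simp
qed


lemma crit_order: "-1 < crit_d" "crit_d < crit_c" "crit_d < 0" "0 < crit_c" "crit_c < 1" "crit_d = - crit_c"
  by (auto simp: crit_d_def crit_c_def)

section \<open>Bimodality of the symmetric maps\<close>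

lemma f_mono:
  assumes a: "0 < a" "a \<le> 1"
  shows "strict_mono_on {-1..crit_d} (f a)" "strict_antimono_on {crit_d..crit_c} (f a)"
    "strict_mono_on {crit_c..1} (f a)"
proof -
  have cont: "continuous_on {x..y} (f a)" if "-1 \<le> x" "y \<le> 1" for x y
    using that by (intro continuous_on_subset[OF f_cont]) auto
  have inc: "strict_mono_on {u..v} (f a)"
    if uv: "-1 \<le> u" "v \<le> 1" and q: "\<And>z. u < z \<Longrightarrow> z < v \<Longrightarrow> 0 < q l z" for u v
  proof (rule monotone_onI)
    fix x y assume xy: "x \<in> {u..v}" "y \<in> {u..v}" "x < y"
    show "f a x < f a y"
    proof (rule DERIV_pos_imp_increasing_open[OF xy(3)])
      fix z assume z: "x < z" "z < y"
      show "\<exists>D. (f a has_real_derivative D) (at z) \<and> 0 < D"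
      proof (intro exI conjI)
        show "(f a has_real_derivative w a z * q l z) (at z)"
          by (rule f_deriv_at) (use z xy uv in auto)
        show "0 < w a z * q l z"
          by (rule mult_pos_pos[OF w_pos[OF a] q]) (use z xy in auto)
      qed
    qed (rule cont; use xy uv in auto)
  qed
  show "strict_mono_on {-1..crit_d} (f a)"
    by (rule inc) (use crit_order(2,5) q_pos in auto)
  show "strict_mono_on {crit_c..1} (f a)"
    by (rule inc) (use crit_order(4) q_pos in auto)
  show "strict_antimono_on {crit_d..crit_c} (f a)"
  proof (rule monotone_onI)
    fix x y assume xy: "x \<in> {crit_d..crit_c}" "y \<in> {crit_d..crit_c}" "x < y"
    show "f a x > f a y"
    proof (rule DERIV_neg_imp_decreasing_open[OF xy(3)])
      fix z assume z: "x < z" "z < y"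
      show "\<exists>D. (f a has_real_derivative D) (at z) \<and> D < 0"
      proof (intro exI conjI)
        show "(f a has_real_derivative w a z * q l z) (at z)"
          by (rule f_deriv_at) (use z xy crit_order(1,5) in auto)
        show "w a z * q l z < 0"
          by (rule mult_pos_neg[OF w_pos[OF a] q_neg]) (use z xy in auto)
      qed
    qed (rule cont; use xy crit_order(1,2,4,5) in auto)
  qed
qed

lemma f_abs_le:
  assumes a: "0 < a" "a \<le> 1" and x: "x \<in> {-1..1}" shows "-1 \<le> f a x \<and> f a x \<le> 1"
proof -
  have le: "f a x \<le> f a y" if "strict_mono_on S (f a)" "x \<in> S" "y \<in> S" "x \<le> y" for S x y
    using strict_mono_on_leD[OF that] .
  have ge: "f a x \<ge> f a y" if "strict_antimono_on S (f a)" "x \<in> S" "y \<in> S" "x \<le> y" for S x y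
    using monotone_onD[OF that(1-3)] that(4) by (cases "x = y") auto
  note m = f_mono[OF a]
  consider "x \<le> crit_d" | "crit_d \<le> x" "x \<le> crit_c" | "crit_c \<le> x" by linarith
  then show ?thesis
  proof cases
    case 1
    then show ?thesis using le[OF m(1), of "-1" x] le[OF m(1), of x crit_d] x crit_order f_vals[of a] a by auto
  next
    case 2
    then show ?thesis using ge[OF m(2), of crit_d x] ge[OF m(2), of x crit_c] crit_order f_vals[of a] a by auto
  next
    case 3
    then show ?thesis using le[OF m(3), of crit_c x] le[OF m(3), of x 1] x crit_order f_vals[of a] a by auto
  qed
qed

lemma f_bimodal:
  assumes a: "0 < a" "a \<le> 1"
  shows "bimodal (f a) crit_d crit_c" "positive_map (f a)" "symmetric_map (f a)"
proof -
  note m = f_mono[OF a]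
  show pos: "positive_map (f a)" using f_vals by (simp add: positive_map_def)
  show "symmetric_map (f a)" using f_odd by (simp add: symmetric_map_def)
  have "C1_self_map (f a)"
    unfolding C1_self_map_def
  proof (intro conjI exI[of _ "\<lambda>x. w a x * q l x"])
    show "f a ` {-1..1} \<subseteq> {-1..1}" using f_abs_le[OF a] by auto
    show "continuous_on {-1..1} (\<lambda>x. w a x * q l x)" by (intro continuous_intros w_cont q_cont)
  qed (use f_deriv in blast)
  moreover have "critical_points (f a) = {crit_d, crit_c}"
  proof -
    have "(f a has_real_derivative 0) (at x within {-1..1}) \<longleftrightarrow> x = crit_d \<or> x = crit_c"
      if x: "x \<in> {-1..1}" for x
    proof
      assume "(f a has_real_derivative 0) (at x within {-1..1})"
      then have "((\<lambda>y. (f a y - f a x) / (y - x)) \<longlongrightarrow> 0) (at x within {-1..1})"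
        by (simp add: has_field_derivative_iff)
      moreover have "((\<lambda>y. (f a y - f a x) / (y - x)) \<longlongrightarrow> w a x * q l x) (at x within {-1..1})"
        using f_deriv[OF x, of a] by (simp add: has_field_derivative_iff)
      moreover have "at x within {-1..1} \<noteq> bot"
        using x by (auto simp: trivial_limit_within islimpt_Icc)
      ultimately have "w a x * q l x = 0" using tendsto_unique by blast
      then have "q l x = 0" using w_pos[OF a, of x] by simp
      then show "x = crit_d \<or> x = crit_c"
        using q_pos[of x l] q_neg[of x l] by (cases x crit_d rule: linorder_cases; cases x crit_c rule: linorder_cases) auto
    next
      assume "x = crit_d \<or> x = crit_c"
      then show "(f a has_real_derivative 0) (at x within {-1..1})"
        using f_deriv[OF x, of a] q_zero[of x l] by simp
    qed
    then show ?thesis using crit_order unfolding critical_points_def by fastforce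
  qed
  moreover have "turning_point (f a) crit_d"
  proof -
    have "eventually (\<lambda>y. y \<in> {-1<..<crit_c}) (nhds crit_d)"
      using crit_order by (intro eventually_nhds_in_open) auto
    then have "eventually (\<lambda>y. f a y \<le> f a crit_d) (nhds crit_d)"
    proof eventually_elim
      case (elim y)
      then show ?case using monotone_onD[OF m(1), of y crit_d] monotone_onD[OF m(2), of crit_d y] crit_order
        by (cases y crit_d rule: linorder_cases) auto
    qed
    then show ?thesis using crit_order by (auto simp: turning_point_def)
  qed
  moreover have "turning_point (f a) crit_c"
  proof -
    have "eventually (\<lambda>y. y \<in> {crit_d<..<1}) (nhds crit_c)"
      using crit_order by (intro eventually_nhds_in_open) auto
    then have "eventually (\<lambda>y. f a crit_c \<le> f a y) (nhds crit_c)"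
    proof eventually_elim
      case (elim y)
      then show ?case using monotone_onD[OF m(2), of y crit_c] monotone_onD[OF m(3), of crit_c y] crit_order
        by (cases y crit_c rule: linorder_cases) auto
    qed
    then show ?thesis using crit_order by (auto simp: turning_point_def)
  qed
  ultimately show "bimodal (f a) crit_d crit_c"
    unfolding bimodal_def using m crit_order pos
    by (auto simp: strictly_monotone_on_def positive_map_def)
qed

text \<open>Around the midpoint \<open>m\<close>, the two ends of \<open>[m - s, m + s]\<close>
  contribute at least twice the geometric mean of \<open>|D (m - s)|\<close> and
  \<open>|D (m + s)|\<close> to the growth of the increment. By log-concavity and the Lipschitz
  bound \<open>g\<close> is below that mean for all \<open>s\<close>; integrating up to
  \<open>h\<close> and squaring gives the claim.\<close>

lemma f_distortion:
  assumes a: "0 < a" "a \<le> 1"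
  obtains Lip where "0 \<le> Lip"
    "\<And>x y. 0 < x \<Longrightarrow> x < y \<Longrightarrow> y < 1 \<Longrightarrow> y < crit_c \<or> crit_c < x \<Longrightarrow>
       (w a x * q l x) * (w a y * q l y) * (x - y)\<^sup>2 \<le> exp (Lip * (y - x)) * (f a x - f a y)\<^sup>2"
proof -
  obtain Lip where Lip: "0 \<le> Lip"
    "\<And>x y. x \<in> {-1..1} \<Longrightarrow> y \<in> {-1..1} \<Longrightarrow> w a x * exp (- Lip * \<bar>x - y\<bar>) \<le> w a y"
    using w_log_lipschitz[OF a] by blast
  have main: "(w a x * q l x) * (w a y * q l y) * (x - y)\<^sup>2 \<le> exp (Lip * (y - x)) * (f a x - f a y)\<^sup>2"
    if xy: "0 < x" "x < y" "y < 1" "y < crit_c \<or> crit_c < x" for x y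
  proof -
    define D where "D t = w a t * q l t" for t
    define m where "m = (x + y) / 2"
    define h where "h = (y - x) / 2"
    have mh: "m - h = x" "m + h = y" "0 < h" using xy by (auto simp: m_def h_def field_simps)
    define sn :: real where "sn = (if y < crit_c then -1 else 1)"
    have sn: "sn * D t = \<bar>D t\<bar>" "sn * sn = 1" if "x \<le> t" "t \<le> y" for t
      using that xy crit_order q_pos[of t l] q_neg[of t l] w_pos[OF a, of t]
      by (auto simp: sn_def D_def abs_mult abs_of_pos abs_of_neg)
    \<comment> \<open>On the way from an end point to \<open>m - s\<close> or \<open>m + s\<close>
      the weight loses at most the factor \<open>exp (- Lip * h)\<close>; the two losses together
      are \<open>exp (- Lip * (y - x))\<close>.\<close>
    define g where "g = sqrt (\<bar>D x\<bar> * \<bar>D y\<bar>) * exp (- Lip * h)"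
    have pair: "g\<^sup>2 \<le> \<bar>D (m - s)\<bar> * \<bar>D (m + s)\<bar>" if s: "0 \<le> s" "s \<le> h" for s
    proof -
      have mem: "m - s \<in> {-1..1}" "m + s \<in> {-1..1}" "x \<in> {-1..1}" "y \<in> {-1..1}"
        using s mh xy by auto
      have exp_le: "exp (- Lip * h) \<le> exp (- Lip * (h - s))"
        using Lip(1) s by (simp add: mult_left_mono)
      have w1: "w a x * exp (- Lip * h) \<le> w a (m - s)"
      proof -
        have "w a x * exp (- Lip * h) \<le> w a x * exp (- Lip * (h - s))"
          using exp_le w_pos[OF a, of x] by (intro mult_left_mono) auto
        also have "\<dots> \<le> w a (m - s)" using Lip(2)[OF mem(3,1)] mh s by auto
        finally show ?thesis .
      qed
      have w2: "w a y * exp (- Lip * h) \<le> w a (m + s)"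
      proof -
        have "w a y * exp (- Lip * h) \<le> w a y * exp (- Lip * (h - s))"
          using exp_le w_pos[OF a, of y] by (intro mult_left_mono) auto
        also have "\<dots> \<le> w a (m + s)" using Lip(2)[OF mem(4,2)] mh s by auto
        finally show ?thesis .
      qed
      have "\<bar>q l (m - h)\<bar> * \<bar>q l (m + h)\<bar> \<le> \<bar>q l (m - s)\<bar> * \<bar>q l (m + s)\<bar>"
        using l s xy crit_order by (intro abs_q_symmetric_pair) (auto simp: m_def h_def abs_if field_simps)
      then have qq: "\<bar>q l x\<bar> * \<bar>q l y\<bar> \<le> \<bar>q l (m - s)\<bar> * \<bar>q l (m + s)\<bar>" using mh by simp
      have "g\<^sup>2 = (w a x * exp (- Lip * h)) * (w a y * exp (- Lip * h)) * (\<bar>q l x\<bar> * \<bar>q l y\<bar>)"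
        using w_pos[OF a, of x] w_pos[OF a, of y]
        by (simp add: g_def D_def power_mult_distrib abs_mult power2_eq_square)
      also have "\<dots> \<le> w a (m - s) * w a (m + s) * (\<bar>q l (m - s)\<bar> * \<bar>q l (m + s)\<bar>)"
        using w_pos[OF a] by (intro mult_mono w1 w2 qq) (auto intro: less_imp_le mult_nonneg_nonneg)
      also have "\<dots> = \<bar>D (m - s)\<bar> * \<bar>D (m + s)\<bar>"
        using w_pos[OF a, of "m - s"] w_pos[OF a, of "m + s"] by (simp add: D_def abs_mult)
      finally show ?thesis .
    qed
    have g0: "0 \<le> g" by (simp add: g_def)
    define H where "H s = sn * (f a (m + s) - f a (m - s)) - 2 * s * g" for s
    have "H 0 \<le> H h"
    proof (rule DERIV_nonneg_imp_increasing_open[of 0 h H])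
      show "0 \<le> h" using mh by simp
      fix s assume s: "0 < s" "s < h"
      have in1: "-1 < m + s" "m + s < 1" "-1 < m - s" "m - s < 1" using s mh xy by auto
      have "(H has_real_derivative sn * (D (m + s) + D (m - s)) - 2 * g) (at s)"
        unfolding H_def D_def
        by (auto intro!: derivative_eq_intros DERIV_chain2[OF f_deriv_at] in1 simp: algebra_simps)
      moreover have "2 * g \<le> \<bar>D (m + s)\<bar> + \<bar>D (m - s)\<bar>"
      proof -
        have "g \<le> sqrt (\<bar>D (m - s)\<bar> * \<bar>D (m + s)\<bar>)" using pair[of s] s g0 by (simp add: real_le_rsqrt)
        also have "\<dots> \<le> (\<bar>D (m - s)\<bar> + \<bar>D (m + s)\<bar>) / 2" by (rule arith_geo_mean_sqrt) auto
        finally show ?thesis by simp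
      qed
      moreover have "sn * (D (m + s) + D (m - s)) = \<bar>D (m + s)\<bar> + \<bar>D (m - s)\<bar>"
        using sn(1)[of "m + s"] sn(1)[of "m - s"] s mh by (simp add: distrib_left)
      ultimately show "\<exists>z. (H has_real_derivative z) (at s) \<and> 0 \<le> z" by force
    next
      show "continuous_on {0..h} H"
        unfolding H_def
        by (intro continuous_intros continuous_on_compose2[OF f_cont]) (use mh xy in auto)
    qed
    moreover have "2 * h = y - x" by (simp add: h_def)
    ultimately have "(y - x) * g \<le> sn * (f a y - f a x)" by (simp add: H_def mh(1,2))
    then have "((y - x) * g)\<^sup>2 \<le> (sn * (f a y - f a x))\<^sup>2"
      using g0 xy by (intro power_mono) auto
    also have "\<dots> = (f a x - f a y)\<^sup>2"
      using sn(2)[of x] xy by (simp add: power_mult_distrib power2_eq_square[of sn] power2_commute)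
    finally have *: "((y - x) * g)\<^sup>2 \<le> (f a x - f a y)\<^sup>2" .
    have "D x * D y = \<bar>D x\<bar> * \<bar>D y\<bar>"
      using sn[of x] sn[of y] xy by (metis less_imp_le order_refl mult.assoc mult.left_commute mult_1)
    moreover have "g\<^sup>2 * exp (Lip * (y - x)) = \<bar>D x\<bar> * \<bar>D y\<bar>"
      by (simp add: g_def power_mult_distrib h_def power2_eq_square mult.assoc flip: exp_add)
        (simp add: field_simps flip: exp_add)
    ultimately have "D x * D y * (x - y)\<^sup>2 = exp (Lip * (y - x)) * ((y - x) * g)\<^sup>2"
      by (simp add: power_mult_distrib power2_commute mult_ac)
    also have "\<dots> \<le> exp (Lip * (y - x)) * (f a x - f a y)\<^sup>2" using * by (intro mult_left_mono) auto
    finally show ?thesis by (simp add: D_def)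
  qed
  show thesis by (rule that[OF Lip(1) main])
qed

definition zero_pt :: "real \<Rightarrow> real" where
  "zero_pt a = (SOME p. crit_c < p \<and> p < 1 \<and> f a p = 0)"

lemma half_bimodal_f:
  assumes a: "0 < a" "a \<le> 1"
  shows "half_bimodal (f a) crit_c (zero_pt a) a"
proof -
  have "\<exists>p\<ge>crit_c. p \<le> 1 \<and> f a p = 0"
    by (rule IVT') (use f_vals[of a] a crit_order in \<open>auto intro: continuous_on_subset[OF f_cont]\<close>)
  then obtain p where "crit_c \<le> p" "p \<le> 1" "f a p = 0" by blast
  then have "crit_c < p \<and> p < 1 \<and> f a p = 0" using f_vals[of a] a by (auto simp: less_le)
  then have p: "crit_c < zero_pt a \<and> zero_pt a < 1 \<and> f a (zero_pt a) = 0"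
    unfolding zero_pt_def by (rule someI)
  have f0: "f a 0 = 0" using f_odd[of 0 a] by simp
  show ?thesis
  proof
    show "continuous_on {0..1} (f a)" by (rule continuous_on_subset[OF f_cont]) auto
    show "strict_antimono_on {0..crit_c} (f a)"
      by (rule monotone_on_subset[OF f_mono(2)[OF a]]) (use crit_order in auto)
    show "strict_mono_on {crit_c..1} (f a)" by (rule f_mono(3)[OF a])
  qed (use p f0 f_vals a crit_order in auto)
qed

text \<open>Separation of variables: joint continuity reduces to coefficients depending on
  \<open>a\<close> and fixed primitives depending on \<open>x\<close>.\<close>

lemma f_linear:
  assumes "x \<in> {-1..1}"
  shows "f a x = -1 + (eps0 a * integral {-1..x} (q l) +
    (coef a Lft * integral {-1..x} (\<lambda>t. \<eta> Lft t * q l t) +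
     coef a Mid * integral {-1..x} (\<lambda>t. \<eta> Mid t * q l t) +
     coef a Rgt * integral {-1..x} (\<lambda>t. \<eta> Rgt t * q l t)))"
proof -
  have "((\<lambda>t. w a t * q l t) has_integral (eps0 a * integral {-1..x} (q l) +
    (coef a Lft * integral {-1..x} (\<lambda>t. \<eta> Lft t * q l t) +
     coef a Mid * integral {-1..x} (\<lambda>t. \<eta> Mid t * q l t) +
     coef a Rgt * integral {-1..x} (\<lambda>t. \<eta> Rgt t * q l t)))) {-1..x}"
  proof -
    have e: "(\<lambda>t. w a t * q l t) = (\<lambda>t. eps0 a * q l t + (coef a Lft * (\<eta> Lft t * q l t) +
        coef a Mid * (\<eta> Mid t * q l t) + coef a Rgt * (\<eta> Rgt t * q l t)))"
      by (simp add: w_eq fun_eq_iff algebra_simps)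
    show ?thesis unfolding e
      by (intro has_integral_add has_integral_mult_right integrable_integral
          integrable_continuous_real continuous_intros q_cont \<eta>_cont)
  qed
  then show ?thesis unfolding family_def w_def by (simp add: integral_unique)
qed

lemma f_joint: "continuous_on ({crit_c..1} \<times> {0..1}) (\<lambda>z. f (fst z) (snd z))"
proof -
  have I: "continuous_on {-1..1} (\<lambda>x. integral {-1..x} g)" if "continuous_on {-1..1} g" for g :: "real \<Rightarrow> real"
    by (rule indefinite_integral_continuous_1) (rule integrable_continuous_real[OF that])
  have Iz: "continuous_on ({crit_c..1} \<times> {0..1}) (\<lambda>z. integral {-1..snd z} g)"
    if "continuous_on {-1..1} g" for g :: "real \<Rightarrow> real"
    by (rule continuous_on_compose2[OF I[OF that]]) (auto intro!: continuous_intros)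
  have "continuous_on {crit_c..1} eps0"
    unfolding eps0_def[abs_def]
    by (rule continuous_on_compose2[of Delta_star \<epsilon>])
      (use eps crit_order in \<open>auto simp: admissible_eps_def Delta_star_def intro!: continuous_intros\<close>)
  then have E: "continuous_on ({crit_c..1} \<times> {0..1::real}) (\<lambda>z. eps0 (fst z))"
    by (rule continuous_on_compose2) (auto intro!: continuous_intros)
  have Cf: "continuous_on ({crit_c..1} \<times> {0..1::real}) (\<lambda>z. coef (fst z) i)" for i
  proof -
    have "continuous_on ({crit_c..1} \<times> {0..1::real}) (\<lambda>z. delta i (fst z) (- fst z))"
      by (cases i) (auto intro!: continuous_intros)
    then show ?thesis unfolding coef_def using E by (intro continuous_intros)
  qed
  show ?thesis
  proof (rule continuous_on_eq)
    show "f (fst z) (snd z) = f (fst z) (snd z)" for z by simp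
    have "continuous_on ({crit_c..1} \<times> {0..1}) (\<lambda>z. -1 + (eps0 (fst z) * integral {-1..snd z} (q l) +
      (coef (fst z) Lft * integral {-1..snd z} (\<lambda>t. \<eta> Lft t * q l t) +
       coef (fst z) Mid * integral {-1..snd z} (\<lambda>t. \<eta> Mid t * q l t) +
       coef (fst z) Rgt * integral {-1..snd z} (\<lambda>t. \<eta> Rgt t * q l t))))"
      by (intro continuous_intros E Cf Iz q_cont \<eta>_cont)
    then show "continuous_on ({crit_c..1} \<times> {0..1}) (\<lambda>z. f (fst z) (snd z))"
      by (rule continuous_on_eq) (use f_linear in auto)
  qed
qed

lemma fibonacci_member:
  obtains a where "0 < a" "a < 1" "fibonacci_combinatorics (f a) crit_d crit_c"
proof -
  \<comment> \<open>The left end \<open>a0\<close> of the parameter interval is taken to be the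
    critical point \<open>1/3\<close> itself.\<close>
  interpret bimodal_family f zero_pt crit_c crit_c
    by (rule bimodal_family.intro) (use half_bimodal_f f_joint crit_order(4,5) in auto)
  obtain a where a: "crit_c \<le> a" "a < 1" "\<And>k. a \<in> val_open crit_c (f a) k"
    using fibonacci_parameter by blast
  have a': "0 < a" "a \<le> 1" using a crit_order by auto
  obtain Lip where Lip: "0 \<le> Lip"
    "\<And>x y. 0 < x \<Longrightarrow> x < y \<Longrightarrow> y < 1 \<Longrightarrow> y < crit_c \<or> crit_c < x \<Longrightarrow>
       (w a x * q l x) * (w a y * q l y) * (x - y)\<^sup>2 \<le> exp (Lip * (y - x)) * (f a x - f a y)\<^sup>2"
    using f_distortion[OF a'] by blast
  interpret half_bimodal "f a" crit_c "zero_pt a" a by (rule half_bimodal_f[OF a'])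
  interpret odd_fib_map "f a" crit_c "zero_pt a" a "\<lambda>x. w a x * q l x" Lip
    by unfold_locales (use a(3) Lip f_deriv_at[of _ a] f_odd[of _ a] in auto)
  have "fibonacci_combinatorics (f a) (- crit_c) crit_c"
    using f_bimodal[OF a'] crit_order by (intro fibonacci_combinatorics) auto
  then show thesis using that[of a] a' a(2) crit_order by simp
qed

end

section \<open>Critical order\<close>

text \<open>Unlike \<open>Ck_on\<close>, which iterates \<open>deriv\<close>, this recursion asks
  for some derivative function, so that products and compositions go by induction;
  \<open>Ck_on_if_Ck\<close> translates back.\<close>

primrec Ck :: "nat \<Rightarrow> (real \<Rightarrow> real) \<Rightarrow> real set \<Rightarrow> bool" where
  "Ck 0 f S \<longleftrightarrow> continuous_on S f"
| "Ck (Suc k) f S \<longleftrightarrow> (\<exists>f'. (\<forall>x\<in>S. (f has_real_derivative f' x) (at x)) \<and> Ck k f' S)"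

lemma Ck_SucI: "(\<And>x. x \<in> S \<Longrightarrow> (f has_real_derivative f' x) (at x)) \<Longrightarrow> Ck k f' S \<Longrightarrow> Ck (Suc k) f S"
  by auto

lemma continuous_on_if_deriv:
  fixes f :: "real \<Rightarrow> real"
  assumes "\<And>x. x \<in> S \<Longrightarrow> (f has_real_derivative f' x) (at x)" shows "continuous_on S f"
  by (rule DERIV_continuous_on) (rule has_field_derivative_at_within[OF assms])

lemma Ck_Suc_imp: "Ck (Suc k) f S \<Longrightarrow> Ck k f S"
proof (induction k arbitrary: f)
  case 0
  then show ?case using continuous_on_if_deriv by auto
next
  case (Suc k)
  then show ?case unfolding Ck.simps(2)[of "Suc k"] Ck.simps(2)[of k f] by blast
qed

lemma Ck_const: "Ck k (\<lambda>x. a) S"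
  by (induction k arbitrary: a) (auto intro!: exI[of _ "\<lambda>x. 0"])

lemma Ck_id: "Ck k (\<lambda>x. x) S"
proof (cases k)
  case (Suc j)
  have "Ck (Suc j) (\<lambda>x. x) S"
    by (rule Ck_SucI[where f' = "\<lambda>x. 1"]) (auto intro: Ck_const)
  then show ?thesis using Suc by simp
qed simp

lemma Ck_add: "Ck k f S \<Longrightarrow> Ck k g S \<Longrightarrow> Ck k (\<lambda>x. f x + g x) S"
proof (induction k arbitrary: f g)
  case (Suc k)
  then obtain f' g' where "\<forall>x\<in>S. (f has_real_derivative f' x) (at x)" "Ck k f' S"
    "\<forall>x\<in>S. (g has_real_derivative g' x) (at x)" "Ck k g' S" by auto
  then show ?case using Suc.IH[of f' g']
    by (intro Ck_SucI[where f' = "\<lambda>x. f' x + g' x"]) (auto intro: DERIV_add)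
qed (auto intro: continuous_on_add)

lemma Ck_mult: "Ck k f S \<Longrightarrow> Ck k g S \<Longrightarrow> Ck k (\<lambda>x. f x * g x) S"
proof (induction k arbitrary: f g)
  case (Suc k)
  then obtain f' g' where d: "\<forall>x\<in>S. (f has_real_derivative f' x) (at x)" "Ck k f' S"
    "\<forall>x\<in>S. (g has_real_derivative g' x) (at x)" "Ck k g' S" by auto
  have "Ck k (\<lambda>x. f' x * g x + g' x * f x) S"
    using d Suc Ck_Suc_imp by (intro Ck_add Suc.IH) auto
  then show ?case using d
    by (intro Ck_SucI[where f' = "\<lambda>x. f' x * g x + g' x * f x"]) (auto intro: DERIV_mult)
qed (auto intro: continuous_on_mult)

lemma Ck_compose: "Ck k f T \<Longrightarrow> Ck k g S \<Longrightarrow> g ` S \<subseteq> T \<Longrightarrow> Ck k (\<lambda>x. f (g x)) S"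
proof (induction k arbitrary: f g)
  case 0
  then show ?case by (auto intro: continuous_on_compose2)
next
  case (Suc k)
  then obtain f' g' where d: "\<forall>x\<in>T. (f has_real_derivative f' x) (at x)" "Ck k f' T"
    "\<forall>x\<in>S. (g has_real_derivative g' x) (at x)" "Ck k g' S" by auto
  have "Ck k (\<lambda>x. f' (g x) * g' x) S"
    by (rule Ck_mult[OF Suc.IH[OF d(2) Ck_Suc_imp[OF Suc.prems(2)] Suc.prems(3)] d(4)])
  then show ?case
  proof (rule Ck_SucI[rotated])
    fix x assume "x \<in> S"
    then show "((\<lambda>x. f (g x)) has_real_derivative f' (g x) * g' x) (at x)"
      using d(1,3) Suc.prems(3) by (intro DERIV_chain2) auto
  qed
qed

lemma Ck_powr: "Ck k (\<lambda>x. x powr b) {0<..}"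
proof (induction k arbitrary: b)
  case 0
  then show ?case by (auto intro!: continuous_intros)
next
  case (Suc k)
  show ?case
    by (rule Ck_SucI[where f' = "\<lambda>x. b * x powr (b - 1)"])
      (auto intro!: has_real_derivative_powr Ck_mult Ck_const Suc)
qed

text \<open>Bootstrapping: once \<open>h\<close> is of class \<open>k\<close>, so is its derivative,
  the reciprocal of \<open>g (h x)\<close>, and the class rises by one. The reciprocal is written as
  a power to reuse \<open>Ck_powr\<close>.\<close>

lemma Ck_inverse_function:
  assumes S: "open S" and k: "Ck k g T" and T: "h ` S \<subseteq> T" and pos: "\<And>y. y \<in> T \<Longrightarrow> 0 < g y"
    and d: "\<And>x. x \<in> S \<Longrightarrow> (h has_real_derivative inverse (g (h x))) (at x)"
  shows "Ck (Suc k) h S"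
  using k
proof (induction k)
  case 0
  have ch: "continuous_on S h" by (rule continuous_on_if_deriv) (rule d)
  have "continuous_on S (\<lambda>x. g (h x))" using continuous_on_compose2[OF _ ch T] 0 by simp
  moreover have "g (h x) \<noteq> 0" if "x \<in> S" for x using pos[of "h x"] T that by auto
  ultimately show ?case using d
    by (intro Ck_SucI[where f' = "\<lambda>x. inverse (g (h x))"]) (auto intro: continuous_on_inverse)
next
  case (Suc k)
  have g: "Ck (Suc k) g T" using Suc.prems .
  have h: "Ck (Suc k) h S" using Suc.IH Ck_Suc_imp[OF g] by blast
  have C: "Ck (Suc k) (\<lambda>x. (g (h x)) powr (-1)) S"
    by (rule Ck_compose[OF Ck_powr Ck_compose[OF g h T]]) (use pos T in auto)
  have "g (h x) powr (-1) = inverse (g (h x))" if "x \<in> S" for x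
    using pos[of "h x"] T that by (auto simp: powr_minus)
  then have "(h has_real_derivative (g (h x)) powr (-1)) (at x)" if "x \<in> S" for x
    using d[OF that] that by (simp only:)
  then show ?case using C by (rule Ck_SucI)
qed

text \<open>The iterated \<open>deriv\<close> depends only on germs, so on an open set it agrees
  with the chosen derivatives.\<close>

lemma Ck_on_if_Ck:
  assumes S: "open S" and k: "Ck k f S"
  shows "Ck_on k f S"
proof -
  have cong: "(deriv ^^ j) u x = (deriv ^^ j) v x"
    if "\<And>x. x \<in> S \<Longrightarrow> u x = v x" "x \<in> S" for j u v x
    using that(2)
  proof (induction j arbitrary: x)
    case (Suc j)
    have "eventually (\<lambda>y. (deriv ^^ j) u y = (deriv ^^ j) v y) (nhds x)"
      using eventually_nhds_in_open[OF S Suc.prems] by eventually_elim (rule Suc.IH)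
    then show ?case by (auto intro: deriv_cong_ev)
  qed (use that in auto)
  have "(\<forall>j<k. \<forall>x\<in>S. (deriv ^^ j) f differentiable (at x)) \<and> continuous_on S ((deriv ^^ k) f)"
    using k
  proof (induction k arbitrary: f)
    case (Suc k)
    then obtain f' where d: "\<And>x. x \<in> S \<Longrightarrow> (f has_real_derivative f' x) (at x)" "Ck k f' S"
      unfolding Ck.simps by blast
    have e: "deriv f x = f' x" if "x \<in> S" for x using d(1)[OF that] by (rule DERIV_imp_deriv)
    have ej: "(deriv ^^ Suc j) f x = (deriv ^^ j) f' x" if "x \<in> S" for j x
      unfolding funpow_Suc_right o_def by (rule cong[OF e that])
    note IH = Suc.IH[OF d(2)]
    have "(deriv ^^ j) f differentiable (at x)" if "j < Suc k" "x \<in> S" for j x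
    proof (cases j)
      case 0
      then show ?thesis using d(1)[OF that(2)] by (auto simp: real_differentiable_def)
    next
      case (Suc i)
      have "(deriv ^^ i) f' differentiable (at x)" using IH that Suc by auto
      then obtain D where "((deriv ^^ i) f' has_real_derivative D) (at x)" by (auto simp: real_differentiable_def)
      moreover have "eventually (\<lambda>y. (deriv ^^ j) f y = (deriv ^^ i) f' y) (nhds x)"
        using eventually_nhds_in_open[OF S that(2)] unfolding Suc by eventually_elim (rule ej)
      ultimately have "((deriv ^^ j) f has_real_derivative D) (at x)"
        using DERIV_cong_ev[OF refl _ refl] by blast
      then show ?thesis by (auto simp: real_differentiable_def)
    qed
    moreover have "continuous_on S ((deriv ^^ Suc k) f)"
      by (rule continuous_on_eq[OF conjunct2[OF IH]]) (rule ej[symmetric])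
    ultimately show ?case by blast
  qed simp
  then show ?thesis
    using S unfolding Ck_on_def differentiable_on_def
    by (auto intro: differentiable_at_withinI)
qed

text \<open>Substituting \<open>t = s * y\<close> in the integral of
  \<open>t * |t| powr (l - 2) * (2/3 + t) powr (l - 1)\<close> from 0 to \<open>y\<close> takes out
  \<open>|y| powr l\<close> and leaves the moment with \<open>r = b = l - 1\<close>;
  \<open>2/3\<close> is the distance of the critical points. General exponents make the class closed
  under differentiation up to constant factors.\<close>

definition power_moment :: "real \<Rightarrow> real \<Rightarrow> real \<Rightarrow> real" where
  "power_moment r b y = integral {0..1} (\<lambda>s. s powr r * (2/3 + s * y) powr b)"

lemma power_moment_base: "s \<in> {0..1} \<Longrightarrow> y \<in> {-1/3<..<1/3} \<Longrightarrow> 0 < 2/3 + s * y" for s y :: real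
proof -
  assume *: "s \<in> {0..1}" "y \<in> {-1/3<..<1/3}"
  have "\<bar>s * y\<bar> \<le> 1 * \<bar>y\<bar>" unfolding abs_mult using * by (intro mult_right_mono) auto
  then show ?thesis using * by (auto simp: abs_if split: if_splits)
qed

lemma power_moment_integrand_cont:
  assumes "r > 0"
  shows "continuous_on ({-1/3<..<1/3::real} \<times> {0..1}) (\<lambda>(y, s). s powr r * (2/3 + s * y) powr b)"
  unfolding case_prod_unfold
proof (rule continuous_on_mult; rule continuous_on_powr')
  show "\<forall>x\<in>{-1/3<..<1/3::real} \<times> {0..1}. 0 \<le> 2/3 + snd x * fst x \<and> (2/3 + snd x * fst x = 0 \<longrightarrow> 0 < b)"
  proof
    fix x :: "real \<times> real" assume "x \<in> {-1/3<..<1/3} \<times> {0..1}"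
    then have "0 < 2/3 + snd x * fst x" using power_moment_base[of "snd x" "fst x"] by auto
    then show "0 \<le> 2/3 + snd x * fst x \<and> (2/3 + snd x * fst x = 0 \<longrightarrow> 0 < b)" by linarith
  qed
qed (use assms in \<open>auto intro!: continuous_intros\<close>)

lemma power_moment_integrand_cont':
  fixes y :: real
  assumes "r > 0" "y \<in> {-1/3<..<1/3}"
  shows "continuous_on {0..1} (\<lambda>s. s powr r * (2/3 + s * y) powr b)"
proof -
  have c: "continuous_on {0..1} (\<lambda>s::real. (y, s))" by (intro continuous_intros)
  have sub: "(\<lambda>s. (y, s)) ` {0..1} \<subseteq> {-1/3<..<1/3::real} \<times> {0..1::real}" using assms(2) by auto
  show ?thesis
    using continuous_on_compose2[OF power_moment_integrand_cont[OF assms(1), of b] c sub] by simp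
qed

lemma power_moment_deriv:
  assumes "r > 0" "y \<in> {-1/3<..<1/3}"
  shows "(power_moment r b has_real_derivative b * power_moment (r + 1) (b - 1) y) (at y)"
proof -
  define U where "U = {-1/3<..<1/3::real}"
  have "((\<lambda>y. integral (cbox 0 1) (\<lambda>s. s powr r * (2/3 + s * y) powr b)) has_real_derivative
      integral (cbox 0 1) (\<lambda>s. b * (s powr (r + 1) * (2/3 + s * y) powr (b - 1)))) (at y within U)"
  proof (rule leibniz_rule_field_derivative)
    fix y s :: real assume *: "y \<in> U" "s \<in> cbox 0 1"
    have b: "0 < 2/3 + s * y" using power_moment_base * by (auto simp: U_def)
    have s: "s powr r * s = s powr (r + 1)" using * by (cases "s = 0") (auto simp: powr_add)
    have "((\<lambda>y. s powr r * (2/3 + s * y) powr b) has_real_derivative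
        s powr r * (b * (2/3 + s * y) powr (b - 1) * s)) (at y within U)"
      using b by (auto intro!: derivative_eq_intros simp: powr_diff field_simps)
    then show "((\<lambda>y. s powr r * (2/3 + s * y) powr b) has_real_derivative
        b * (s powr (r + 1) * (2/3 + s * y) powr (b - 1))) (at y within U)"
      by (simp add: s[symmetric] mult_ac)
  next
    show "(\<lambda>s. s powr r * (2/3 + s * y) powr b) integrable_on cbox 0 1" if "y \<in> U" for y
      using power_moment_integrand_cont'[OF assms(1)] that
      by (auto intro!: integrable_continuous_real simp: U_def)
    have "continuous_on (U \<times> {0..1}) (\<lambda>z. b * (case z of (y, s) \<Rightarrow> s powr (r + 1) * (2/3 + s * y) powr (b - 1)))"
      unfolding U_def using assms by (intro continuous_intros power_moment_integrand_cont) auto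
    then show "continuous_on (U \<times> cbox 0 1) (\<lambda>(y, s). b * (s powr (r + 1) * (2/3 + s * y) powr (b - 1)))"
      by (simp add: case_prod_unfold)
  qed (use assms in \<open>auto simp: U_def\<close>)
  moreover have "at y within U = at y" using assms by (intro at_within_open) (auto simp: U_def)
  ultimately show ?thesis by (simp add: power_moment_def[abs_def])
qed

lemma Ck_power_moment: "r > 0 \<Longrightarrow> Ck k (power_moment r b) {-1/3<..<1/3}"
proof (induction k arbitrary: r b)
  case 0
  show ?case unfolding Ck.simps by (rule continuous_on_if_deriv) (rule power_moment_deriv[OF 0])
next
  case (Suc k)
  show ?case
    by (rule Ck_SucI[where f' = "\<lambda>y. b * power_moment (r + 1) (b - 1) y"])
      (use Suc power_moment_deriv in \<open>auto intro!: Ck_mult Ck_const\<close>)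
qed

text \<open>A continuous nonnegative integrand with integral 0 would vanish everywhere, but at
  \<open>s = 1\<close> it does not.\<close>

lemma power_moment_pos:
  assumes "r > 0" "y \<in> {-1/3<..<1/3}" shows "0 < power_moment r b y"
proof -
  have "0 \<le> power_moment r b y" unfolding power_moment_def by (rule integral_nonneg)
    (use power_moment_integrand_cont'[OF assms] in \<open>auto intro: integrable_continuous_real\<close>)
  moreover have "power_moment r b y \<noteq> 0"
  proof
    assume "power_moment r b y = 0"
    moreover have "((\<lambda>s. s powr r * (2/3 + s * y) powr b) has_integral power_moment r b y) {0..1}"
      unfolding power_moment_def
      by (intro integrable_integral integrable_continuous_real power_moment_integrand_cont'[OF assms])
    ultimately have "((\<lambda>s. s powr r * (2/3 + s * y) powr b) has_integral 0) (cbox 0 1)" by simp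
    from has_integral_0_cbox_imp_0[OF _ _ this, of 1] power_moment_integrand_cont'[OF assms]
      power_moment_base[OF _ assms(2), of 1]
    show False by auto
  qed
  ultimately show ?thesis by simp
qed

text \<open>Integration by parts: the derivative of \<open>s powr l * (2/3 + s * y) powr (l - 1)\<close> in \<open>s\<close>.\<close>

lemma power_moment_ode:
  assumes l: "l > 1" and y: "y \<in> {-1/3<..<1/3}"
  shows "l * power_moment (l - 1) (l - 1) y + y * ((l - 1) * power_moment l (l - 2) y) = (2/3 + y) powr (l - 1)"
proof -
  define A where "A s = s powr (l - 1) * (2/3 + s * y) powr (l - 1)" for s
  define B where "B s = s powr l * (2/3 + s * y) powr (l - 2)" for s
  have i1: "((\<lambda>s. l * A s + y * ((l - 1) * B s)) has_integral
     1 powr l * (2/3 + 1 * y) powr (l - 1) - 0 powr l * (2/3 + 0 * y) powr (l - 1)) {0..1}"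
  proof (rule fundamental_theorem_of_calculus_interior)
    show "continuous_on {0..1} (\<lambda>s. s powr l * (2/3 + s * y) powr (l - 1))"
      using power_moment_integrand_cont'[of l y "l - 1"] l y by simp
    fix s :: real assume s: "s \<in> {0<..<1}"
    have b: "0 < 2/3 + s * y" using power_moment_base[of s y] s y by auto
    have "((\<lambda>s. s powr l * (2/3 + s * y) powr (l - 1)) has_real_derivative
       (l * s powr (l - 1)) * (2/3 + s * y) powr (l - 1) + ((l - 1) * (2/3 + s * y) powr (l - 1 - 1) * y) * s powr l) (at s)"
      using b s by (intro DERIV_mult has_real_derivative_powr DERIV_fun_powr[THEN DERIV_cong])
        (auto intro!: derivative_eq_intros)
    then show "((\<lambda>s. s powr l * (2/3 + s * y) powr (l - 1)) has_vector_derivative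
       l * A s + y * ((l - 1) * B s)) (at s)"
      by (simp add: has_real_derivative_iff_has_vector_derivative[symmetric] A_def B_def algebra_simps)
  qed simp
  have i2: "((\<lambda>s. l * A s + y * ((l - 1) * B s)) has_integral
     l * power_moment (l - 1) (l - 1) y + y * ((l - 1) * power_moment l (l - 2) y)) {0..1}"
    unfolding A_def B_def power_moment_def using l y
    by (intro has_integral_add has_integral_mult_right integrable_integral
        integrable_continuous_real power_moment_integrand_cont') auto
  show ?thesis using has_integral_unique[OF i2 i1] l by simp
qed

text \<open>The inverse function theorem in dimension one, global on \<open>S\<close> because a
  positive derivative on a connected set gives monotonicity.\<close>

lemma homeomorphism_inverse_deriv:
  fixes g g' :: "real \<Rightarrow> real"
  assumes S: "open S" "connected S" and d: "\<And>x. x \<in> S \<Longrightarrow> (g has_real_derivative g' x) (at x)"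
    and pos: "\<And>x. x \<in> S \<Longrightarrow> 0 < g' x"
  obtains h where "homeomorphism S (g ` S) g h" "open (g ` S)"
    "\<And>t. t \<in> g ` S \<Longrightarrow> (h has_real_derivative inverse (g' (h t))) (at t)"
proof -
  have cont: "continuous_on S g" by (rule continuous_on_if_deriv) (rule d)
  have less: "g x < g y" if "x \<in> S" "y \<in> S" "x < y" for x y
  proof (rule DERIV_pos_imp_increasing[OF that(3)])
    fix z assume "x \<le> z" "z \<le> y"
    then have "z \<in> S" using connected_contains_Icc[OF S(2) that(1,2)] by auto
    then show "\<exists>D. (g has_real_derivative D) (at z) \<and> 0 < D" using d pos by blast
  qed
  have inj: "inj_on g S" by (rule linorder_inj_onI') (use less in force)
  have op: "open (g ` S)" using injective_into_1d_imp_open_map_UNIV[OF S(1) cont inj] by simp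
  have "path_connected S" using S connected_open_path_connected by blast
  then obtain h where h: "homeomorphism S (g ` S) g h"
    using injective_into_1d_eq_homeomorphism[OF cont] inj by blast
  have "(h has_real_derivative inverse (g' (h t))) (at t)" if t: "t \<in> g ` S" for t
  proof -
    have ht: "h t \<in> S" using h t by (auto simp: homeomorphism_def)
    obtain e where e: "e > 0" "ball t e \<subseteq> g ` S" using op t open_contains_ball by blast
    show ?thesis
    proof (rule DERIV_inverse_function[where f = g and g = h and x = t and a = "t - e" and b = "t + e"])
      show "(g has_real_derivative g' (h t)) (at (h t))" by (rule d[OF ht])
      show "g' (h t) \<noteq> 0" using pos[OF ht] by simp
      show "g (h y) = y" if "t - e < y" "y < t + e" for y
      proof -
        have "y \<in> ball t e" using that by (simp add: dist_real_def abs_less_iff)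
        then show ?thesis using e h by (auto simp: homeomorphism_def)
      qed
      have "continuous_on (g ` S) h" using h by (simp add: homeomorphism_def)
      then show "isCont h t" using continuous_on_eq_continuous_at[OF op] t by blast
    qed (use e in auto)
  qed
  then show thesis using that h op by blast
qed

section \<open>The power law at the critical points\<close>

context odd_family
begin

text \<open>The closed supports of the bumps lie in the open laps and so have positive distance from
  \<open>crit_c\<close>. The bound \<open>1/3\<close> keeps \<open>crit_c + y\<close> between 0 and
  \<open>2/3\<close> and \<open>y\<close> in the domain of the moments.\<close>

lemma w_const_near_crit:
  obtains r where "0 < r" "r \<le> 1/3" "\<And>y. y \<in> {-r<..<r} \<Longrightarrow> w a (crit_c + y) = eps0 a"
proof -
  have nc: "crit_c \<in> - closure {x. \<eta> i x \<noteq> 0}" for i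
  proof -
    have "closure {x. \<eta> i x \<noteq> 0} \<subseteq> lap_interior i" using bumps by (simp add: admissible_bumps_def)
    moreover have "crit_c \<notin> lap_interior i" by (cases i) (auto simp: crit_d_def crit_c_def)
    ultimately show ?thesis by blast
  qed
  have "\<exists>e>0. ball crit_c e \<subseteq> - closure {x. \<eta> i x \<noteq> 0}" for i
    by (rule openE[OF open_Compl[OF closed_closure] nc]) blast
  then obtain e where e: "\<And>i. 0 < e i" "\<And>i. ball crit_c (e i) \<subseteq> - closure {x. \<eta> i x \<noteq> 0}" by metis
  define r where "r = min (1/3) (min (e Lft) (min (e Mid) (e Rgt)))"
  have "w a (crit_c + y) = eps0 a" if "y \<in> {-r<..<r}" for y
  proof -
    have "\<eta> i (crit_c + y) = 0" for i
    proof -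
      have "\<bar>y\<bar> < e i" using that by (cases i) (auto simp: r_def)
      then have "crit_c + y \<in> ball crit_c (e i)" by (simp add: dist_real_def)
      then have "crit_c + y \<notin> closure {x. \<eta> i x \<noteq> 0}" using e(2) by blast
      then show ?thesis using closure_subset[of "{x. \<eta> i x \<noteq> 0}"] by blast
    qed
    then show ?thesis by (simp add: w_eq)
  qed
  then show thesis using that[of r] e(1) by (auto simp: r_def)
qed

text \<open>Away from 0 the function \<open>P\<close> has derivative 0 by
  \<open>power_moment_ode\<close>, and it is continuous at 0, so it keeps the value
  \<open>f a crit_c\<close>.\<close>

lemma f_near_crit:
  assumes r: "0 < r" "r \<le> 1/3" and w: "\<And>y. y \<in> {-r<..<r} \<Longrightarrow> w a (crit_c + y) = eps0 a"
    and y: "y \<in> {-r<..<r}"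
  shows "f a (crit_c + y) = f a crit_c + \<bar>y\<bar> powr l * (eps0 a * power_moment (l - 1) (l - 1) y)"
proof -
  define g where "g y = power_moment (l - 1) (l - 1) y" for y
  define g' where "g' y = (l - 1) * power_moment l (l - 2) y" for y
  define P where "P y = f a (crit_c + y) - \<bar>y\<bar> powr l * (eps0 a * g y)" for y
  have sub: "x \<in> {-1/3<..<1/3}" if "x \<in> {-r<..<r}" for x using that r by auto
  have dg: "(g has_real_derivative g' x) (at x)" if "x \<in> {-r<..<r}" for x
    using power_moment_deriv[of "l - 1" x "l - 1"] l sub[OF that] unfolding g_def[abs_def] g'_def by simp
  have ode: "l * g x + x * g' x = (2/3 + x) powr (l - 1)" if "x \<in> {-r<..<r}" for x
    using power_moment_ode[of l x] l sub[OF that] by (simp add: g_def g'_def)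
  have df: "((\<lambda>y. f a (crit_c + y)) has_real_derivative eps0 a * (rho l x * (2/3 + x) powr (l - 1))) (at x)"
    if "x \<in> {-r<..<r}" for x
  proof -
    have b: "-1 < crit_c + x" "crit_c + x < 1" "0 < 2/3 + x" using that r by (auto simp: crit_c_def)
    have q: "q l (crit_c + x) = rho l x * (2/3 + x) powr (l - 1)"
    proof -
      have "rho l (2/3 + x) = (2/3 + x) powr (l - 1)"
        using abs_rho[of l "2/3 + x"] rho_pos[of "2/3 + x" l] b by simp
      moreover have "crit_c + x - crit_d = 2/3 + x" "crit_c + x - crit_c = x"
        by (simp_all add: crit_c_def crit_d_def)
      ultimately show ?thesis by (simp only: q_def mult.commute)
    qed
    have "((\<lambda>y. f a (crit_c + y)) has_real_derivative (w a (crit_c + x) * q l (crit_c + x)) * 1) (at x)"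
      by (rule DERIV_chain2[where f = "f a" and g = "\<lambda>y. crit_c + y"])
        (use b in \<open>auto intro!: f_deriv_at derivative_eq_intros\<close>)
    then show ?thesis using w[OF that] q by simp
  qed
  have dpow: "((\<lambda>x. \<bar>x\<bar> powr l) has_real_derivative l * rho l x) (at x)" if "x \<noteq> 0" for x
  proof (cases "x > 0")
    case True
    have "((\<lambda>x. x powr l) has_real_derivative l * x powr (l - 1)) (at x)" using True by (rule has_real_derivative_powr)
    moreover have "rho l x = x powr (l - 1)" using abs_rho[of l x] rho_pos[OF True, of l] True by simp
    moreover have "eventually (\<lambda>y. \<bar>y\<bar> powr l = y powr l) (nhds x)"
      using eventually_nhds_in_open[of "{0<..}" x] True by (auto elim: eventually_mono)
    ultimately show ?thesis by (subst DERIV_cong_ev[OF refl _ refl]) auto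
  next
    case False
    then have neg: "x < 0" using that by simp
    have "((\<lambda>x. (- x) powr l) has_real_derivative (l * (- x) powr (l - 1)) * (- 1)) (at x)"
      by (rule DERIV_chain2[where g = uminus]) (use neg in \<open>auto intro!: has_real_derivative_powr derivative_eq_intros\<close>)
    moreover have "rho l x = - ((- x) powr (l - 1))" using abs_rho[of l x] rho_neg[OF neg, of l] neg by simp
    moreover have "eventually (\<lambda>y. \<bar>y\<bar> powr l = (- y) powr l) (nhds x)"
      using eventually_nhds_in_open[of "{..<0}" x] neg by (auto elim: eventually_mono)
    ultimately show ?thesis by (subst DERIV_cong_ev[OF refl _ refl]) auto
  qed
  have abs_rho': "\<bar>x\<bar> powr l = x * rho l x" for x
  proof (cases "x = 0")
    case False
    have "\<bar>x\<bar> powr l = \<bar>x\<bar> powr (1 + (l - 1))" by simp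
    also have "\<dots> = \<bar>x\<bar> * \<bar>rho l x\<bar>" unfolding powr_add abs_rho using False by simp
    also have "\<dots> = x * rho l x" using rho_pos[of x l] rho_neg[of x l] False
      by (cases "x > 0") (auto simp: abs_mult[symmetric] mult_neg_neg abs_of_pos abs_of_neg)
    finally show ?thesis .
  qed (use l in \<open>simp add: rho_def\<close>)
  have dP: "(P has_real_derivative 0) (at x)" if x: "x \<in> {-r<..<r}" "x \<noteq> 0" for x
  proof -
    have "(P has_real_derivative eps0 a * (rho l x * (2/3 + x) powr (l - 1)) -
        (l * rho l x * (eps0 a * g x) + (eps0 a * g' x) * \<bar>x\<bar> powr l)) (at x)"
      unfolding P_def by (intro DERIV_diff df DERIV_mult dpow DERIV_cmult dg x)
    moreover have "eps0 a * (rho l x * (2/3 + x) powr (l - 1)) -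
        (l * rho l x * (eps0 a * g x) + (eps0 a * g' x) * \<bar>x\<bar> powr l) = 0"
      unfolding ode[OF x(1), symmetric] abs_rho' by (simp add: algebra_simps)
    ultimately show ?thesis by simp
  qed
  have cP: "continuous_on {-r<..<r} P"
    unfolding P_def using l
    by (intro continuous_intros continuous_on_if_deriv[OF df] continuous_on_if_deriv[OF dg]
        continuous_on_powr') auto
  have "P y = P 0"
  proof (cases y "0::real" rule: linorder_cases)
    case less
    have "P 0 = P y"
      by (rule DERIV_isconst2[of y 0 P]) (use less y dP in \<open>auto intro: continuous_on_subset[OF cP]\<close>)
    then show ?thesis by simp
  next
    case greater
    show ?thesis
      by (rule DERIV_isconst2[of 0 y P]) (use greater y dP in \<open>auto intro: continuous_on_subset[OF cP]\<close>)
  qed simp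
  then show ?thesis using l by (simp add: P_def g_def)
qed

text \<open>Oddness carries the coordinate at \<open>crit_c\<close> over to
  \<open>crit_d = - crit_c\<close>, hence the sign \<open>s\<close>. On the side of the values a
  translation suffices.\<close>

lemma f_critical_order:
  assumes a: "0 < a" "a \<le> 1" and s: "s = 1 \<or> s = (-1 :: real)"
  shows "has_critical_order (f a) (s * crit_c) l"
proof -
  obtain r where r: "0 < r" "r \<le> 1/3" and w: "\<And>y. y \<in> {-r<..<r} \<Longrightarrow> w a (crit_c + y) = eps0 a"
    using w_const_near_crit by blast
  define S where "S = {-r<..<r}"
  define g where "g y = eps0 a * power_moment (l - 1) (l - 1) y" for y
  define z where "z y = y * g y powr (1 / l)" for y
  \<comment> \<open>The derivative of \<open>z\<close>: by \<open>power_moment_ode\<close> the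
    factor \<open>l * g y + y * G\<close> collapses to
    \<open>eps0 a * (2/3 + y) powr (l - 1)\<close>, which makes it a product of positive factors on
    all of \<open>S\<close>.\<close>
  define z' where "z' y = (eps0 a / l) * (g y powr (1 / l - 1) * (2/3 + y) powr (l - 1))" for y
  have e: "0 < eps0 a" using eps0_pos a by simp
  have sub: "S \<subseteq> {-1/3<..<1/3}" using r by (auto simp: S_def)
  have gpos: "0 < g y" if "y \<in> S" for y
    using power_moment_pos[of "l - 1" y "l - 1"] l e sub that by (auto simp: g_def)
  have base: "0 < 2/3 + y" if "y \<in> S" for y using that r by (auto simp: S_def)
  have z'pos: "0 < z' y" if "y \<in> S" for y
    using gpos[OF that] base[OF that] e l by (simp add: z'_def)
  have dz: "(z has_real_derivative z' y) (at y)" if y: "y \<in> S" for y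
  proof -
    have y': "y \<in> {-1/3<..<1/3}" using sub y by blast
    define G where "G = eps0 a * ((l - 1) * power_moment l (l - 2) y)"
    have dg: "(g has_real_derivative G) (at y)"
      unfolding g_def[abs_def] G_def using power_moment_deriv[of "l - 1" y "l - 1"] l y'
      by (intro DERIV_cmult) simp
    have "((\<lambda>y. g y powr (1 / l)) has_real_derivative (1 / l) * g y powr (1 / l - 1) * G) (at y)"
      using DERIV_fun_powr[OF dg gpos[OF y], of "1 / l"] by simp
    from DERIV_mult[OF DERIV_ident this]
    have "(z has_real_derivative 1 * g y powr (1 / l) + (1 / l) * g y powr (1 / l - 1) * G * y) (at y)"
      unfolding z_def[abs_def] by simp
    moreover have "1 * g y powr (1 / l) + (1 / l) * g y powr (1 / l - 1) * G * y = z' y"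
    proof -
      have "g y powr (1 / l) = g y powr (1 / l - 1) * g y"
        using gpos[OF y] by (simp add: powr_diff)
      then have "1 * g y powr (1 / l) + (1 / l) * g y powr (1 / l - 1) * G * y =
          g y powr (1 / l - 1) * (l * g y + y * G) / l"
        using l by (simp add: field_simps)
      also have "l * g y + y * G = eps0 a * (2/3 + y) powr (l - 1)"
        using power_moment_ode[of l y] l y' by (simp add: g_def G_def algebra_simps) (metis distrib_left mult.left_commute)
      finally show ?thesis by (simp add: z'_def)
    qed
    ultimately show ?thesis by simp
  qed
  have Ckg: "Ck k g S" for k
  proof -
    have "Ck k (power_moment (l - 1) (l - 1)) {-1/3<..<1/3}" using l by (intro Ck_power_moment) simp
    then have "Ck k (\<lambda>y. power_moment (l - 1) (l - 1) y) S"
      using Ck_compose[OF _ Ck_id[of k S]] sub by simp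
    then show ?thesis unfolding g_def[abs_def] by (intro Ck_mult Ck_const)
  qed
  have Ckp: "Ck k (\<lambda>y. g y powr b) S" for k b
    by (rule Ck_compose[OF Ck_powr Ckg]) (use gpos in auto)
  have Ckz': "Ck k z' S" for k
  proof -
    have "Ck k (\<lambda>y. (2/3 + y) powr (l - 1)) S"
      by (rule Ck_compose[OF Ck_powr Ck_add[OF Ck_const Ck_id]]) (use base in auto)
    then show ?thesis unfolding z'_def[abs_def] by (intro Ck_mult Ck_const Ckp)
  qed
  have Ckz: "Ck k z S" for k unfolding z_def[abs_def] by (intro Ck_mult Ck_id Ckp)
  have oS: "open S" "connected S" by (auto simp: S_def)
  obtain h where h: "homeomorphism S (z ` S) z h" "open (z ` S)"
    "\<And>t. t \<in> z ` S \<Longrightarrow> (h has_real_derivative inverse (z' (h t))) (at t)"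
    using homeomorphism_inverse_deriv[OF oS dz z'pos] by blast
  have hS: "h ` (z ` S) \<subseteq> S" using h(1) by (simp add: homeomorphism_def)
  have Ckh: "Ck (Suc k) h (z ` S)" for k
    by (rule Ck_inverse_function[OF h(2) Ckz' hS z'pos h(3)])
  define V where "V = (\<lambda>y. s * (crit_c + y)) ` S"
  define \<phi> where "\<phi> t = s * (crit_c + h t)" for t
  define \<phi>' where "\<phi>' x = z (s * x - crit_c)" for x
  have ss: "s * (s * x) = x" for x using s by auto
  have V_iff: "x \<in> V \<longleftrightarrow> s * x - crit_c \<in> S" for x
  proof
    assume "s * x - crit_c \<in> S"
    moreover have "x = s * (crit_c + (s * x - crit_c))" by (simp add: ss)
    ultimately show "x \<in> V" unfolding V_def by blast
  qed (auto simp: V_def ss)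
  have oV: "open V"
  proof -
    have "V = (\<lambda>x. s * x - crit_c) -` S" using V_iff by auto
    then show ?thesis using oS(1) by (auto intro!: open_vimage continuous_intros)
  qed
  have Ck\<phi>: "Ck 3 \<phi> (z ` S)" unfolding \<phi>_def[abs_def] numeral_3_eq_3
    by (intro Ck_mult Ck_add Ck_const Ckh)
  have Ck\<phi>': "Ck 3 \<phi>' V"
  proof -
    have "Ck 3 (\<lambda>x. z (s * x + (- crit_c))) V"
      by (rule Ck_compose[OF Ckz Ck_add[OF Ck_mult[OF Ck_const Ck_id] Ck_const]]) (use V_iff in auto)
    then show ?thesis by (simp add: \<phi>'_def[abs_def])
  qed
  have hom: "homeomorphism (z ` S) V \<phi> \<phi>'"
  proof -
    have *: "\<And>x. x \<in> S \<Longrightarrow> h (z x) = x" "\<And>t. t \<in> z ` S \<Longrightarrow> z (h t) = t"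
      using h(1) by (auto simp: homeomorphism_def)
    have ims: "\<phi> ` (z ` S) = V" unfolding V_def \<phi>_def image_image using *(1) by auto
    have im': "\<phi>' ` V = z ` S" unfolding V_def \<phi>'_def image_image by (simp add: ss)
    have "continuous_on (z ` S) \<phi>" using Ck_Suc_imp[OF Ck_Suc_imp[OF Ck_Suc_imp[OF Ck\<phi>[unfolded numeral_3_eq_3]]]] by simp
    moreover have "continuous_on V \<phi>'" using Ck_Suc_imp[OF Ck_Suc_imp[OF Ck_Suc_imp[OF Ck\<phi>'[unfolded numeral_3_eq_3]]]] by simp
    moreover have "\<phi>' (\<phi> t) = t" if "t \<in> z ` S" for t using *(2)[OF that] by (simp add: \<phi>_def \<phi>'_def ss)
    moreover have "\<phi> (\<phi>' x) = x" if "x \<in> V" for x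
      using *(1)[of "s * x - crit_c"] that V_iff[of x] by (simp add: \<phi>_def \<phi>'_def ss)
    ultimately show ?thesis using ims im' by (simp add: homeomorphism_def)
  qed
  have dif\<phi>: "Ck_diffeo 3 (z ` S) V \<phi> \<phi>'"
    unfolding Ck_diffeo_def using hom Ck_on_if_Ck[OF h(2) Ck\<phi>] Ck_on_if_Ck[OF oV Ck\<phi>'] by simp
  define \<psi> where "\<psi> t = t + f a (s * crit_c)" for t
  define \<psi>' where "\<psi>' t = t + - f a (s * crit_c)" for t
  have dif\<psi>: "Ck_diffeo 3 UNIV UNIV \<psi> \<psi>'"
  proof -
    have "Ck 3 \<psi> UNIV" "Ck 3 \<psi>' UNIV" unfolding \<psi>_def[abs_def] \<psi>'_def[abs_def]
      by (intro Ck_add Ck_id Ck_const)+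
    moreover have "homeomorphism UNIV UNIV \<psi> \<psi>'"
      by (rule homeomorphismI) (auto simp: \<psi>_def \<psi>'_def intro!: continuous_intros)
    ultimately show ?thesis unfolding Ck_diffeo_def by (auto intro: Ck_on_if_Ck)
  qed
  have S0: "0 \<in> S" and z0: "z 0 = 0" using r by (auto simp: S_def z_def)
  have U0: "0 \<in> z ` S" using S0 z0 by force
  have h0: "h 0 = 0" using h(1) S0 z0 by (auto simp: homeomorphism_def)
  have f_s: "f a (s * x) = s * f a x" if "-1 \<le> x" "x \<le> 1" for x
    using s f_odd[OF that, of a] by auto
  have val: "\<bar>\<psi>' (f a (\<phi> t))\<bar> = \<bar>t\<bar> powr l" if t: "t \<in> z ` S" for t
  proof -
    have ht: "h t \<in> S" "z (h t) = t" using h(1) t by (auto simp: homeomorphism_def)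
    have b: "-1 \<le> crit_c + h t" "crit_c + h t \<le> 1" "-1 \<le> crit_c" "crit_c \<le> 1"
      using ht r by (auto simp: S_def crit_c_def)
    have "f a (crit_c + h t) - f a crit_c = \<bar>h t\<bar> powr l * g (h t)"
      using f_near_crit[OF r w, of "h t"] ht by (simp add: S_def g_def)
    also have "\<dots> = (\<bar>h t\<bar> * g (h t) powr (1 / l)) powr l"
      using gpos[OF ht(1)] l by (simp add: powr_mult powr_powr)
    also have "\<bar>h t\<bar> * g (h t) powr (1 / l) = \<bar>t\<bar>"
      using arg_cong[OF ht(2), of abs] by (simp add: z_def abs_mult)
    finally have "f a (crit_c + h t) - f a crit_c = \<bar>t\<bar> powr l" .
    moreover have "\<psi>' (f a (\<phi> t)) = s * (f a (crit_c + h t) - f a crit_c)"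
      using f_s[OF b(1,2)] f_s[OF b(3,4)] by (simp add: \<psi>'_def \<phi>_def right_diff_distrib)
    ultimately show ?thesis using s by auto
  qed
  have "eventually (\<lambda>t. t \<in> z ` S) (nhds 0)" using h(2) U0 by (rule eventually_nhds_in_open)
  then have ev: "eventually (\<lambda>t. f a (\<phi> t) \<in> UNIV \<and> \<bar>\<psi>' (f a (\<phi> t))\<bar> = \<bar>t\<bar> powr l) (nhds 0)"
    by eventually_elim (simp add: val)
  have p0: "\<phi> 0 = s * crit_c" "\<psi> 0 = f a (s * crit_c)" by (auto simp: \<phi>_def \<psi>_def h0)
  show ?thesis
    unfolding has_critical_order_def
  proof (intro conjI exI)
    show "l > 1" using l by simp
    show "Ck_diffeo 3 (z ` S) V \<phi> \<phi>'" by fact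
    show "Ck_diffeo 3 UNIV UNIV \<psi> \<psi>'" by fact
  qed (use U0 p0 ev in auto)
qed

end

theorem proposition2:
  fixes l :: real
    and \<eta> :: "lap \<Rightarrow> real \<Rightarrow> real"
    and \<epsilon> :: "real \<times> real \<Rightarrow> real"
  assumes "l > 3"
    and "admissible_bumps l \<eta>"
    and "admissible_eps l \<epsilon>"
  shows "\<exists>a. 0 < a \<and> a < 1 \<and>
    bimodal (family l \<eta> \<epsilon> a (- a)) (-1/3) (1/3) \<and>
    positive_map (family l \<eta> \<epsilon> a (- a)) \<and>
    symmetric_map (family l \<eta> \<epsilon> a (- a)) \<and>
    fibonacci_combinatorics (family l \<eta> \<epsilon> a (- a)) (-1/3) (1/3) \<and>
    has_critical_order (family l \<eta> \<epsilon> a (- a)) (-1/3) l \<and>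
    has_critical_order (family l \<eta> \<epsilon> a (- a)) (1/3) l"
proof -
  interpret odd_family l \<eta> \<epsilon> by unfold_locales (fact assms)+
  obtain a where a: "0 < a" "a < 1" "fibonacci_combinatorics (f a) crit_d crit_c"
    using fibonacci_member by blast
  then have a': "0 < a" "a \<le> 1" by auto
  have "has_critical_order (f a) crit_c l" "has_critical_order (f a) crit_d l"
    using f_critical_order[OF a', of 1] f_critical_order[OF a', of "-1"] crit_order(6) by simp_all
  then show ?thesis
    using a f_bimodal[OF a'] unfolding crit_d_def crit_c_def by blast
qed

end
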